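(* There exists an algorithm that, given an instance $\mathbf{SG}=\langle G,k,\mathsf{init},\mathsf{fin}\rangle$ of Snake Game, solves $\mathbf{SG}$ (i.e., correctly decides whether $\mathsf{init}$ can reach $\mathsf{fin}$) in time $k^{\mathcal{O}(k)}|V(G)|^3\log^2|V(G)|$. Moreover, it finds a shortest path from $\mathsf{init}$ to $\mathsf{fin}$ (in the $1$-configuration graph) if one exists.
   Context: $\mathbb{N}=\{1,2,\dots\}$. Let $G$ be an undirected graph and $k\in\mathbb{N}$. A $(G,k)$-configuration (configuration) is a tuple $(v_1,\dots,v_k)$ of pairwise distinct vertices of $G$ with $\{v_i,v_{i+1}\}\in E(G)$ for all $1\le i\le k-1$ ($v_1$ is the head, $v_k$ the tail). A pair $(\mathsf{conf},\mathsf{conf}')$ of configurations $\mathsf{conf}=(v_1,\dots,v_k)$, $\mathsf{conf}'=(v'_1,\dots,v'_k)$ is a $1$-transition if $v'_1\ne v_i$ for all $1\le i\le k-1$ and $v'_i=v_{i-1}$ for all $2\le i\le k$. For $\ell\in\mathbb{N}$, $(\mathsf{conf},\mathsf{conf}')$ is an $\ell$-transition if there are configurations $\mathsf{conf}_1=\mathsf{conf},\mathsf{conf}_2,\dots,\mathsf{conf}_{\ell+1}=\mathsf{conf}'$ such that each $(\mathsf{conf}_i,\mathsf{conf}_{i+1})$ is a $1$-transition. $\mathsf{conf}$ can reach $\mathsf{conf}'$ if $(\mathsf{conf},\mathsf{conf}')$ is an $\ell$-transition for some $\ell\in\mathbb{N}$. An instance of Snake Game is $\langle G,k,\mathsf{init},\mathsf{fin}\rangle$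 where $G$ is an undirected graph, $k\in\mathbb{N}$ and $\mathsf{init},\mathsf{fin}$ are $(G,k)$-configurations; it is a Yes-instance iff $\mathsf{init}$ can reach $\mathsf{fin}$. The $1$-configuration graph is the directed graph whose vertices are all $(G,k)$-configurations, with an arc from $\mathsf{conf}$ to $\mathsf{conf}'$ iff $(\mathsf{conf},\mathsf{conf}')$ is a $1$-transition. *)

theory Defs
  imports Complex_Main "Graph_Theory.Graph_Theory"
begin

section \<open>Snake Game\<close>

text \<open>
  An undirected graph is a \<open>pair_graph\<close>, i.e. a finite, loop-free, symmetric set of pairs:
  the edge \<open>{u, v}\<close> is the pair of arcs \<open>(u, v)\<close>, \<open>(v, u)\<close>. Configurations are lists, indexed
  from 0, with the head of the snake first.
\<close>

definition configuration :: "'a pair_pre_digraph \<Rightarrow> nat \<Rightarrow> 'a list \<Rightarrow> bool" where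
  "configuration G k vs \<longleftrightarrow>
     length vs = k \<and> set vs \<subseteq> pverts G \<and> distinct vs \<and>
     (\<forall>i. Suc i < k \<longrightarrow> (vs ! i, vs ! Suc i) \<in> parcs G)"

definition one_transition :: "'a pair_pre_digraph \<Rightarrow> nat \<Rightarrow> 'a list \<Rightarrow> 'a list \<Rightarrow> bool" where
  "one_transition G k conf conf' \<longleftrightarrow>
     configuration G k conf \<and> configuration G k conf' \<and>
     (\<forall>i < k - 1. conf' ! 0 \<noteq> conf ! i) \<and>
     (\<forall>i. 1 \<le> i \<and> i < k \<longrightarrow> conf' ! i = conf ! (i - 1))"

definition l_transition :: "'a pair_pre_digraph \<Rightarrow> nat \<Rightarrow> nat \<Rightarrow> 'a list \<Rightarrow> 'a list \<Rightarrow> bool" where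
  "l_transition G k l conf conf' \<longleftrightarrow>
     (\<exists>confs. length confs = l + 1 \<and> (\<forall>c \<in> set confs. configuration G k c) \<and>
        confs ! 0 = conf \<and> confs ! l = conf' \<and>
        (\<forall>i < l. one_transition G k (confs ! i) (confs ! Suc i)))"

definition can_reach :: "'a pair_pre_digraph \<Rightarrow> nat \<Rightarrow> 'a list \<Rightarrow> 'a list \<Rightarrow> bool" where
  "can_reach G k conf conf' \<longleftrightarrow> (\<exists>l \<ge> 1. l_transition G k l conf conf')"

definition snake_instance :: "'a pair_pre_digraph \<Rightarrow> nat \<Rightarrow> 'a list \<Rightarrow> 'a list \<Rightarrow> bool" where
  "snake_instance G k init fin \<longleftrightarrow>
     pair_graph G \<and> 1 \<le> k \<and> configuration G k init \<and> configuration G k fin"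

definition config_graph :: "'a pair_pre_digraph \<Rightarrow> nat \<Rightarrow> 'a list pair_pre_digraph" where
  "config_graph G k =
     \<lparr> pverts = {c. configuration G k c},
       parcs = {(c, c'). one_transition G k c c'} \<rparr>"

text \<open>
  Paths have no repeated vertices, so for \<open>init = fin\<close> the shortest path is the trivial path
  \<open>[init]\<close>, whereas \<open>can_reach G k init init\<close> asks for a closed walk with at least one arc.
\<close>

definition shortest_path ::
  "'a pair_pre_digraph \<Rightarrow> nat \<Rightarrow> 'a list \<Rightarrow> 'a list \<Rightarrow> 'a list list \<Rightarrow> bool" where
  "shortest_path G k init fin p \<longleftrightarrow>
     is_arg_min vwalk_length
       (\<lambda>q. vpath q (with_proj (config_graph G k)) \<and> hd q = init \<and> last q = fin) p"

section \<open>Word RAM\<close>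

text \<open>
  Running time is measured on a word RAM, programmed in a structured language. A state consists of
  registers and a random-access memory, both holding natural numbers (words). Every elementary
  operation and every test of a condition takes unit time. The parameter \<open>W\<close> of the semantics is
  the largest number that fits into a word; an operation that would produce a larger number is
  stuck, so unit-cost arithmetic cannot be abused on huge numbers.
\<close>

datatype operator = Add | Sub | Mul | Div | Mod

primrec apply_op :: "operator \<Rightarrow> nat \<Rightarrow> nat \<Rightarrow> nat" where
  "apply_op Add x y = x + y"
| "apply_op Sub x y = x - y"
| "apply_op Mul x y = x * y"
| "apply_op Div x y = x div y"
| "apply_op Mod x y = x mod y"

datatype prog =
    Skip
  | Const nat nat
  | Calc operator nat nat nat
  | Load nat nat
  | Store nat nat
  | Seq prog prog
  | Cond nat prog prog
  | While nat prog

type_synonym state = "(nat \<Rightarrow> nat) \<times> (nat \<Rightarrow> nat)"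

text \<open>
  \<open>exec W c s t s'\<close>: started in state \<open>s\<close> (registers, memory), the program \<open>c\<close> halts after exactly
  \<open>t\<close> steps in state \<open>s'\<close>, all words staying at most \<open>W\<close>.
\<close>

inductive exec :: "nat \<Rightarrow> prog \<Rightarrow> state \<Rightarrow> nat \<Rightarrow> state \<Rightarrow> bool" for W :: nat where
  Skip:  "exec W Skip s 1 s"
| Const: "n \<le> W \<Longrightarrow> exec W (Const r n) (R, M) 1 (R(r := n), M)"
| Calc:  "apply_op f (R a) (R b) \<le> W \<Longrightarrow>
            exec W (Calc f r a b) (R, M) 1 (R(r := apply_op f (R a) (R b)), M)"
| Load:  "exec W (Load r a) (R, M) 1 (R(r := M (R a)), M)"
| Store: "exec W (Store a r) (R, M) 1 (R, M(R a := R r))"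
| Seq:   "exec W c1 s1 t1 s2 \<Longrightarrow> exec W c2 s2 t2 s3 \<Longrightarrow> exec W (Seq c1 c2) s1 (t1 + t2) s3"
| CondT: "R r \<noteq> 0 \<Longrightarrow> exec W c1 (R, M) t s \<Longrightarrow> exec W (Cond r c1 c2) (R, M) (t + 1) s"
| CondF: "R r = 0 \<Longrightarrow> exec W c2 (R, M) t s \<Longrightarrow> exec W (Cond r c1 c2) (R, M) (t + 1) s"
| WhileT: "R r \<noteq> 0 \<Longrightarrow> exec W c (R, M) t1 s2 \<Longrightarrow> exec W (While r c) s2 t2 s3 \<Longrightarrow>
            exec W (While r c) (R, M) (t1 + t2 + 1) s3"
| WhileF: "R r = 0 \<Longrightarrow> exec W (While r c) (R, M) 1 (R, M)"

inductive_cases exec_SkipE: "exec W Skip s t s'"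
inductive_cases exec_ConstE: "exec W (Const r n) s t s'"
inductive_cases exec_CalcE: "exec W (Calc f r a b) s t s'"
inductive_cases exec_LoadE: "exec W (Load r a) s t s'"
inductive_cases exec_StoreE: "exec W (Store a r) s t s'"
inductive_cases exec_SeqE: "exec W (Seq c1 c2) s t s'"
inductive_cases exec_CondE: "exec W (Cond r c1 c2) s t s'"
inductive_cases exec_WhileE: "exec W (While r c) s t s'"

lemma exec_deterministic:
  "exec W c s t s' \<Longrightarrow> exec W c s u s'' \<Longrightarrow> u = t \<and> s'' = s'"
proof (induction arbitrary: u s'' rule: exec.induct)
  case (Seq c1 s1 t1 s2 c2 t2 s3)
  from Seq.prems show ?case
  proof (rule exec_SeqE)
    fix t1' s2' t2'
    assume u: "u = t1' + t2'" and 1: "exec W c1 s1 t1' s2'" and 2: "exec W c2 s2' t2' s''"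
    from Seq.IH(1)[OF 1] have "t1' = t1" "s2' = s2" by simp_all
    with u Seq.IH(2)[of t2' s''] 2 show ?case by simp
  qed
next
  case (WhileT R r c M t1 s2 t2 s3)
  from WhileT.prems show ?case
  proof (rule exec_WhileE)
    fix R' M' t1' s2' t2'
    assume eq: "(R, M) = (R', M')" and u: "u = Suc (t1' + t2')"
      and 1: "exec W c (R', M') t1' s2'" and 2: "exec W (While r c) s2' t2' s''"
    from eq 1 have "exec W c (R, M) t1' s2'" by simp
    from WhileT.IH(1)[OF this] have "t1' = t1" "s2' = s2" by simp_all
    with u WhileT.IH(2)[of t2' s''] 2 show ?case by simp
  qed (use WhileT.hyps(1) in simp)
next
  case (CondT R r c1 M t s c2)
  from CondT.prems show ?case
    by (rule exec_CondE) (use CondT.hyps(1) CondT.IH in simp_all)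
next
  case (CondF R r c2 M t s c1)
  from CondF.prems show ?case
    by (rule exec_CondE) (use CondF.hyps(1) CondF.IH in simp_all)
next
  case (WhileF R r c M)
  from WhileF.prems show ?case
    by (rule exec_WhileE) (use WhileF.hyps in simp_all)
next
  case Skip
  then show ?case by (rule exec_SkipE) simp
next
  case Const
  from Const.prems show ?case by (rule exec_ConstE) simp
next
  case Calc
  from Calc.prems show ?case by (rule exec_CalcE) simp
next
  case Load
  from Load.prems show ?case by (rule exec_LoadE) simp
next
  case Store
  from Store.prems show ?case by (rule exec_StoreE) simp
qed

section \<open>Input and output\<close>

text \<open>
  The vertices are numbered \<open>0, ..., n - 1\<close> by an enumeration \<open>vs\<close> of the vertex set. The input
  consists of \<open>n\<close>, \<open>k\<close>, the adjacency matrix row by row and the vertices of the two configurations.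
  It is stored from address 0 on; all other memory cells and all registers are initially 0.
\<close>

definition index :: "'a list \<Rightarrow> 'a \<Rightarrow> nat" where
  "index vs = the_inv_into {..<length vs} ((!) vs)"

definition encode_instance ::
  "'a list \<Rightarrow> 'a pair_pre_digraph \<Rightarrow> nat \<Rightarrow> 'a list \<Rightarrow> 'a list \<Rightarrow> nat list" where
  "encode_instance vs G k init fin =
     [length vs, k] @
     [of_bool ((u, v) \<in> parcs G). u \<leftarrow> vs, v \<leftarrow> vs] @
     map (index vs) init @ map (index vs) fin"

definition initial_state :: "nat list \<Rightarrow> state" where
  "initial_state xs = ((\<lambda>_. 0), (\<lambda>a. if a < length xs then xs ! a else 0))"

text \<open>
  The output starts at address 0: the answer (1 for Yes, 0 for No), then the number of
  configurations on the path, then these configurations one after the other. The number of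
  configurations is 0 if there is no path.
\<close>

definition encode_answer :: "'a list \<Rightarrow> bool \<Rightarrow> 'a list list \<Rightarrow> nat list" where
  "encode_answer vs yes p = [of_bool yes, length p] @ map (index vs) (concat p)"

definition outputs :: "state \<Rightarrow> nat list \<Rightarrow> bool" where
  "outputs s xs \<longleftrightarrow> map (snd s) [0..<length xs] = xs"

definition correct_output ::
  "'a list \<Rightarrow> 'a pair_pre_digraph \<Rightarrow> nat \<Rightarrow> 'a list \<Rightarrow> 'a list \<Rightarrow> state \<Rightarrow> bool" where
  "correct_output vs G k init fin s \<longleftrightarrow>
     (if \<exists>p. shortest_path G k init fin p
      then \<exists>p. shortest_path G k init fin p \<and>
               outputs s (encode_answer vs (can_reach G k init fin) p)
      else outputs s (encode_answer vs (can_reach G k init fin) []))"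

text \<open>
  Words have \<open>O(k log k + log n)\<close> bits, as is needed to address the
  \<open>k^O(k) n^O(1)\<close> memory cells that can be used within the time bound.
\<close>

definition max_word :: "nat \<Rightarrow> nat \<Rightarrow> nat \<Rightarrow> nat" where
  "max_word c k n = c * (k ^ k * n) ^ c"

end

theory Submission
  imports Defs
begin

text \<open>
  A play of the snake is a walk each of whose windows of \<open>k\<close> consecutive vertices is a configuration.
  The future of a play depends on a configuration only through its head and through the set of
  conditions \<open>c ! i \<noteq> f j\<close> for \<open>i + j + 1 < k\<close>, where \<open>f j\<close> is the \<open>j\<close>-th vertex visited later. So a
  breadth-first search may discard a configuration as soon as every future it admits is admitted by
  a configuration with the same head that was found before. This is decided by branching: if no stored
  configuration admits \<open>f\<close>, each of them collides with \<open>f\<close> in some pair \<open>(i, j)\<close>, and at most \<open>k - 1\<close>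
  such pairs, written as a code with \<open>k\<close> digits in base \<open>k\<^sup>2\<close>, determine \<open>f\<close> as far as it matters. Hence at
  most \<open>n k^O(k)\<close> configurations are kept, and comparing every successor with the whole queue takes
  time \<open>k^O(k) n\<^sup>3\<close>, even without the logarithmic factor.

  The exchange argument may alter the last \<open>k\<close> vertices of the past, so the final configuration is not
  searched for itself: a shortest play of length at least \<open>k\<close> ends with \<open>k\<close> moves along the final
  configuration, started in a stored configuration that admits them, and a shorter play is determined
  by the initial and the final configuration.
\<close>

section \<open>Representative configurations\<close>

text \<open>A vertex in position \<open>i\<close> has drifted to position \<open>i + j\<close> when
  the later move \<open>j\<close> is made, and a move vacates only the last position; hence the
  condition \<open>i + j + 1 < k\<close> in \<open>compat\<close>. The obstacle is that a dense
  graph has about \<open>n ^ k\<close> configurations, so the discard test must leave few survivors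
  while every discarded configuration stays replaceable. \<open>needed\<close> achieves this without
  being exact: digits are guesses that nothing verifies, so a covered configuration may still be
  kept. Two one-sided facts suffice. A configuration rejected under every code has a representative
  for each of its futures, and an accepted one can be charged to a code that accepted it. Since the
  test looks at earlier entries only, entries are never removed, parents stay valid and the queue
  remains sorted by depth, which makes the first solution found a shortest one. Representation has
  to survive a move. Sharing the head transfers the next edge, and admitting a future that starts
  with the new head transfers the rest of its legality, so the same vertex can be played from the
  representative.\<close>

definition compat :: "nat \<Rightarrow> nat list \<Rightarrow> (nat \<Rightarrow> nat) \<Rightarrow> bool" where
  "compat k c f \<longleftrightarrow> (\<forall>i j. i + j + 1 < k \<longrightarrow> c ! i \<noteq> f j)"

text \<open>A recorded partial future \<open>X\<close> has \<open>X j = Suc v\<close> if its \<open>j\<close>-th vertex is \<open>v\<close> and \<open>X j = 0\<close> if that vertex is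
  still open.\<close>

definition admits :: "nat \<Rightarrow> (nat \<Rightarrow> nat) \<Rightarrow> nat list \<Rightarrow> bool" where
  "admits k X c \<longleftrightarrow> (\<forall>i j. i + j + 1 < k \<longrightarrow> X j \<noteq> Suc (c ! i))"

text \<open>A digit \<open>d\<close> guesses where the future collides with the entry: position
  \<open>d div k\<close> of the entry against move \<open>d mod k\<close>. Entries with another
  head, or already excluded by the record, consume no digit.\<close>

fun scan_step :: "nat \<Rightarrow> nat \<Rightarrow> nat list \<Rightarrow> (nat \<Rightarrow> nat) \<times> nat \<times> nat \<Rightarrow> (nat \<Rightarrow> nat) \<times> nat \<times> nat" where
  "scan_step k v c (X, p, m) =
     (if c ! 0 = v \<and> admits k X c
      then (X(p mod (k * k) mod k := Suc (c ! (p mod (k * k) div k))), p div (k * k), Suc m)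
      else (X, p, m))"

definition scan :: "nat \<Rightarrow> nat \<Rightarrow> nat list list \<Rightarrow> (nat \<Rightarrow> nat) \<times> nat \<times> nat \<Rightarrow> (nat \<Rightarrow> nat) \<times> nat \<times> nat" where
  "scan k v cs = fold (scan_step k v) cs"

abbreviation start :: "nat \<Rightarrow> (nat \<Rightarrow> nat) \<times> nat \<times> nat" where
  "start p \<equiv> (\<lambda>_. 0, p, 0)"

text \<open>The bound on the number of digits leaves only \<open>k\<close> values for the count,
  which the counting argument uses; a record that follows a genuine future stays below it, because
  each digit opens a new slot below \<open>k - 1\<close>.\<close>

definition accepts :: "nat \<Rightarrow> nat list list \<Rightarrow> nat list \<Rightarrow> nat \<Rightarrow> bool" where
  "accepts k cs b p \<longleftrightarrow> admits k (fst (scan k (b ! 0) cs (start p))) b \<and>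
     snd (snd (scan k (b ! 0) cs (start p))) < k"

definition codes :: "nat \<Rightarrow> nat" where "codes k = (k * k) ^ k"

definition needed :: "nat \<Rightarrow> nat list list \<Rightarrow> nat list \<Rightarrow> bool" where
  "needed k cs b \<longleftrightarrow> (\<exists>p < codes k. accepts k cs b p)"

lemma scan_Nil [simp]: "scan k v [] s = s"
  and scan_Cons: "scan k v (c # cs) s = scan k v cs (scan_step k v c s)"
  and scan_append: "scan k v (cs @ ds) s = scan k v ds (scan k v cs s)"
  by (simp_all add: scan_def)

lemma scan_count_mono: "m \<le> snd (snd (scan k v cs (X, p, m)))"
proof (induction cs arbitrary: X p m)
  case (Cons c cs)
  show ?case
    using Cons[of m] Suc_leD[OF Cons[of "Suc m"]] by (simp add: scan_Cons)
qed simp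

text \<open>A future \<open>f\<close> blocked by every stored entry dictates a code: each entry that still admits the
  recorded part \<open>X\<close> of \<open>f\<close> collides with \<open>f\<close> in a new position, which becomes the next digit.\<close>
lemma blocking_code:
  assumes "\<forall>c \<in> set cs. c ! 0 = v \<longrightarrow> \<not> compat k c f"
    and "\<forall>j. X j \<noteq> 0 \<longrightarrow> X j = Suc (f j)" and "{j. X j \<noteq> 0} \<subseteq> {..<k - 1}"
    and "card {j. X j \<noteq> 0} = m"
  shows "\<exists>p < (k * k) ^ (k - 1 - m). (\<forall>j. fst (scan k v cs (X, p, m)) j \<noteq> 0 \<longrightarrow>
      fst (scan k v cs (X, p, m)) j = Suc (f j)) \<and> snd (snd (scan k v cs (X, p, m))) \<le> k - 1"
  using assms
proof (induction cs arbitrary: X m)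
  case Nil
  have "card {j. X j \<noteq> 0} \<le> k - 1"
    using card_mono[OF _ Nil(3)] by simp
  moreover have "0 < (k * k) ^ (k - 1 - m)" by (cases k) auto
  ultimately show ?case using Nil by (intro exI[of _ 0]) auto
next
  case (Cons c cs)
  show ?case
  proof (cases "c ! 0 = v \<and> admits k X c")
    case False
    then have "scan k v (c # cs) (X, p, m) = scan k v cs (X, p, m)" for p
      by (auto simp: scan_Cons)
    then show ?thesis using Cons.IH[of X m] Cons.prems by simp
  next
    case True
    then obtain i j where ij: "i + j + 1 < k" "c ! i = f j"
      using Cons.prems(1) by (auto simp: compat_def)
    then have "X j \<noteq> Suc (f j)" using True unfolding admits_def by metis
    then have Xj: "X j = 0" using Cons.prems(2) by blast
    let ?X = "X(j := Suc (c ! i))"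
    have dom: "{j. ?X j \<noteq> 0} = insert j {j. X j \<noteq> 0}" by auto
    have fin: "finite {j. X j \<noteq> 0}" using Cons.prems(3) finite_subset by blast
    have sub: "{j. ?X j \<noteq> 0} \<subseteq> {..<k - 1}" using dom Cons.prems(3) ij(1) by auto
    have card: "card {j. ?X j \<noteq> 0} = Suc m"
      unfolding dom using fin Xj Cons.prems(4) by simp
    then have mk: "Suc m \<le> k - 1" using card_mono[OF _ sub] by simp
    have X: "\<forall>j. ?X j \<noteq> 0 \<longrightarrow> ?X j = Suc (f j)" using Cons.prems(2) ij by auto
    have "\<forall>c \<in> set cs. c ! 0 = v \<longrightarrow> \<not> compat k c f" using Cons.prems(1) by simp
    from Cons.IH[OF this X sub card] obtain p where p: "p < (k * k) ^ (k - 1 - Suc m)"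
      and scan: "\<forall>j. fst (scan k v cs (?X, p, Suc m)) j \<noteq> 0 \<longrightarrow>
        fst (scan k v cs (?X, p, Suc m)) j = Suc (f j)" "snd (snd (scan k v cs (?X, p, Suc m))) \<le> k - 1"
      by blast
    define d where "d = i * k + j"
    have "Suc i * k \<le> k * k" using ij by (intro mult_le_mono) auto
    then have d: "d < k * k" using ij unfolding d_def by simp
    have digit: "d mod k = j" "d div k = i" using ij by (auto simp: d_def)
    \<comment> \<open>The scan reads the least significant digit first, so the new digit goes below
      the code \<open>p\<close> supplied by the induction hypothesis.\<close>
    let ?p = "d + (k * k) * p"
    have "k * k \<noteq> 0" using d by linarith
    then have "?p mod (k * k) = d" "?p div (k * k) = p"
      using d div_mult_self2[of "k * k" d p] by simp_all
    then have "scan k v (c # cs) (X, ?p, m) = scan k v cs (?X, p, Suc m)"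
      using True digit by (simp add: scan_Cons)
    moreover have "?p < (k * k) ^ (k - 1 - m)"
    proof -
      have "?p < k * k * Suc p" using d by simp
      also have "\<dots> \<le> k * k * (k * k) ^ (k - 1 - Suc m)" using p by (intro mult_le_mono) auto
      also have "\<dots> = (k * k) ^ (k - 1 - m)" using mk
        by (metis Suc_diff_Suc Suc_le_lessD power_Suc)
      finally show ?thesis .
    qed
    ultimately show ?thesis using scan by (intro exI[of _ ?p]) simp
  qed
qed

text \<open>By contradiction from \<open>blocking_code\<close> with the empty record: if every entry
  with the head of \<open>b\<close> collided with \<open>f\<close>, the resulting code would record
  only vertices of \<open>f\<close>. Since \<open>b\<close> is compatible with \<open>f\<close>, it
  admits this record and would pass the test.\<close>

lemma not_needed_represented:
  assumes "\<not> needed k cs b" "compat k b f" "1 \<le> k"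
  shows "\<exists>c \<in> set cs. c ! 0 = b ! 0 \<and> compat k c f"
proof (rule ccontr)
  assume "\<not> ?thesis"
  then obtain p where p: "p < (k * k) ^ (k - 1)"
    "\<forall>j. fst (scan k (b ! 0) cs (start p)) j \<noteq> 0 \<longrightarrow>
      fst (scan k (b ! 0) cs (start p)) j = Suc (f j)" "snd (snd (scan k (b ! 0) cs (start p))) \<le> k - 1"
    using blocking_code[of cs "b ! 0" k f "\<lambda>_. 0" 0] by auto
  have "(k * k) ^ (k - 1) \<le> codes k"
    unfolding codes_def using assms(3) by (intro power_increasing) auto
  moreover have "admits k (fst (scan k (b ! 0) cs (start p))) b"
    unfolding admits_def using p(2) assms(2) by (metis Suc_inject compat_def nat.distinct(1))
  moreover have "snd (snd (scan k (b ! 0) cs (start p))) < k" using p(3) assms(3) by simp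
  ultimately have "needed k cs b" using p(1) unfolding needed_def accepts_def by (meson less_le_trans)
  with assms(1) show False by simp
qed

text \<open>An accepted entry consumes a digit in every later scan with its code, so it is determined by its
  head, its code and the number of digits consumed before it.\<close>
lemma needed_length_bound:
  assumes "\<forall>q < length Q. needed k (take q Q) (Q ! q)" "\<forall>q < length Q. Q ! q ! 0 < n"
  shows "length Q \<le> n * codes k * k"
proof -
  obtain w where w: "\<And>q. q < length Q \<Longrightarrow> w q < codes k \<and> accepts k (take q Q) (Q ! q) (w q)"
    using assms(1) unfolding needed_def by metis
  define cnt where "cnt q = snd (snd (scan k (Q ! q ! 0) (take q Q) (start (w q))))" for q
  define g where "g q = (Q ! q ! 0, w q, cnt q)" for q
  have neq: "g q \<noteq> g q'" if qq: "q < q'" "q' < length Q" for q q'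
  proof
    assume "g q = g q'"
    then have same: "Q ! q ! 0 = Q ! q' ! 0" "w q = w q'" and cnt: "cnt q = cnt q'"
      by (auto simp: g_def)
    let ?v = "Q ! q ! 0"
    obtain X p m where s: "scan k ?v (take q Q) (start (w q)) = (X, p, m)"
      by (metis surj_pair)
    have adm: "admits k X (Q ! q)" using w[of q] qq s by (simp add: accepts_def)
    have "take q' Q = take q Q @ Q ! q # drop (Suc q) (take q' Q)"
      using id_take_nth_drop[of q "take q' Q"] qq by (simp add: min_def)
    then have "scan k ?v (take q' Q) (start (w q)) =
        scan k ?v (take q Q @ Q ! q # drop (Suc q) (take q' Q)) (start (w q))" by (rule arg_cong)
    also have "\<dots> = scan k ?v (drop (Suc q) (take q' Q)) (scan_step k ?v (Q ! q) (X, p, m))"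
      by (simp only: scan_append scan_Cons s)
    finally have "scan k ?v (take q' Q) (start (w q)) =
        scan k ?v (drop (Suc q) (take q' Q)) (scan_step k ?v (Q ! q) (X, p, m))" .
    then have "Suc m \<le> snd (snd (scan k ?v (take q' Q) (start (w q))))"
      using adm scan_count_mono by simp
    then show False using cnt s same by (simp add: cnt_def)
  qed
  have "inj_on g {..<length Q}"
    by (rule inj_onI) (metis lessThan_iff linorder_neqE_nat neq)
  moreover have "g ` {..<length Q} \<subseteq> {..<n} \<times> {..<codes k} \<times> {..<k}"
    using w assms(2) by (fastforce simp: g_def cnt_def accepts_def)
  ultimately have "card {..<length Q} \<le> card ({..<n} \<times> {..<codes k} \<times> {..<k})"
    by (intro card_inj_on_le[of g]) auto
  then show ?thesis by (simp add: card_cartesian_product mult.assoc)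
qed

text \<open>The configuration after the first \<open>s\<close> of \<open>L\<close> moves from \<open>c\<close> to \<open>fin\<close>.\<close>

definition window :: "nat \<Rightarrow> nat list \<Rightarrow> nat \<Rightarrow> nat list \<Rightarrow> nat \<Rightarrow> nat list" where
  "window k fin L c s = map (\<lambda>i. if i < s then fin ! (L - s + i) else c ! (i - s)) [0..<k]"

section \<open>Moves, plays towards the final configuration, and the search invariant\<close>

locale snake =
  fixes n k :: nat and E :: "nat \<Rightarrow> nat \<Rightarrow> bool" and init fin :: "nat list"
begin

definition conf :: "nat list \<Rightarrow> bool" where
  "conf c \<longleftrightarrow> length c = k \<and> set c \<subseteq> {..<n} \<and> distinct c \<and> (\<forall>i. Suc i < k \<longrightarrow> E (c ! i) (c ! Suc i))"

definition move :: "nat \<Rightarrow> nat list \<Rightarrow> nat list" where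
  "move u c = u # butlast c"

text \<open>\<open>Suc i < k\<close> spares the tail, whose vertex may be entered as it is vacated.
  For \<open>k = 1\<close> a move need not follow an edge; the relation supplied for
  \<open>E\<close> is then the complete one (\<open>adjacent\<close>).\<close>

definition legal :: "nat \<Rightarrow> nat list \<Rightarrow> bool" where
  "legal u c \<longleftrightarrow> u < n \<and> E u (c ! 0) \<and> (\<forall>i. Suc i < k \<longrightarrow> c ! i \<noteq> u)"

definition step :: "nat list \<Rightarrow> nat list \<Rightarrow> bool" where
  "step c c' \<longleftrightarrow> conf c \<and> (\<exists>u. legal u c \<and> c' = move u c)"

definition walk :: "(nat \<Rightarrow> nat list) \<Rightarrow> nat \<Rightarrow> nat list \<Rightarrow> nat list \<Rightarrow> bool" where
  "walk f l c c' \<longleftrightarrow> f 0 = c \<and> f l = c' \<and> (\<forall>i < l. step (f i) (f (Suc i)))"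

text \<open>Criterion for a play of exactly \<open>L \<le> k\<close> moves from \<open>c\<close> to
  \<open>fin\<close>. Such a play must visit \<open>fin ! (L - 1)\<close>, ...,
  \<open>fin ! 0\<close> in this order. What remains to be asked is the first edge, that no move
  bites the old body, and that the surviving part of \<open>c\<close> is the rest of
  \<open>fin\<close>; everything among the new vertices is inherited from
  \<open>conf fin\<close>.\<close>

definition ok :: "nat list \<Rightarrow> nat \<Rightarrow> bool" where
  "ok c L \<longleftrightarrow> E (fin ! (L - 1)) (c ! 0) \<and>
     (\<forall>i j. i + j + 1 < k \<and> j < L \<longrightarrow> fin ! (L - 1 - j) \<noteq> c ! i) \<and>
     (\<forall>i. L + i < k \<longrightarrow> fin ! (L + i) = c ! i)"

text \<open>The representative may vary with \<open>f\<close>. The depth bound is what preserves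
  shortest lengths under exchange.\<close>

definition represented :: "nat list list \<Rightarrow> (nat \<Rightarrow> nat) \<Rightarrow> nat list \<Rightarrow> nat \<Rightarrow> bool" where
  "represented Q dep c m \<longleftrightarrow> (\<forall>f. compat k c f \<longrightarrow>
     (\<exists>q < length Q. Q ! q ! 0 = c ! 0 \<and> dep q \<le> m \<and> compat k (Q ! q) f))"

text \<open>\<open>h\<close> is the entry under expansion and \<open>u0\<close> the next head to
  try. \<open>needed\<close> refers to the prefix of each entry, the form in which
  \<open>needed_length_bound\<close> bounds the queue. The bound \<open>Suc (dep h)\<close> on all
  depths is what makes a representative of a rejected successor of \<open>h\<close> early
  enough.\<close>

definition bfs_inv :: "nat list list \<Rightarrow> (nat \<Rightarrow> nat) \<Rightarrow> (nat \<Rightarrow> nat) \<Rightarrow> nat \<Rightarrow> nat \<Rightarrow> bool" where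
  "bfs_inv Q par dep h u0 \<longleftrightarrow>
     Q \<noteq> [] \<and> Q ! 0 = init \<and> dep 0 = 0 \<and> h \<le> length Q \<and>
     (\<forall>q < length Q. conf (Q ! q) \<and> needed k (take q Q) (Q ! q)) \<and>
     (\<forall>q < length Q. 0 < q \<longrightarrow> par q < q \<and> dep q = Suc (dep (par q)) \<and> step (Q ! par q) (Q ! q)) \<and>
     (\<forall>q q'. q \<le> q' \<and> q' < length Q \<longrightarrow> dep q \<le> dep q') \<and>
     (h < length Q \<longrightarrow> (\<forall>q < length Q. dep q \<le> Suc (dep h))) \<and>
     (\<forall>p u. (p < h \<or> p = h \<and> h < length Q \<and> u < u0) \<and> legal u (Q ! p) \<longrightarrow>
        represented Q dep (move u (Q ! p)) (Suc (dep p)))"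

end

locale snake_input = snake +
  assumes k: "1 \<le> k" and conf_init: "conf init" and conf_fin: "conf fin"
begin

lemma confD:
  assumes "conf c"
  shows "length c = k" "set c \<subseteq> {..<n}" "distinct c" "Suc i < k \<Longrightarrow> E (c ! i) (c ! Suc i)"
    "i < k \<Longrightarrow> c ! i < n" "i < k \<Longrightarrow> j < k \<Longrightarrow> c ! i = c ! j \<longleftrightarrow> i = j"
  using assms nth_mem by (auto simp: conf_def nth_eq_iff_index_eq)

lemma nth_move:
  assumes "conf c"
  shows "move u c ! 0 = u" "Suc i < k \<Longrightarrow> move u c ! Suc i = c ! i" "length (move u c) = k"
  using confD(1)[OF assms] k by (auto simp: move_def nth_butlast)

lemma conf_move:
  assumes "conf c" "legal u c"
  shows "conf (move u c)"
proof -
  have "set (butlast c) \<subseteq> {..<n}" using confD(2)[OF assms(1)] in_set_butlastD by fastforce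
  moreover have "u \<notin> set (butlast c)"
    using assms confD(1)[OF assms(1)] k by (auto simp: in_set_conv_nth legal_def nth_butlast)
  moreover have "E (move u c ! i) (move u c ! Suc i)" if "Suc i < k" for i
    using that assms confD(4)[OF assms(1), of "i - 1"] nth_move[OF assms(1)]
    by (cases i) (auto simp: legal_def)
  ultimately show ?thesis
    using assms confD(1,3)[OF assms(1)] nth_move(3)[OF assms(1)]
    unfolding conf_def by (auto simp: move_def distinct_butlast legal_def)
qed

lemma stepD: "step c c' \<Longrightarrow> conf c \<and> conf c'"
  using conf_move by (auto simp: step_def)

lemma step_nth:
  assumes "step c c'"
  shows "Suc i < k \<Longrightarrow> c' ! Suc i = c ! i" "legal (c' ! 0) c"
  using assms nth_move by (auto simp: step_def)

lemma walk_conf: "walk f l c c' \<Longrightarrow> conf c \<Longrightarrow> i \<le> l \<Longrightarrow> conf (f i)"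
  by (cases i) (auto simp: walk_def Suc_le_eq dest: stepD)

text \<open>Each move shifts the body by one position, so a vertex is found \<open>d\<close> moves
  later \<open>d\<close> positions further back, until it leaves at the tail.\<close>

lemma walk_nth:
  assumes "walk f l c c'" "s + d \<le> l" "i + d < k"
  shows "f (s + d) ! (i + d) = f s ! i"
  using assms(2,3)
proof (induction d)
  case (Suc d)
  have "step (f (s + d)) (f (Suc (s + d)))" using assms(1) Suc.prems by (simp add: walk_def)
  from step_nth(1)[OF this, of "i + d"] Suc show ?case by simp
qed simp

lemma walk_tl: "walk f l c c' \<Longrightarrow> s \<le> l \<Longrightarrow> walk (\<lambda>i. f (s + i)) (l - s) (f s) c'"
  by (simp add: walk_def)

lemma window_nth: "i < k \<Longrightarrow> window k fin L c s ! i = (if i < s then fin ! (L - s + i) else c ! (i - s))"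
  and length_window [simp]: "length (window k fin L c s) = k"
  by (simp_all add: window_def)

lemma window_0: "length c = k \<Longrightarrow> window k fin L c 0 = c"
  by (rule nth_equalityI) (simp_all add: window_nth)

lemma window_fin:
  assumes "ok c L" "L \<le> k"
  shows "window k fin L c L = fin"
proof (rule nth_equalityI)
  fix i assume "i < length (window k fin L c L)"
  then show "window k fin L c L ! i = fin ! i"
    using assms by (cases "i < L") (auto simp: window_nth ok_def dest: spec[of _ "i - L"])
qed (simp add: confD(1)[OF conf_fin])

text \<open>The next vertex \<open>fin ! (L - Suc s)\<close> cannot hit the first \<open>s\<close>
  positions of the window, which lie in the repetition-free \<open>fin\<close>, and
  \<open>ok\<close> keeps it off the old body. The first edge comes from \<open>ok\<close>, all
  later ones from \<open>fin\<close>.\<close>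

lemma window_step:
  assumes "conf c" "ok c L" "L \<le> k" "s < L"
  shows "conf (window k fin L c s) \<and> step (window k fin L c s) (window k fin L c (Suc s))"
proof -
  let ?w = "window k fin L c"
  have step: "step (?w s) (?w (Suc s))" if "conf (?w s)" "s < L" for s
  proof -
    let ?u = "fin ! (L - Suc s)"
    have "E ?u (?w s ! 0)"
      using that assms(2,3) confD(4)[OF conf_fin, of "L - Suc s"] k
      by (cases s) (auto simp: window_nth ok_def Suc_diff_Suc)
    moreover have "?w s ! i \<noteq> ?u" if i: "Suc i < k" for i
    proof (cases "i < s")
      case True
      then show ?thesis
        using \<open>s < L\<close> i assms(3) confD(6)[OF conf_fin, of "L - s + i" "L - Suc s"]
        by (auto simp: window_nth)
    next
      case False
      then have "(i - s) + s + 1 < k \<and> s < L" using i \<open>s < L\<close> by auto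
      then have "fin ! (L - 1 - s) \<noteq> c ! (i - s)" using assms(2) unfolding ok_def by blast
      then show ?thesis using False i by (auto simp: window_nth)
    qed
    ultimately have "legal ?u (?w s)"
      using confD(5)[OF conf_fin, of "L - Suc s"] that assms(3) by (auto simp: legal_def)
    moreover have "?w (Suc s) = move ?u (?w s)"
    proof (rule nth_equalityI)
      fix i assume "i < length (?w (Suc s))"
      then show "?w (Suc s) ! i = move ?u (?w s) ! i"
        using nth_move[OF that(1)] that(2) by (cases i) (auto simp: window_nth Suc_diff_Suc)
    qed (simp add: nth_move(3)[OF that(1)])
    ultimately show ?thesis using that(1) by (auto simp: step_def)
  qed
  have "conf (?w s)" if "s < L" for s
    using that
  proof (induction s)
    case 0
    then show ?case using assms(1) by (simp add: window_0 confD(1))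
  next
    case (Suc s)
    then show ?case using step[of s] stepD by auto
  qed
  then show ?thesis using step assms(4) by blast
qed

text \<open>\<open>walk_nth\<close> reads off both sides of each condition: the head after
  \<open>Suc j\<close> moves ends up in position \<open>L - 1 - j\<close> of \<open>fin\<close>, and
  vertex \<open>i\<close> of \<open>c\<close> sits in position \<open>i + j\<close> when move
  \<open>j\<close> is made.\<close>

lemma walk_imp_ok:
  assumes w: "walk f L c fin" and L: "1 \<le> L" "L \<le> k" and c: "conf c"
  shows "ok c L"
proof -
  have f: "f 0 = c" "f L = fin" using w by (auto simp: walk_def)
  have legal: "legal (f (Suc j) ! 0) (f j)" if "j < L" for j
    using w that step_nth(2) by (auto simp: walk_def)
  have fin: "fin ! (L - 1 - j) = f (Suc j) ! 0" if "j < L" for j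
    using walk_nth[OF w, of "Suc j" "L - 1 - j" 0] that L f by simp
  have "E (fin ! (L - 1)) (c ! 0)"
    using legal[of 0] fin[of 0] L f by (auto simp: legal_def)
  moreover have "fin ! (L - 1 - j) \<noteq> c ! i" if "i + j + 1 < k" "j < L" for i j
  proof -
    have "f j ! (i + j) = c ! i"
      using walk_nth[OF w, of 0 j i] that f by simp
    moreover have "f j ! (i + j) \<noteq> f (Suc j) ! 0" using legal[of j] that by (auto simp: legal_def)
    ultimately show ?thesis using fin that by simp
  qed
  moreover have "fin ! (L + i) = c ! i" if "L + i < k" for i
    using walk_nth[OF w, of 0 L i] that f by (simp add: add.commute)
  ultimately show ?thesis by (simp add: ok_def)
qed

section \<open>Preservation of the search invariant\<close>

lemma bfs_inv_init: "needed k [] init \<Longrightarrow> dep 0 = 0 \<Longrightarrow> bfs_inv [init] par dep 0 0"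
  using conf_init by (auto simp: bfs_inv_def)

lemma needed_Nil: "needed k [] init"
  using k by (auto simp: needed_def accepts_def codes_def admits_def intro!: exI[of _ 0])

lemma bfs_inv_length:
  assumes "bfs_inv Q par dep h u"
  shows "length Q \<le> n * codes k * k"
  using assms confD(5)[of _ 0] k by (intro needed_length_bound) (auto simp: bfs_inv_def)

lemma bfs_inv_next_head:
  assumes "bfs_inv Q par dep h n" "h < length Q"
  shows "bfs_inv Q par dep (Suc h) 0"
proof -
  have mono: "dep q \<le> Suc (dep (Suc h))" if "Suc h < length Q" "q < length Q" for q
    using assms that unfolding bfs_inv_def by (meson Suc_le_mono le_SucI le_refl le_trans)
  have "represented Q dep (move u (Q ! p)) (Suc (dep p))" if "p < Suc h" "legal u (Q ! p)" for p u
  proof -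
    have "u < n" using that by (simp add: legal_def)
    then show ?thesis using assms that unfolding bfs_inv_def by (metis less_antisym)
  qed
  with mono assms show ?thesis unfolding bfs_inv_def by auto
qed

text \<open>Every entry of the queue has depth at most \<open>Suc (dep h)\<close>, so any
  representative given by \<open>not_needed_represented\<close> meets the depth bound. For an
  illegal \<open>u\<close> there is nothing to represent.\<close>

lemma bfs_inv_skip:
  assumes "bfs_inv Q par dep h u" "h < length Q"
    and "legal u (Q ! h) \<Longrightarrow> \<not> needed k Q (move u (Q ! h))"
  shows "bfs_inv Q par dep h (Suc u)"
proof -
  have "represented Q dep (move u (Q ! h)) (Suc (dep h))" if "legal u (Q ! h)"
    unfolding represented_def
  proof (intro allI impI)
    fix f assume "compat k (move u (Q ! h)) f"
    from not_needed_represented[OF assms(3)[OF that] this k]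
    show "\<exists>q<length Q. Q ! q ! 0 = move u (Q ! h) ! 0 \<and> dep q \<le> Suc (dep h) \<and> compat k (Q ! q) f"
      using assms(1,2) unfolding bfs_inv_def by (metis in_set_conv_nth)
  qed
  with assms(1,2) show ?thesis unfolding bfs_inv_def by (auto simp: less_Suc_eq)
qed

lemma represented_extend:
  assumes "represented Q dep c m" "\<And>q. q < length Q \<Longrightarrow> dep' q = dep q"
  shows "represented (Q @ [b]) dep' c m"
  unfolding represented_def
proof (intro allI impI)
  fix f assume "compat k c f"
  then obtain q where "q < length Q" "Q ! q ! 0 = c ! 0" "dep q \<le> m" "compat k (Q ! q) f"
    using assms(1) unfolding represented_def by blast
  then show "\<exists>q<length (Q @ [b]). (Q @ [b]) ! q ! 0 = c ! 0 \<and> dep' q \<le> m \<and> compat k ((Q @ [b]) ! q) f"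
    using assms(2) by (intro exI[of _ q]) (simp add: nth_append)
qed

text \<open>The new configuration represents itself, and appending it keeps the depths sorted
  because no depth exceeds \<open>Suc (dep h)\<close>. \<open>par'\<close> and \<open>dep'\<close>
  are left arbitrary beyond the new slot, as befits the contents of an array.\<close>

lemma bfs_inv_add:
  assumes inv: "bfs_inv Q par dep h u" and h: "h < length Q"
    and u: "legal u (Q ! h)" and needed: "needed k Q (move u (Q ! h))"
    and par': "\<And>q. q < length Q \<Longrightarrow> par' q = par q" "par' (length Q) = h"
    and dep': "\<And>q. q < length Q \<Longrightarrow> dep' q = dep q" "dep' (length Q) = Suc (dep h)"
  shows "bfs_inv (Q @ [move u (Q ! h)]) par' dep' h (Suc u)"
proof -
  let ?b = "move u (Q ! h)" let ?Q = "Q @ [?b]"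
  have conf: "conf (Q ! h)" using inv h by (simp add: bfs_inv_def)
  have step: "step (Q ! h) ?b" using conf u by (auto simp: step_def)
  have conf': "conf ?b" using stepD[OF step] by simp
  have "conf (?Q ! q) \<and> needed k (take q ?Q) (?Q ! q)" if "q < length ?Q" for q
    using that inv conf' needed by (cases "q < length Q") (auto simp: bfs_inv_def nth_append less_Suc_eq)
  moreover have "par' q < q \<and> dep' q = Suc (dep' (par' q)) \<and> step (?Q ! par' q) (?Q ! q)"
    if "q < length ?Q" "0 < q" for q
  proof (cases "q < length Q")
    case True
    then have "par q < q \<and> dep q = Suc (dep (par q)) \<and> step (Q ! par q) (Q ! q)"
      using inv that(2) by (simp add: bfs_inv_def)
    then show ?thesis using True par' dep' by (simp add: nth_append)
  next
    case False
    then have "q = length Q" using that by simp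
    then show ?thesis using par' dep' h step by (simp add: nth_append)
  qed
  moreover have "dep' q \<le> dep' q'" if "q \<le> q'" "q' < length ?Q" for q q'
  proof (cases "q' < length Q")
    case True
    then show ?thesis using inv that dep' by (simp add: bfs_inv_def)
  next
    case False
    then show ?thesis using inv that dep' h by (cases "q = length Q") (auto simp: bfs_inv_def less_Suc_eq)
  qed
  moreover have "dep' q \<le> Suc (dep' h)" if "q < length ?Q" for q
    using that inv dep' h by (cases "q = length Q") (auto simp: bfs_inv_def less_Suc_eq)
  moreover have "represented ?Q dep' (move v (?Q ! p)) (Suc (dep' p))"
    if "p < h \<or> p = h \<and> v < Suc u" "legal v (?Q ! p)" for p v
  proof (cases "p = h \<and> v = u")
    case True
    then show ?thesis using dep' h unfolding represented_def
      by (intro allI impI exI[of _ "length Q"]) (simp add: nth_append)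
  next
    case False
    have p: "p < length Q" using that h by auto
    have "represented Q dep (move v (Q ! p)) (Suc (dep p))"
      using inv that False p h unfolding bfs_inv_def by (auto simp: nth_append less_Suc_eq)
    then show ?thesis using represented_extend[of Q dep _ _ dep'] p dep' by (simp add: nth_append)
  qed
  ultimately show ?thesis using inv dep' h unfolding bfs_inv_def by (auto simp: nth_append)
qed

text \<open>The exchange argument. A future \<open>g\<close> of \<open>c\<close>, preceded by the
  head of \<open>c\<close>, is a future of the configuration before it; a representative of that one
  can make the same move. With \<open>h = length Q\<close> all successors have been treated, so the
  result of the move is itself represented, one level deeper at most.\<close>

lemma walk_represented:
  assumes inv: "bfs_inv Q par dep (length Q) u0" and "walk f t init c"
  shows "represented Q dep c t"
  using assms(2)
proof (induction t arbitrary: c)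
  case 0
  then have "c = init" by (auto simp: walk_def)
  then show ?case using inv unfolding represented_def bfs_inv_def by (metis le_refl length_greater_0_conv)
next
  case (Suc t)
  let ?c = "f t"
  have "walk f t init ?c" and step: "step ?c c" using Suc.prems by (auto simp: walk_def)
  then have rep: "represented Q dep ?c t" using Suc.IH by blast
  show ?case unfolding represented_def
  proof (intro allI impI)
    fix g assume g: "compat k c g"
    let ?v = "c ! 0"
    let ?g = "\<lambda>j. if j = 0 then ?v else g (j - 1)"
    have legal: "legal ?v ?c" using step step_nth by blast
    have "compat k ?c ?g" unfolding compat_def
    proof (intro allI impI)
      fix i j assume ij: "i + j + 1 < k"
      show "?c ! i \<noteq> ?g j"
      proof (cases j)
        case 0
        then show ?thesis using legal ij by (auto simp: legal_def)
      next
        case (Suc j')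
        then have "c ! Suc i \<noteq> g j'" using g ij by (auto simp: compat_def)
        then show ?thesis using Suc step_nth(1)[OF step, of i] ij by simp
      qed
    qed
    then obtain q where q: "q < length Q" "Q ! q ! 0 = ?c ! 0" "dep q \<le> t" "compat k (Q ! q) ?g"
      using rep by (auto simp: represented_def)
    \<comment> \<open>Compatibility at move 0 is legality of \<open>?v\<close> apart from the edge,
      and the edge is supplied by the shared head.\<close>
    have "Q ! q ! i \<noteq> ?v" if "Suc i < k" for i
      using q(4) that unfolding compat_def by (metis add.right_neutral Suc_eq_plus1)
    then have lq: "legal ?v (Q ! q)" using legal q(2) by (auto simp: legal_def)
    have cq: "conf (Q ! q)" using inv q(1) by (auto simp: bfs_inv_def)
    let ?b = "move ?v (Q ! q)"
    have "represented Q dep ?b (Suc (dep q))" using inv q(1) lq by (auto simp: bfs_inv_def)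
    moreover have "compat k ?b g" unfolding compat_def
    proof (intro allI impI)
      fix i j assume ij: "i + j + 1 < k"
      show "?b ! i \<noteq> g j"
      proof (cases i)
        case 0
        then show ?thesis using g ij nth_move(1)[OF cq] by (auto simp: compat_def)
      next
        case (Suc i')
        then have "Q ! q ! i' \<noteq> ?g (Suc j)" using q(4) ij unfolding compat_def by (metis add_Suc_shift)
        then show ?thesis using nth_move(2)[OF cq, of i'] Suc ij by simp
      qed
    qed
    ultimately obtain q' where "q' < length Q" "Q ! q' ! 0 = ?b ! 0" "dep q' \<le> Suc (dep q)"
      "compat k (Q ! q') g"
      by (auto simp: represented_def)
    then show "\<exists>q<length Q. Q ! q ! 0 = c ! 0 \<and> dep q \<le> Suc t \<and> compat k (Q ! q) g"
      using q(3) nth_move(1)[OF cq] by (intro exI[of _ q']) auto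
  qed
qed

text \<open>Truncated subtraction lets one counter \<open>z\<close> first run through the short plays, of length \<open>z + 1 < k\<close>
  from entry 0, and then through the queue entries followed by \<open>k\<close> moves.\<close>

definition cand :: "nat list list \<Rightarrow> nat \<Rightarrow> bool" where
  "cand Q z \<longleftrightarrow> ok (Q ! (z - (k - 1))) (k - (k - 1 - z))"

definition cost :: "(nat \<Rightarrow> nat) \<Rightarrow> nat \<Rightarrow> nat" where
  "cost dep z = dep (z - (k - 1)) + (k - (k - 1 - z))"

text \<open>Depth is sorted along the queue, and the number of final moves rises to \<open>k\<close>
  and stays there. Hence the first candidate met is a cheapest one.\<close>

lemma cost_mono:
  assumes "bfs_inv Q par dep h u0" "z \<le> z'" "z' < length Q + (k - 1)"
  shows "cost dep z \<le> cost dep z'"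
proof -
  have "dep (z - (k - 1)) \<le> dep (z' - (k - 1))"
    using assms unfolding bfs_inv_def by (smt (verit) diff_le_mono le_0_eq length_0_conv
      less_diff_conv2 linorder_not_le nat_le_linear add.commute diff_is_0_eq' length_greater_0_conv)
  then show ?thesis unfolding cost_def using assms(2) by (intro add_mono diff_le_mono2) auto
qed

text \<open>With exactly \<open>k\<close> final moves the clause of \<open>ok\<close> on the
  surviving body is void, so \<open>ok\<close> depends on the start only through its head and its
  compatibility with the reversed \<open>fin\<close>; both pass to a representative. A play shorter
  than \<open>k\<close> starts at entry 0, which is \<open>init\<close> itself, so no exchange is
  made.\<close>

lemma walk_cand:
  assumes inv: "bfs_inv Q par dep (length Q) u0" and w: "walk f l init fin" and l: "1 \<le> l"
  shows "\<exists>z < length Q + (k - 1). cand Q z \<and> cost dep z \<le> l"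
proof (cases "l < k")
  case True
  have "ok init l" using walk_imp_ok[OF w l] True conf_init by simp
  moreover have "l - 1 - (k - 1) = 0" "k - (k - 1 - (l - 1)) = l" using True l by auto
  ultimately show ?thesis using inv True l
    by (intro exI[of _ "l - 1"]) (auto simp: cand_def cost_def bfs_inv_def)
next
  case False
  let ?s = "l - k" let ?c = "f ?s"
  have w1: "walk f ?s init ?c" and w2: "walk (\<lambda>i. f (?s + i)) k ?c fin"
    using w walk_tl[OF w, of ?s] False by (auto simp: walk_def)
  have "conf ?c" using walk_conf[OF w conf_init] by simp
  then have ok: "ok ?c k" using walk_imp_ok[OF w2] k by simp
  have "compat k ?c (\<lambda>j. fin ! (k - 1 - j))" unfolding compat_def
  proof (intro allI impI)
    fix i j assume "i + j + 1 < k"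
    moreover then have "j < k" by simp
    ultimately show "?c ! i \<noteq> fin ! (k - 1 - j)" using ok unfolding ok_def by metis
  qed
  then obtain q where q: "q < length Q" "Q ! q ! 0 = ?c ! 0" "dep q \<le> ?s"
    "compat k (Q ! q) (\<lambda>j. fin ! (k - 1 - j))"
    using walk_represented[OF inv w1] by (auto simp: represented_def)
  have "ok (Q ! q) k" using ok q(2,4) unfolding ok_def compat_def by fastforce
  moreover have "q + (k - 1) - (k - 1) = q" "k - (k - 1 - (q + (k - 1))) = k" by auto
  ultimately show ?thesis using q False
    by (intro exI[of _ "q + (k - 1)"]) (auto simp: cand_def cost_def)
qed

text \<open>\<open>t\<close> counts the moves still to be made, since parents lead backwards. For
  \<open>t \<ge> L\<close> this is the ancestor of \<open>q\<close> by \<open>t - L\<close>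
  generations with a trivial window; for smaller \<open>t\<close> it is entry \<open>q\<close> after
  \<open>L - t\<close> moves. Truncated subtraction merges the two regimes.\<close>

definition trace :: "nat list list \<Rightarrow> (nat \<Rightarrow> nat) \<Rightarrow> nat \<Rightarrow> nat \<Rightarrow> nat \<Rightarrow> nat list" where
  "trace Q par q L t = window k fin L (Q ! ((par ^^ (t - L)) q)) (L - t)"

lemma ancestor:
  assumes inv: "bfs_inv Q par dep h u0" and "q < length Q" "s \<le> dep q"
  shows "(par ^^ s) q < length Q \<and> dep ((par ^^ s) q) = dep q - s"
  using assms(3)
proof (induction s)
  case (Suc s)
  let ?a = "(par ^^ s) q"
  have "?a < length Q" "dep ?a = dep q - s" using Suc by auto
  moreover then have "0 < ?a" using inv Suc.prems unfolding bfs_inv_def by (metis Suc_le_eq gr0I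
    zero_less_diff less_irrefl)
  ultimately have "par ?a < ?a \<and> dep ?a = Suc (dep (par ?a))" using inv by (auto simp: bfs_inv_def)
  then show ?case using \<open>?a < length Q\<close> \<open>dep ?a = dep q - s\<close> by auto
qed (use assms in simp)

text \<open>Parents yield the first \<open>dep q\<close> moves and \<open>window_step\<close> the
  other \<open>L\<close>. The alternative \<open>L = 0\<close> serves the trivial play that is
  written out when the two given configurations coincide.\<close>

lemma trace_walk:
  assumes inv: "bfs_inv Q par dep h u0" and q: "q < length Q" and L: "L \<le> k"
    and ok: "L = 0 \<and> Q ! q = fin \<or> ok (Q ! q) L"
  shows "walk (\<lambda>t. trace Q par q L (dep q + L - t)) (dep q + L) init fin"
proof -
  let ?D = "dep q" let ?a = "\<lambda>s. (par ^^ s) q"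
  have conf: "conf (Q ! p)" if "p < length Q" for p using inv that by (auto simp: bfs_inv_def)
  have tr: "trace Q par q L (?D + L - t) = Q ! ?a (?D - t)" if "t \<le> ?D" for t
    using that ancestor[OF inv q, of "?D - t"] conf confD(1) by (simp add: trace_def window_0)
  have "dep (?a ?D) = 0" "?a ?D < length Q" using ancestor[OF inv q, of ?D] by auto
  then have "?a ?D = 0" using inv unfolding bfs_inv_def by (metis gr0I nat.distinct(1))
  then have 0: "trace Q par q L (?D + L - 0) = init" using tr[of 0] inv by (simp add: bfs_inv_def)
  have "trace Q par q L (?D + L - (?D + L)) = window k fin L (Q ! q) L" by (simp add: trace_def)
  also have "\<dots> = fin" using ok L window_fin window_0 confD(1)[OF conf_fin] by auto
  finally have end_: "trace Q par q L (?D + L - (?D + L)) = fin" .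
  have "step (trace Q par q L (?D + L - t)) (trace Q par q L (?D + L - Suc t))" if "t < ?D + L" for t
  proof (cases "t < ?D")
    case True
    let ?p = "?a (?D - Suc t)"
    have p: "?p < length Q" "dep ?p = Suc t" using ancestor[OF inv q, of "?D - Suc t"] True by auto
    then have "0 < ?p" using inv unfolding bfs_inv_def by (metis gr0I nat.distinct(1))
    then have "step (Q ! par ?p) (Q ! ?p)" using inv p by (auto simp: bfs_inv_def)
    moreover have "par ?p = ?a (?D - t)"
      using True by (metis Suc_diff_Suc comp_apply funpow.simps(2))
    ultimately show ?thesis using tr[of t] tr[of "Suc t"] True by simp
  next
    case False
    let ?s = "t - ?D"
    have "?s < L" using that False by auto
    moreover then have "ok (Q ! q) L" using ok by auto
    ultimately have "step (window k fin L (Q ! q) ?s) (window k fin L (Q ! q) (Suc ?s))"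
      using window_step conf[OF q] L by blast
    moreover have "trace Q par q L (?D + L - t) = window k fin L (Q ! q) ?s"
      "trace Q par q L (?D + L - Suc t) = window k fin L (Q ! q) (Suc ?s)"
      using False that by (auto simp: trace_def Suc_diff_le intro!: arg_cong[of _ _ "window k fin L (Q ! q)"])
    ultimately show ?thesis by simp
  qed
  with 0 end_ show ?thesis by (auto simp: walk_def)
qed

end

section \<open>Structured programs on the word RAM\<close>

type_synonym vars = "nat \<Rightarrow> nat"
type_synonym arrays = "nat \<Rightarrow> nat \<Rightarrow> nat"

datatype expr = Num nat | Var nat | Bop operator expr expr | Get nat expr

text \<open>Registers below 64 hold the program variables; the others are scratch space for evaluating
  expressions. Variable 2 contains the base address \<open>S\<close> of the work space.\<close>

abbreviation (input) vS :: nat where "vS \<equiv> 2"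

fun eval :: "expr \<Rightarrow> vars \<Rightarrow> arrays \<Rightarrow> nat" where
  "eval (Num c) V A = c"
| "eval (Var x) V A = V x"
| "eval (Bop f a b) V A = apply_op f (eval a V A) (eval b V A)"
| "eval (Get a e) V A = A a (eval e V A)"

text \<open>Interleaving the work arrays gives each of them room to grow without sizes or separate
  base addresses; array 0 is the unshifted memory below \<open>S\<close>.\<close>

definition address :: "nat \<Rightarrow> nat \<Rightarrow> nat \<Rightarrow> nat" where
  "address S a i = (if a = 0 then i else S + 8 * i + (a - 1))"

text \<open>Array 0 asks nothing of the base register, so the input can be read before the program
  has computed \<open>S\<close>.\<close>

definition valid_address :: "nat \<Rightarrow> nat \<Rightarrow> nat \<Rightarrow> nat \<Rightarrow> vars \<Rightarrow> bool" where
  "valid_address W S a i V \<longleftrightarrow>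
     (if a = 0 then i < S else a \<le> 8 \<and> V vS = S \<and> address S a i \<le> W)"

fun safe :: "nat \<Rightarrow> nat \<Rightarrow> expr \<Rightarrow> vars \<Rightarrow> arrays \<Rightarrow> bool" where
  "safe W S (Num c) V A \<longleftrightarrow> c \<le> W"
| "safe W S (Var x) V A \<longleftrightarrow> x < 64 \<and> V x \<le> W"
| "safe W S (Bop f a b) V A \<longleftrightarrow>
     safe W S a V A \<and> safe W S b V A \<and> apply_op f (eval a V A) (eval b V A) \<le> W"
| "safe W S (Get a e) V A \<longleftrightarrow> safe W S e V A \<and> valid_address W S a (eval e V A) V"

definition to_address :: "nat \<Rightarrow> nat \<Rightarrow> prog" where
  "to_address a r = (if a = 0 then Skip else
     Seq (Const (Suc r) 8) (Seq (Calc Mul r r (Suc r)) (Seq (Calc Add r r vS)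
       (Seq (Const (Suc r) (a - 1)) (Calc Add r r (Suc r))))))"

fun compile :: "expr \<Rightarrow> nat \<Rightarrow> prog" where
  "compile (Num c) r = Const r c"
| "compile (Var x) r = Seq (Const r 0) (Calc Add r r x)"
| "compile (Bop f a b) r = Seq (compile a r) (Seq (compile b (Suc r)) (Calc f r r (Suc r)))"
| "compile (Get a e) r = Seq (compile e r) (Seq (to_address a r) (Load r r))"

fun ecost :: "expr \<Rightarrow> nat" where
  "ecost (Num c) = 1"
| "ecost (Var x) = 2"
| "ecost (Bop f a b) = ecost a + ecost b + 1"
| "ecost (Get a e) = ecost e + 6"

text \<open>The machine has no register move; a copy is an addition of zero.\<close>

definition asg :: "nat \<Rightarrow> expr \<Rightarrow> prog" where
  "asg x e = Seq (compile e 64) (Seq (Const 65 0) (Calc Add x 64 65))"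

definition put :: "nat \<Rightarrow> expr \<Rightarrow> expr \<Rightarrow> prog" where
  "put a i e = Seq (compile e 64) (Seq (compile i 65) (Seq (to_address a 65) (Store 65 64)))"

definition cond :: "expr \<Rightarrow> prog \<Rightarrow> prog \<Rightarrow> prog" where
  "cond e c1 c2 = Seq (compile e 64) (Cond 64 c1 c2)"

definition loop :: "expr \<Rightarrow> prog \<Rightarrow> prog" where
  "loop e c = Seq (compile e 64) (While 64 (Seq c (compile e 64)))"

definition iter :: "nat \<Rightarrow> expr \<Rightarrow> prog \<Rightarrow> prog" where
  "iter x e c = Seq (asg x (Num 0))
     (loop (Bop Sub e (Var x)) (Seq c (asg x (Bop Add (Var x) (Num 1)))))"

definition var_view :: "(nat \<Rightarrow> nat) \<Rightarrow> vars" where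
  "var_view R = (\<lambda>x. if x < 64 then R x else 0)"

text \<open>Array 0 is cut off at \<open>S\<close>; otherwise writes to the work arrays would show
  up in it.\<close>

definition array_view :: "nat \<Rightarrow> (nat \<Rightarrow> nat) \<Rightarrow> arrays" where
  "array_view S M = (\<lambda>a i. if a = 0 then if i < S then M i else 0
     else if a \<le> 8 then M (address S a i) else 0)"

text \<open>A memory address from \<open>S\<close> on belongs to the work array given by its residue modulo 8, so writes
  to different arrays never interfere.\<close>

lemma array_view_update:
  assumes "if a = 0 then i < S else a \<le> 8"
  shows "array_view S (M(address S a i := x)) = (array_view S M)(a := (array_view S M a)(i := x))"
proof (intro ext)
  fix b j
  have eq: "address S a i = address S b j \<longleftrightarrow> a = b \<and> i = j"
    if ab: "0 < a" "0 < b" "a \<le> 8" "b \<le> 8"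
  proof
    assume "address S a i = address S b j"
    then have eq: "(a - 1) + 8 * i = (b - 1) + 8 * j" using ab by (simp add: address_def)
    have "((a - 1) + 8 * i) div 8 = i" "((b - 1) + 8 * j) div 8 = j" using ab by simp_all
    with eq have "i = j" by metis
    with eq ab show "a = b \<and> i = j" by linarith
  qed simp
  consider "a = 0" "b = 0" | "a = 0" "0 < b" | "0 < a" "b = 0" | "0 < a" "0 < b" by blast
  then show "array_view S (M(address S a i := x)) b j
      = ((array_view S M)(a := (array_view S M a)(i := x))) b j"
  proof cases
    case 4
    then show ?thesis using assms eq by (cases "b \<le> 8") (auto simp: array_view_def)
  qed (use assms in \<open>auto simp: array_view_def address_def\<close>)
qed

lemma exec_to_address:
  assumes "64 \<le> r" "valid_address W S a (R r) (var_view R)" "8 \<le> W"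
  shows "\<exists>t R'. t \<le> 5 \<and> exec W (to_address a r) (R, M) t (R', M) \<and> R' r = address S a (R r) \<and>
    (\<forall>y < r. R' y = R y)"
proof (cases "a = 0")
  case True
  then show ?thesis using exec.Skip[of W "(R, M)"]
    by (intro exI[of _ 1] exI[of _ R]) (simp add: to_address_def address_def)
next
  case False
  let ?r = "Suc r"
  let ?R1 = "R(?r := 8)"
  let ?R2 = "?R1(r := apply_op Mul (?R1 r) (?R1 ?r))"
  let ?R3 = "?R2(r := apply_op Add (?R2 r) (?R2 vS))"
  let ?R4 = "?R3(?r := a - 1)"
  let ?R5 = "?R4(r := apply_op Add (?R4 r) (?R4 ?r))"
  have S: "R vS = S" and a: "a \<le> 8" "S + 8 * R r + (a - 1) \<le> W"
    using assms(2) False by (auto simp: valid_address_def var_view_def address_def)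
  have "exec W (to_address a r) (R, M) (1 + (1 + (1 + (1 + 1)))) (?R5, M)"
    unfolding to_address_def if_not_P[OF False]
    by (rule exec.Seq[OF exec.Const exec.Seq[OF exec.Calc exec.Seq[OF exec.Calc
          exec.Seq[OF exec.Const exec.Calc]]]]) (use False a S assms(1,3) in auto)
  moreover have "?R5 r = address S a (R r)" using False S assms(1) by (simp add: address_def)
  ultimately show ?thesis using assms(1) by (intro exI[of _ "1 + (1 + (1 + (1 + 1)))"] exI[of _ ?R5] conjI) auto
qed

text \<open>Preservation of the registers below \<open>r\<close> is a stack discipline: the right
  operand, compiled at \<open>Suc r\<close>, leaves the left value in \<open>r\<close> intact, and
  with \<open>64 \<le> r\<close> no program variable changes. \<open>8 \<le> W\<close> admits the
  constants of \<open>to_address\<close>.\<close>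

lemma exec_compile:
  assumes "safe W S e (var_view R) (array_view S M)" "64 \<le> r" "8 \<le> W"
  shows "\<exists>t R'. t \<le> ecost e \<and> exec W (compile e r) (R, M) t (R', M) \<and>
    R' r = eval e (var_view R) (array_view S M) \<and> (\<forall>y < r. R' y = R y)"
  using assms(1,2)
proof (induction e arbitrary: r R)
  case (Num c)
  then have "exec W (compile (Num c) r) (R, M) 1 (R(r := c), M)" using exec.Const by simp
  moreover have "(R(r := c)) r = eval (Num c) (var_view R) (array_view S M)"
    "\<forall>y < r. (R(r := c)) y = R y" "1 \<le> ecost (Num c)" by simp_all
  ultimately show ?case by blast
next
  case (Var x)
  then have x: "x < 64" "R x \<le> W" by (auto simp: var_view_def)
  let ?R1 = "R(r := 0)" let ?R2 = "?R1(r := apply_op Add (?R1 r) (?R1 x))"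
  have "exec W (compile (Var x) r) (R, M) (1 + 1) (?R2, M)"
    unfolding compile.simps by (rule exec.Seq[OF exec.Const exec.Calc]) (use x Var in auto)
  moreover have "?R2 r = eval (Var x) (var_view R) (array_view S M)" "\<forall>y < r. ?R2 y = R y"
    "1 + 1 \<le> ecost (Var x)" using x Var(2) by (auto simp: var_view_def)
  ultimately show ?case by blast
next
  case (Bop f a b)
  have "safe W S a (var_view R) (array_view S M)" using Bop.prems by simp
  from Bop.IH(1)[OF this Bop.prems(2)] obtain t1 R1 where 1: "t1 \<le> ecost a"
    "exec W (compile a r) (R, M) t1 (R1, M)" "R1 r = eval a (var_view R) (array_view S M)"
    "\<forall>y < r. R1 y = R y" by blast
  have v: "var_view R1 = var_view R" using 1(4) Bop.prems(2) by (auto simp: var_view_def)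
  have "safe W S b (var_view R1) (array_view S M)" "64 \<le> Suc r" using Bop.prems v by simp_all
  from Bop.IH(2)[OF this] obtain t2 R2 where 2: "t2 \<le> ecost b"
    "exec W (compile b (Suc r)) (R1, M) t2 (R2, M)" "R2 (Suc r) = eval b (var_view R1) (array_view S M)"
    "\<forall>y < Suc r. R2 y = R1 y" by blast
  let ?R3 = "R2(r := apply_op f (R2 r) (R2 (Suc r)))"
  have "apply_op f (R2 r) (R2 (Suc r)) \<le> W" using Bop.prems 1(3) 2(3,4) v by simp
  then have "exec W (compile (Bop f a b) r) (R, M) (t1 + (t2 + 1)) (?R3, M)"
    unfolding compile.simps by (intro exec.Seq[OF 1(2)] exec.Seq[OF 2(2)] exec.Calc)
  moreover have "?R3 r = eval (Bop f a b) (var_view R) (array_view S M)" "\<forall>y < r. ?R3 y = R y"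
    "t1 + (t2 + 1) \<le> ecost (Bop f a b)" using 1 2 v by auto
  ultimately show ?case by blast
next
  case (Get a e)
  have "safe W S e (var_view R) (array_view S M)" using Get.prems by simp
  from Get.IH[OF this Get.prems(2)] obtain t1 R1 where 1: "t1 \<le> ecost e"
    "exec W (compile e r) (R, M) t1 (R1, M)" "R1 r = eval e (var_view R) (array_view S M)"
    "\<forall>y < r. R1 y = R y" by blast
  have v: "var_view R1 = var_view R" using 1(4) Get.prems(2) by (auto simp: var_view_def)
  have valid: "valid_address W S a (R1 r) (var_view R1)" using Get.prems 1 v by simp
  from exec_to_address[OF Get.prems(2) this assms(3)] obtain t2 R2 where 2: "t2 \<le> 5"
    "exec W (to_address a r) (R1, M) t2 (R2, M)" "R2 r = address S a (R1 r)" "\<forall>y < r. R2 y = R1 y"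
    by blast
  let ?R3 = "R2(r := M (R2 r))"
  have "exec W (compile (Get a e) r) (R, M) (t1 + (t2 + 1)) (?R3, M)"
    unfolding compile.simps by (intro exec.Seq[OF 1(2)] exec.Seq[OF 2(2)] exec.Load)
  moreover have "M (R2 r) = array_view S M a (R1 r)"
    using valid 2(3) by (auto simp: array_view_def valid_address_def address_def)
  ultimately have "?R3 r = eval (Get a e) (var_view R) (array_view S M)" "\<forall>y < r. ?R3 y = R y"
    "t1 + (t2 + 1) \<le> ecost (Get a e)" using 1 2 by auto
  with \<open>exec W (compile (Get a e) r) (R, M) (t1 + (t2 + 1)) (?R3, M)\<close> show ?case by blast
qed

section \<open>Total correctness with time bounds\<close>

locale machine =
  fixes W S :: nat
  assumes W_ge_8: "8 \<le> W"
begin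

text \<open>A weakest precondition with a time bound. Quantifying over all concrete states with the
  given views hides scratch registers and cells outside the arrays. The postcondition may itself be
  a \<open>runs\<close> statement, which is how sequences are composed.\<close>

definition runs :: "prog \<Rightarrow> nat \<Rightarrow> vars \<Rightarrow> arrays \<Rightarrow> (vars \<Rightarrow> arrays \<Rightarrow> bool) \<Rightarrow> bool" where
  "runs c T V A Q \<longleftrightarrow> (\<forall>R M. var_view R = V \<and> array_view S M = A \<longrightarrow>
     (\<exists>t R' M'. t \<le> T \<and> exec W c (R, M) t (R', M') \<and> Q (var_view R') (array_view S M')))"

lemma runsI:
  assumes "\<And>R M. V = var_view R \<Longrightarrow> A = array_view S M \<Longrightarrow>
    \<exists>t R' M'. t \<le> T \<and> exec W c (R, M) t (R', M') \<and> Q (var_view R') (array_view S M')"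
  shows "runs c T V A Q"
  using assms by (auto simp: runs_def)

lemma runsD:
  assumes "runs c T (var_view R) (array_view S M) Q"
  obtains t R' M' where "t \<le> T" "exec W c (R, M) t (R', M')" "Q (var_view R') (array_view S M')"
  using assms unfolding runs_def by blast

lemma compileD:
  assumes "safe W S e (var_view R) (array_view S M)" "64 \<le> r"
  shows "\<exists>t R'. t \<le> ecost e \<and> exec W (compile e r) (R, M) t (R', M) \<and>
    R' r = eval e (var_view R) (array_view S M) \<and> var_view R' = var_view R \<and> (\<forall>y < r. R' y = R y)"
proof -
  obtain t R' where *: "t \<le> ecost e" "exec W (compile e r) (R, M) t (R', M)"
    "R' r = eval e (var_view R) (array_view S M)" "\<forall>y < r. R' y = R y"
    using exec_compile[OF assms W_ge_8] by blast
  then have "var_view R' = var_view R" using assms(2) by (auto simp: var_view_def)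
  with * show ?thesis by blast
qed

lemma runs_mono:
  assumes "runs c T V A Q" "T \<le> T'" "\<And>V A. Q V A \<Longrightarrow> Q' V A"
  shows "runs c T' V A Q'"
proof (rule runsI)
  fix R M assume "V = var_view R" "A = array_view S M"
  then obtain t R' M' where "t \<le> T" "exec W c (R, M) t (R', M')" "Q (var_view R') (array_view S M')"
    using assms(1) runsD by blast
  then show "\<exists>t R' M'. t \<le> T' \<and> exec W c (R, M) t (R', M') \<and> Q' (var_view R') (array_view S M')"
    using assms(2,3) le_trans by blast
qed

lemma runs_time: "runs c T V A Q \<Longrightarrow> T \<le> T' \<Longrightarrow> runs c T' V A Q"
  using runs_mono by blast

lemma runs_Skip: "Q V A \<Longrightarrow> runs Skip 1 V A Q"
  by (rule runsI) (use exec.Skip in blast)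

lemma runs_Seq:
  assumes "runs c1 T1 V A (\<lambda>V A. runs c2 T2 V A Q)"
  shows "runs (Seq c1 c2) (T1 + T2) V A Q"
proof (rule runsI)
  fix R M assume "V = var_view R" "A = array_view S M"
  then obtain t1 R1 M1 where 1: "t1 \<le> T1" "exec W c1 (R, M) t1 (R1, M1)"
    "runs c2 T2 (var_view R1) (array_view S M1) Q" using assms runsD by blast
  from 1(3) obtain t2 R2 M2 where "t2 \<le> T2" "exec W c2 (R1, M1) t2 (R2, M2)"
    "Q (var_view R2) (array_view S M2)" by (rule runsD)
  with 1 show "\<exists>t R' M'. t \<le> T1 + T2 \<and> exec W (Seq c1 c2) (R, M) t (R', M') \<and>
      Q (var_view R') (array_view S M')"
    by (meson add_mono exec.Seq)
qed

lemma runs_asg: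
  assumes "Q (V(x := eval e V A)) A" "safe W S e V A" "eval e V A \<le> W" "x < 64"
  shows "runs (asg x e) (ecost e + 2) V A Q"
proof (rule runsI)
  fix R M assume VA: "V = var_view R" "A = array_view S M"
  then obtain t1 R1 where 1: "t1 \<le> ecost e" "exec W (compile e 64) (R, M) t1 (R1, M)"
    "R1 64 = eval e V A" "var_view R1 = V" using compileD[of e R M 64] assms(2) by auto
  let ?R2 = "R1(65 := 0)" let ?R3 = "?R2(x := apply_op Add (?R2 64) (?R2 65))"
  have "exec W (asg x e) (R, M) (t1 + (1 + 1)) (?R3, M)"
    unfolding asg_def using 1(3) assms(3)
    by (intro exec.Seq[OF 1(2)] exec.Seq[OF exec.Const] exec.Calc) auto
  moreover have "Q (var_view ?R3) (array_view S M)"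
  proof -
    have "var_view ?R3 = V(x := eval e V A)" using 1(3,4) assms(4) by (auto simp: var_view_def)
    then show ?thesis using assms(1) VA by simp
  qed
  moreover have "t1 + (1 + 1) \<le> ecost e + 2" using 1(1) by simp
  ultimately show "\<exists>t R' M'. t \<le> ecost e + 2 \<and> exec W (asg x e) (R, M) t (R', M') \<and>
      Q (var_view R') (array_view S M')"
    by blast
qed

lemma runs_put:
  assumes "Q V (A(a := (A a)(eval i V A := eval e V A)))"
    "safe W S e V A" "safe W S i V A" "valid_address W S a (eval i V A) V"
  shows "runs (put a i e) (ecost i + ecost e + 6) V A Q"
proof (rule runsI)
  fix R M assume VA: "V = var_view R" "A = array_view S M"
  then obtain t1 R1 where 1: "t1 \<le> ecost e" "exec W (compile e 64) (R, M) t1 (R1, M)"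
    "R1 64 = eval e V A" "var_view R1 = V" using compileD[of e R M 64] assms(2) by auto
  then obtain t2 R2 where 2: "t2 \<le> ecost i" "exec W (compile i 65) (R1, M) t2 (R2, M)"
    "R2 65 = eval i V A" "var_view R2 = V" "R2 64 = R1 64"
    using compileD[of i R1 M 65] assms(3) VA by auto
  obtain t3 R3 where 3: "t3 \<le> 5" "exec W (to_address a 65) (R2, M) t3 (R3, M)"
    "R3 65 = address S a (R2 65)" "\<forall>y < 65. R3 y = R2 y"
    using exec_to_address[of 65 W S a R2 M] 2 assms(4) W_ge_8 by auto
  let ?M = "M(R3 65 := R3 64)"
  have "exec W (put a i e) (R, M) (t1 + (t2 + (t3 + 1))) (R3, ?M)"
    unfolding put_def by (intro exec.Seq[OF 1(2)] exec.Seq[OF 2(2)] exec.Seq[OF 3(2)] exec.Store)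
  moreover have "var_view R3 = V" using 2(4) 3(4) by (auto simp: var_view_def)
  moreover have "array_view S ?M = A(a := (A a)(eval i V A := eval e V A))"
  proof -
    have "R3 65 = address S a (eval i V A)" "R3 64 = eval e V A" using 1 2 3 by auto
    moreover have "if a = 0 then eval i V A < S else a \<le> 8"
      using assms(4) by (auto simp: valid_address_def split: if_splits)
    ultimately show ?thesis using array_view_update[of a "eval i V A" S M "eval e V A"] VA by simp
  qed
  ultimately show "\<exists>t R' M'. t \<le> ecost i + ecost e + 6 \<and> exec W (put a i e) (R, M) t (R', M') \<and>
      Q (var_view R') (array_view S M')"
    using 1(1) 2(1) 3(1) assms(1)
    by (intro exI[of _ "t1 + (t2 + (t3 + 1))"] exI[of _ R3] exI[of _ ?M]) simp
qed

lemma runs_cond: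
  assumes "eval e V A \<noteq> 0 \<Longrightarrow> runs c1 T1 V A Q" "eval e V A = 0 \<Longrightarrow> runs c2 T2 V A Q" "safe W S e V A"
  shows "runs (cond e c1 c2) (ecost e + T1 + T2 + 1) V A Q"
proof (rule runsI)
  fix R M assume VA: "V = var_view R" "A = array_view S M"
  then obtain t1 R1 where 1: "t1 \<le> ecost e" "exec W (compile e 64) (R, M) t1 (R1, M)"
    "R1 64 = eval e V A" "var_view R1 = V" using compileD[of e R M 64] assms(3) by auto
  show "\<exists>t R' M'. t \<le> ecost e + T1 + T2 + 1 \<and> exec W (cond e c1 c2) (R, M) t (R', M') \<and>
      Q (var_view R') (array_view S M')"
  proof (cases "eval e V A = 0")
    case True
    with assms(2) have "runs c2 T2 (var_view R1) (array_view S M) Q" using 1 VA by simp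
    then obtain t R' M' where 2: "t \<le> T2" "exec W c2 (R1, M) t (R', M')"
      "Q (var_view R') (array_view S M')" by (rule runsD)
    have "exec W (Cond 64 c1 c2) (R1, M) (t + 1) (R', M')"
      using exec.CondF[of R1 64 W c2 M t "(R', M')" c1] 1(3) True 2(2) by simp
    then have "exec W (cond e c1 c2) (R, M) (t1 + (t + 1)) (R', M')"
      unfolding cond_def by (rule exec.Seq[OF 1(2)])
    then show ?thesis using 1(1) 2
      by (intro exI[of _ "t1 + (t + 1)"] exI[of _ R'] exI[of _ M']) simp
  next
    case False
    with assms(1) have "runs c1 T1 (var_view R1) (array_view S M) Q" using 1 VA by simp
    then obtain t R' M' where 2: "t \<le> T1" "exec W c1 (R1, M) t (R', M')"
      "Q (var_view R') (array_view S M')" by (rule runsD)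
    have "exec W (Cond 64 c1 c2) (R1, M) (t + 1) (R', M')"
      using exec.CondT[of R1 64 W c1 M t "(R', M')" c2] 1(3) False 2(2) by simp
    then have "exec W (cond e c1 c2) (R, M) (t1 + (t + 1)) (R', M')"
      unfolding cond_def by (rule exec.Seq[OF 1(2)])
    then show ?thesis using 1(1) 2
      by (intro exI[of _ "t1 + (t + 1)"] exI[of _ R'] exI[of _ M']) simp
  qed
qed

text \<open>\<open>I\<close> is indexed by the number of completed rounds. A nonzero guard forces
  \<open>i < m\<close>, so \<open>m - i\<close> decreases; this yields termination and the time
  bound together. Register 64 carries the guard value and is refreshed at the end of each
  round.\<close>

lemma exec_While_loop:
  assumes safe: "\<And>i V A. I i V A \<Longrightarrow> safe W S e V A"
    and body: "\<And>i V A. I i V A \<Longrightarrow> eval e V A \<noteq> 0 \<Longrightarrow> i < m \<and> runs c T V A (I (Suc i))"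
    and exit: "\<And>i V A. I i V A \<Longrightarrow> eval e V A = 0 \<Longrightarrow> Q V A"
    and "I i (var_view R) (array_view S M)" "R 64 = eval e (var_view R) (array_view S M)"
    and "m - i = d"
  shows "\<exists>t R' M'. t \<le> d * (T + ecost e + 1) + 1 \<and>
    exec W (While 64 (Seq c (compile e 64))) (R, M) t (R', M') \<and> Q (var_view R') (array_view S M')"
  using assms(4-)
proof (induction d arbitrary: i R M)
  case 0
  then have "eval e (var_view R) (array_view S M) = 0" using body by fastforce
  moreover from this have "Q (var_view R) (array_view S M)" using 0 exit by blast
  ultimately show ?case using exec.WhileF[of R 64 W "Seq c (compile e 64)" M] 0
    by (intro exI[of _ 1] exI[of _ R] exI[of _ M]) simp
next
  case (Suc d)
  show ?case
  proof (cases "eval e (var_view R) (array_view S M) = 0")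
    case True
    then have "Q (var_view R) (array_view S M)" using Suc exit by blast
    then show ?thesis using exec.WhileF[of R 64 W "Seq c (compile e 64)" M] Suc True
      by (intro exI[of _ 1] exI[of _ R] exI[of _ M]) simp
  next
    case False
    then obtain t1 R1 M1 where 1: "t1 \<le> T" "exec W c (R, M) t1 (R1, M1)"
      "I (Suc i) (var_view R1) (array_view S M1)" using body Suc.prems(1) runsD by metis
    from compileD[OF safe[OF 1(3)], of 64] obtain t2 R2 where 2: "t2 \<le> ecost e"
      "exec W (compile e 64) (R1, M1) t2 (R2, M1)"
      "R2 64 = eval e (var_view R1) (array_view S M1)" "var_view R2 = var_view R1" by auto
    have "m - Suc i = d" using Suc.prems(3) by simp
    from Suc.IH[of "Suc i" R2 M1, OF _ _ this] 1 2 obtain t3 R3 M3 where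
      3: "t3 \<le> d * (T + ecost e + 1) + 1"
      "exec W (While 64 (Seq c (compile e 64))) (R2, M1) t3 (R3, M3)"
      "Q (var_view R3) (array_view S M3)" by auto
    have "exec W (While 64 (Seq c (compile e 64))) (R, M) ((t1 + t2) + t3 + 1) (R3, M3)"
      using False Suc.prems(2) by (intro exec.WhileT[OF _ exec.Seq[OF 1(2) 2(2)] 3(2)]) simp
    moreover have "(t1 + t2) + t3 + 1 \<le> Suc d * (T + ecost e + 1) + 1"
      using 1(1) 2(1) 3(1) by simp
    ultimately show ?thesis using 3(3) by blast
  qed
qed

lemma runs_loop:
  assumes "I 0 V A" "\<And>i V A. I i V A \<Longrightarrow> safe W S e V A"
    and "\<And>i V A. I i V A \<Longrightarrow> eval e V A \<noteq> 0 \<Longrightarrow> i < m \<and> runs c T V A (I (Suc i))"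
    and "\<And>i V A. I i V A \<Longrightarrow> eval e V A = 0 \<Longrightarrow> Q V A"
  shows "runs (loop e c) (m * (T + ecost e + 1) + ecost e + 1) V A Q"
proof (rule runsI)
  fix R M assume VA: "V = var_view R" "A = array_view S M"
  then obtain t1 R1 where 1: "t1 \<le> ecost e" "exec W (compile e 64) (R, M) t1 (R1, M)"
    "R1 64 = eval e V A" "var_view R1 = V" using compileD[of e R M 64] assms(2)[OF assms(1)] by auto
  obtain t2 R2 M2 where 2: "t2 \<le> m * (T + ecost e + 1) + 1"
    "exec W (While 64 (Seq c (compile e 64))) (R1, M) t2 (R2, M2)"
    "Q (var_view R2) (array_view S M2)"
    using exec_While_loop[of I e m c T Q 0 R1 M m] assms 1 VA by auto
  have "exec W (loop e c) (R, M) (t1 + t2) (R2, M2)"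
    unfolding loop_def by (rule exec.Seq[OF 1(2) 2(2)])
  then show "\<exists>t R' M'. t \<le> m * (T + ecost e + 1) + ecost e + 1 \<and> exec W (loop e c) (R, M) t (R', M') \<and>
      Q (var_view R') (array_view S M')"
    using 1(1) 2 by (intro exI[of _ "t1 + t2"] exI[of _ R2] exI[of _ M2]) simp
qed

text \<open>The overhead of 10 per round is 6 for incrementing the counter, 3 for subtracting it
  from the bound and 1 for the test. The final 7 is 3 for the initial assignment, 3 for the first
  guard and 1 for the last test.\<close>

abbreviation iter_time :: "nat \<Rightarrow> nat \<Rightarrow> expr \<Rightarrow> nat" where
  "iter_time m T e \<equiv> m * (T + ecost e + 10) + ecost e + 7"

abbreviation step_post :: "nat \<Rightarrow> (nat \<Rightarrow> vars \<Rightarrow> arrays \<Rightarrow> bool) \<Rightarrow> nat \<Rightarrow> vars \<Rightarrow> arrays \<Rightarrow> bool" where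
  "step_post x I i \<equiv> \<lambda>V A. V x = i \<and> I (Suc i) (V(x := Suc i)) A"

lemma runs_iter:
  assumes "I 0 (V(x := 0)) A" "x < 64" "m < W"
    and bound: "\<And>i V A. I i V A \<Longrightarrow> V x = i \<Longrightarrow> i \<le> m \<Longrightarrow> safe W S e V A \<and> eval e V A = m"
    and body: "\<And>i V A. I i V A \<Longrightarrow> V x = i \<Longrightarrow> i < m \<Longrightarrow>
      runs c T V A (step_post x I i)"
    and exit: "\<And>V A. I m V A \<Longrightarrow> V x = m \<Longrightarrow> Q V A"
  shows "runs (iter x e c) (iter_time m T e) V A Q"
proof -
  let ?I = "\<lambda>i V A. I i V A \<and> V x = i \<and> i \<le> m"
  let ?e = "Bop Sub e (Var x)" let ?i = "Bop Add (Var x) (Num 1)"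
  have safe: "safe W S ?e V A" if "?I i V A" for i V A
    using bound[of i V A] that assms(2,3) by auto
  have step: "i < m \<and> runs (Seq c (asg x ?i)) (T + (ecost ?i + 2)) V A (?I (Suc i))"
    if I: "?I i V A" and "eval ?e V A \<noteq> 0" for i V A
  proof
    show "i < m" using bound[of i V A] that by auto
    then have c: "runs c T V A (step_post x I i)" using I body by blast
    have asg: "runs (asg x ?i) (ecost ?i + 2) V A (?I (Suc i))"
      if "V x = i \<and> I (Suc i) (V(x := Suc i)) A" for V A
      by (rule runs_asg) (use that \<open>i < m\<close> assms(2,3) in auto)
    have "runs c T V A (\<lambda>V A. runs (asg x ?i) (ecost ?i + 2) V A (?I (Suc i)))"
      by (rule runs_mono[OF c le_refl asg])
    then show "runs (Seq c (asg x ?i)) (T + (ecost ?i + 2)) V A (?I (Suc i))" by (rule runs_Seq)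
  qed
  have exit': "Q V A" if "?I i V A" "eval ?e V A = 0" for i V A
  proof -
    have "i = m" using bound[of i V A] that by auto
    then show ?thesis using that exit by blast
  qed
  have "runs (loop ?e (Seq c (asg x ?i))) (m * ((T + (ecost ?i + 2)) + ecost ?e + 1) + ecost ?e + 1)
      (V(x := 0)) A Q"
    by (rule runs_loop[where I = ?I]) (use assms(1) safe step exit' in \<open>auto simp del: eval.simps safe.simps\<close>)
  then have "runs (asg x (Num 0)) (ecost (Num 0) + 2) V A (\<lambda>V A. runs (loop ?e (Seq c (asg x ?i)))
      (m * ((T + (ecost ?i + 2)) + ecost ?e + 1) + ecost ?e + 1) V A Q)"
    by (intro runs_asg) (use assms(2) in auto)
  from runs_Seq[OF this] have "runs (Seq (asg x (Num 0)) (loop ?e (Seq c (asg x ?i))))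
     ((ecost (Num 0) + 2) + (m * ((T + (ecost ?i + 2)) + ecost ?e + 1) + ecost ?e + 1)) V A Q" .
  then show ?thesis unfolding iter_def by (rule runs_time) (simp add: algebra_simps)
qed

end

section \<open>Testing a stored configuration\<close>

text \<open>
  Variables: \<open>vC\<close> the number of codes, \<open>vL\<close> the length of the queue, \<open>vh\<close> the entry being expanded,
  \<open>vu\<close> the new head, \<open>vp\<close> a code and \<open>vP\<close> its unread digits, \<open>vm\<close> the number of digits read, \<open>vq\<close> a
  queue entry, \<open>vf\<close> and \<open>vacc\<close> flags. Arrays: \<open>aF\<close> the final configuration, \<open>aQ\<close> the queue, \<open>aP\<close> and \<open>aD\<close>
  the parents and depths of its entries, \<open>aX\<close> the recorded future. Array 0 is the memory below \<open>S\<close>.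
\<close>

abbreviation (input) vn :: nat where "vn \<equiv> 21"
abbreviation (input) vk :: nat where "vk \<equiv> 22"
abbreviation (input) vC :: nat where "vC \<equiv> 3"
abbreviation (input) vL :: nat where "vL \<equiv> 4"
abbreviation (input) vh :: nat where "vh \<equiv> 5"
abbreviation (input) vu :: nat where "vu \<equiv> 6"
abbreviation (input) vp :: nat where "vp \<equiv> 7"
abbreviation (input) vq :: nat where "vq \<equiv> 8"
abbreviation (input) vP :: nat where "vP \<equiv> 9"
abbreviation (input) vm :: nat where "vm \<equiv> 10"
abbreviation (input) vi :: nat where "vi \<equiv> 11"
abbreviation (input) vj :: nat where "vj \<equiv> 12"
abbreviation (input) vf :: nat where "vf \<equiv> 13"
abbreviation (input) vacc :: nat where "vacc \<equiv> 14"

abbreviation (input) aF :: nat where "aF \<equiv> 6"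
abbreviation (input) aQ :: nat where "aQ \<equiv> 2"
abbreviation (input) aP :: nat where "aP \<equiv> 3"
abbreviation (input) aD :: nat where "aD \<equiv> 4"
abbreviation (input) aX :: nat where "aX \<equiv> 5"

abbreviation (input) add :: "expr \<Rightarrow> expr \<Rightarrow> expr" (infixl "[+]" 65) where "a [+] b \<equiv> Bop Add a b"
abbreviation sub :: "expr \<Rightarrow> expr \<Rightarrow> expr" (infixl "[-]" 65) where "a [-] b \<equiv> Bop Sub a b"
abbreviation mul :: "expr \<Rightarrow> expr \<Rightarrow> expr" (infixl "[*]" 70) where "a [*] b \<equiv> Bop Mul a b"
abbreviation quo :: "expr \<Rightarrow> expr \<Rightarrow> expr" (infixl "[div]" 70) where "a [div] b \<equiv> Bop Div a b"
abbreviation rem :: "expr \<Rightarrow> expr \<Rightarrow> expr" (infixl "[mod]" 70) where "a [mod] b \<equiv> Bop Mod a b"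
text \<open>By truncated subtraction this evaluates to the distance of \<open>a\<close> and
  \<open>b\<close>.\<close>

abbreviation neq :: "expr \<Rightarrow> expr \<Rightarrow> expr" (infix "[\<noteq>]" 50) where
  "a [\<noteq>] b \<equiv> (a [-] b) [+] (b [-] a)"

text \<open>The flag is only ever cleared, so consecutive and nested loops accumulate one
  conjunction.\<close>

definition all_loop :: "nat \<Rightarrow> expr \<Rightarrow> expr \<Rightarrow> prog" where
  "all_loop x e t = iter x e (cond t Skip (asg vf (Num 0)))"

definition agree :: "nat set \<Rightarrow> vars \<Rightarrow> vars \<Rightarrow> bool" where
  "agree U V V' \<longleftrightarrow> (\<forall>x. x \<notin> U \<longrightarrow> V' x = V x)"

lemma agree_refl [simp]: "agree U V V"
  by (simp add: agree_def)

lemma agree_trans: "agree U V V1 \<Longrightarrow> agree U' V1 V2 \<Longrightarrow> U \<subseteq> U'' \<Longrightarrow> U' \<subseteq> U'' \<Longrightarrow> agree U'' V V2"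
  unfolding agree_def subset_iff by metis

lemma agree_upd: "agree U V V' \<Longrightarrow> x \<in> U \<Longrightarrow> agree U V (V'(x := y))"
  by (auto simp: agree_def)

lemma (in machine) runs_all:
  assumes "x \<noteq> vf" "x < 64" "m < W" "V vf = of_bool b"
    and bound: "\<And>V'. agree {x, vf} V V' \<Longrightarrow> V' x \<le> m \<Longrightarrow> safe W S e V' A \<and> eval e V' A = m"
    and test: "\<And>V' i. agree {x, vf} V V' \<Longrightarrow> V' x = i \<Longrightarrow> i < m \<Longrightarrow>
      safe W S t V' A \<and> (eval t V' A \<noteq> 0 \<longleftrightarrow> P i)"
    and exit: "\<And>V'. agree {x, vf} V V' \<Longrightarrow> V' vf = of_bool (b \<and> (\<forall>i < m. P i)) \<Longrightarrow> Q V' A"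
  shows "runs (all_loop x e t) (m * (ecost t + ecost e + 20) + ecost e + 7) V A Q"
proof -
  let ?I = "\<lambda>i V' A'. A' = A \<and> agree {x, vf} V V' \<and> V' vf = of_bool (b \<and> (\<forall>i' < i. P i'))"
  have "runs (all_loop x e t) (iter_time m (ecost t + 1 + (ecost (Num 0) + 2) + 1) e) V A Q"
    unfolding all_loop_def
  proof (rule runs_iter[where I = ?I])
    fix i V' A' assume I: "?I i V' A'" "V' x = i"
    { assume "i \<le> m" then show "safe W S e V' A' \<and> eval e V' A' = m" using I bound by simp }
    assume i: "i < m"
    have t: "safe W S t V' A" "eval t V' A \<noteq> 0 \<longleftrightarrow> P i" using test I i by auto
    have ag: "agree {x, vf} V (V'(x := Suc i))" "agree {x, vf} V (V'(vf := 0, x := Suc i))"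
      using I by (auto intro!: agree_upd)
    have "runs (cond t Skip (asg vf (Num 0))) (ecost t + 1 + (ecost (Num 0) + 2) + 1) V' A
       (step_post x ?I i)"
    proof (rule runs_cond)
      assume "eval t V' A \<noteq> 0"
      then show "runs Skip 1 V' A (step_post x ?I i)"
        using I t ag(1) assms(1) by (intro runs_Skip) (auto simp: less_Suc_eq)
    next
      assume "eval t V' A = 0"
      then show "runs (asg vf (Num 0)) (ecost (Num 0) + 2) V' A
          (step_post x ?I i)"
        using I t ag(2) assms(1) by (intro runs_asg) (auto simp: less_Suc_eq)
    qed (rule t)
    then show "runs (cond t Skip (asg vf (Num 0))) (ecost t + 1 + (ecost (Num 0) + 2) + 1) V' A'
       (step_post x ?I i)" using I by simp
  next
    fix V' A' assume "?I m V' A'"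
    then show "Q V' A'" using exit by blast
  next
    show "?I 0 (V(x := 0)) A" using assms(1,4) by (auto intro!: agree_upd)
  qed (use assms in auto)
  then show ?thesis by (rule runs_time) (simp add: algebra_simps)
qed

definition admits_prog :: prog where
  "admits_prog = Seq (asg vf (Num 1))
    (Seq (cond (Get aQ (Var vq [*] Var vk) [\<noteq>] Var vu) (asg vf (Num 0)) Skip)
    (iter vi (Var vk) (all_loop vj (Var vk [-] (Var vi [+] Num 1))
       (Get aX (Var vj) [\<noteq>] (Get aQ (Var vq [*] Var vk [+] Var vi) [+] Num 1)))))"

text \<open>\<open>QM\<close> bounds the length of the queue, and \<open>S\<close> exceeds the size of both the input and the output.\<close>

locale snake_machine = snake_input n k E init fin + machine W S
  for n k E init fin W S +
  fixes QM :: nat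
  assumes QM: "QM = n * codes k * k"
    and S: "S = 10 + n * n + 2 * k + k * k + codes k + k * (QM + k + 1)"
    and W: "S + 8 * ((QM + 2) * k + QM + k + 2) + 100 \<le> W"
begin

lemma n_pos: "1 \<le> n"
  using confD(5)[OF conf_init, of 0] k by simp

lemma codes_pos: "1 \<le> codes k"
  using k by (simp add: codes_def)

lemma k_le_QM: "k \<le> QM"
proof -
  have "1 \<le> n * codes k" using n_pos codes_pos by simp
  from mult_le_mono1[OF this, of k] show ?thesis by (simp add: QM)
qed

lemma n_le_QM: "n \<le> QM"
proof -
  have "1 \<le> codes k * k" using k codes_pos by simp
  from mult_le_mono2[OF this, of n] show ?thesis by (simp add: QM mult.assoc)
qed

lemma small: "n < W" "k < W" "S < W" "codes k < W" "k * k < W" "n * n < W" "QM < W" "8 \<le> W"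
  using S W n_le_QM by (simp_all add: algebra_simps)

text \<open>A candidate is built in the slot just behind the queue and \<open>k\<close> itself is
  allowed as an offset; this gives the term \<open>(QM + 2) * k\<close> in the lower bound on
  \<open>W\<close>.\<close>

lemma entry_address: "q \<le> Suc QM \<Longrightarrow> i \<le> k \<Longrightarrow> S + 8 * (q * k + i) + 8 < W"
proof -
  assume "q \<le> Suc QM" "i \<le> k"
  then have "q * k + i \<le> Suc QM * k + k" by (intro add_mono mult_le_mono1)
  then show ?thesis using W by simp
qed

lemma entry_address': "q \<le> Suc QM \<Longrightarrow> S + 8 * (q * k) + 8 < W"
  using entry_address[of q 0] by simp

lemma index_address: "q \<le> Suc QM \<Longrightarrow> S + 8 * q + 8 < W"
  using W by simp

lemma k_le_kk: "k \<le> k * k" "1 \<le> k * k"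
  using k by simp_all

lemma runs_admits:
  assumes V: "V vk = k" "V vS = S" "V vq = q" "V vu = v" and q: "q \<le> QM" and v: "v < n"
    and c: "\<And>i. i < k \<Longrightarrow> A aQ (q * k + i) = c ! i \<and> c ! i < n"
    and X: "\<And>j. j < k \<Longrightarrow> A aX j = X j \<and> X j \<le> n"
    and cont: "\<And>V'. agree {vf, vi, vj} V V' \<Longrightarrow> V' vf = of_bool (c ! 0 = v \<and> admits k X c) \<Longrightarrow> Q V' A"
  shows "runs admits_prog (300 * (k * k)) V A Q"
proof -
  let ?P = "\<lambda>i. \<forall>j < k - Suc i. X j \<noteq> Suc (c ! i)"
  let ?I = "\<lambda>i V' A'. A' = A \<and> agree {vf, vi, vj} V V' \<and> V' vf = of_bool (c ! 0 = v \<and> (\<forall>i' < i. ?P i'))"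
  let ?t = "Get aX (Var vj) [\<noteq>] (Get aQ (Var vq [*] Var vk [+] Var vi) [+] Num 1)"
  let ?e = "Var vk [-] (Var vi [+] Num 1)"
  have c0: "A aQ (q * k) = c ! 0" "c ! 0 < n" using c[of 0] k by auto
  have inner: "runs (all_loop vj ?e ?t) (k * (ecost ?t + ecost ?e + 20) + ecost ?e + 7) V' A
      (step_post vi ?I i)"
    if I: "agree {vf, vi, vj} V V'" "V' vf = of_bool (c ! 0 = v \<and> (\<forall>i' < i. ?P i'))" "V' vi = i" "i < k" for V' i
  proof (rule runs_time, rule runs_all[where m = "k - Suc i" and P = "\<lambda>j. X j \<noteq> Suc (c ! i)"])
    fix W1 assume a: "agree {vj, vf} V' W1"
    have [simp]: "W1 vk = k" "W1 vS = S" "W1 vi = i" "W1 vq = q" using a I V by (auto simp: agree_def)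
    { show "safe W S ?e W1 A \<and> eval ?e W1 A = k - Suc i" using small I(4) by simp }
    { fix j assume j: "W1 vj = j" "j < k - Suc i"
      then have "S + 8 * j + 8 < W" using index_address[of j] k_le_QM by simp
      moreover have "S + 8 * (q * k + i) + 8 < W" using entry_address[of q i] q I(4) by simp
      moreover have "A aQ (q * k + i) = c ! i" "c ! i < n" using c I(4) by auto
      moreover have "A aX j = X j" "X j \<le> n" using X[of j] j by auto
      ultimately show "safe W S ?t W1 A \<and> (eval ?t W1 A \<noteq> 0 \<longleftrightarrow> X j \<noteq> Suc (c ! i))"
        using small q j by (auto simp: valid_address_def address_def) }
    { assume "W1 vf = of_bool ((c ! 0 = v \<and> (\<forall>i' < i. ?P i')) \<and> ?P i)"
      then show "W1 vi = i \<and> ?I (Suc i) (W1(vi := Suc i)) A"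
        using a I(1) by (auto simp: agree_def less_Suc_eq) }
  qed (use I small in \<open>auto intro!: mult_le_mono1\<close>)
  have outer: "runs (iter vi (Var vk) (all_loop vj ?e ?t))
      (iter_time k (k * (ecost ?t + ecost ?e + 20) + ecost ?e + 7) (Var vk)) V' A Q"
    if "agree {vf} V V'" "V' vf = of_bool (c ! 0 = v)" for V'
  proof (rule runs_iter[where I = ?I])
    fix i V' A' assume I: "?I i V' A'" "V' vi = i"
    then show "safe W S (Var vk) V' A' \<and> eval (Var vk) V' A' = k"
      using small V by (auto simp: agree_def)
    assume "i < k"
    then show "runs (all_loop vj ?e ?t) (k * (ecost ?t + ecost ?e + 20) + ecost ?e + 7) V' A'
        (step_post vi ?I i)" using I inner by blast
  next
    fix V' A' assume "?I k V' A'"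
    moreover have "(\<forall>i' < k. ?P i') \<longleftrightarrow> admits k X c"
      unfolding admits_def by (auto simp: less_diff_conv)
    ultimately show "Q V' A'" using cont by simp
  qed (use that small in \<open>auto simp: agree_def\<close>)
  show ?thesis unfolding admits_prog_def
    apply (rule runs_time)
     apply ((rule runs_Seq runs_asg runs_cond runs_Skip outer)
       | (use V c0 q v small entry_address'[of q] in \<open>auto simp: agree_def valid_address_def address_def; fail\<close>))+
    by (simp add: algebra_simps) (use k_le_kk in linarith)
qed

end

section \<open>Expanding a configuration\<close>

text \<open>The summand \<open>2 div (k + 1)\<close> is nonzero only for \<open>k = 1\<close>, when all moves are allowed.\<close>

definition legal_prog :: prog where
  "legal_prog = Seq (asg vf (Num 1))
    (Seq (cond (Get 0 (Num 2 [+] Var vu [*] Var vn [+] Get aQ (Var vh [*] Var vk)) [+]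
        (Num 2 [div] (Var vk [+] Num 1))) Skip (asg vf (Num 0)))
    (all_loop vi (Var vk [-] Num 1) (Get aQ (Var vh [*] Var vk [+] Var vi) [\<noteq>] Var vu)))"

text \<open>The successor is written behind the end of the queue, where the scan can treat it like
  an entry. It joins the queue only if \<open>vL\<close> is incremented later; otherwise the next
  candidate overwrites it.\<close>

definition build_prog :: prog where
  "build_prog = Seq (put aQ (Var vL [*] Var vk) (Var vu))
    (Seq (iter vi (Var vk [-] Num 1)
        (put aQ (Var vL [*] Var vk [+] Var vi [+] Num 1) (Get aQ (Var vh [*] Var vk [+] Var vi))))
    (Seq (put aP (Var vL) (Var vh)) (put aD (Var vL) (Get aD (Var vh) [+] Num 1))))"

definition digit_expr :: expr where
  "digit_expr = Var vP [mod] (Var vk [*] Var vk)"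

text \<open>The loop runs over \<open>vL + 1\<close> entries. The extra one is the candidate, so its
  test uses the same code as the others: on exit \<open>vf\<close> tells whether the candidate
  admits the record, and if so \<open>vm\<close> includes a digit of its own.\<close>

definition scan_prog :: prog where
  "scan_prog = Seq (asg vP (Var vp)) (Seq (asg vm (Num 0))
    (Seq (iter vj (Var vk) (put aX (Var vj) (Num 0)))
    (iter vq (Var vL [+] Num 1) (Seq admits_prog
      (cond (Var vf)
        (Seq (put aX (digit_expr [mod] Var vk)
            (Get aQ (Var vq [*] Var vk [+] digit_expr [div] Var vk) [+] Num 1))
        (Seq (asg vP (Var vP [div] (Var vk [*] Var vk))) (asg vm (Var vm [+] Num 1))))
        Skip)))))"

definition accept_prog :: prog where
  "accept_prog = Seq (asg vacc (Num 0)) (iter vp (Var vC) (Seq scan_prog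
     (cond (Var vf [*] (Var vk [+] Num 1 [-] Var vm)) (asg vacc (Num 1)) Skip)))"

definition extend_prog :: prog where
  "extend_prog = Seq legal_prog (cond (Var vf)
     (Seq build_prog (Seq accept_prog (cond (Var vacc) (asg vL (Var vL [+] Num 1)) Skip))) Skip)"

definition bfs_prog :: prog where
  "bfs_prog = Seq (asg vL (Num 1)) (Seq (asg vh (Num 0))
     (loop (Var vL [-] Var vh)
       (Seq (iter vu (Var vn) extend_prog) (asg vh (Var vh [+] Num 1)))))"

lemma cell_bound:
  fixes u v m l :: nat
  assumes "u < m" "v < l"
  shows "u * l + v < m * l"
proof -
  have "u * l + v < Suc u * l" using assms(2) by simp
  also have "\<dots> \<le> m * l" using assms(1) by (intro mult_le_mono1) simp
  finally show ?thesis .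
qed

context snake_machine
begin

text \<open>The facts that the search leaves unchanged. The bound by 1 keeps the edge test, a sum of
  a cell and \<open>2 div Suc k\<close>, within a word.\<close>

definition static :: "vars \<Rightarrow> arrays \<Rightarrow> bool" where
  "static V A \<longleftrightarrow> V vn = n \<and> V vk = k \<and> V vS = S \<and> V vC = codes k \<and>
     (\<forall>u < n. \<forall>v < n. A 0 (2 + u * n + v) \<le> 1 \<and> (A 0 (2 + u * n + v) + 2 div Suc k \<noteq> 0 \<longleftrightarrow> E u v)) \<and>
     (\<forall>i < k. A aF i = fin ! i)"

definition queue :: "nat list list \<Rightarrow> arrays \<Rightarrow> bool" where
  "queue Q A \<longleftrightarrow> (\<forall>q < length Q. \<forall>i < k. A aQ (q * k + i) = Q ! q ! i)"

lemma staticD: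
  assumes "static V A"
  shows "V vn = n" "V vk = k" "V vS = S" "V vC = codes k"
    "u < n \<Longrightarrow> v < n \<Longrightarrow> A 0 (2 + u * n + v) \<le> 1"
    "u < n \<Longrightarrow> v < n \<Longrightarrow> A 0 (2 + u * n + v) + 2 div Suc k \<noteq> 0 \<longleftrightarrow> E u v"
    "i < k \<Longrightarrow> A aF i = fin ! i"
  using assms by (simp_all add: static_def)

lemma static_cong:
  assumes "static V A" "agree U V V'" "U \<inter> {vn, vk, vS, vC} = {}" "A' 0 = A 0" "A' aF = A aF"
  shows "static V' A'"
proof -
  have "V' vn = V vn" "V' vk = V vk" "V' vS = V vS" "V' vC = V vC"
    using assms(2,3) by (auto simp: agree_def)
  then show ?thesis using assms(1,4,5) unfolding static_def by simp
qed

lemma cell_address: "u < n \<Longrightarrow> v < n \<Longrightarrow> 2 + u * n + v < S"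
  using cell_bound[of u n v n] S by simp

lemma runs_legal:
  assumes st: "static V A" and qu: "queue Q A" and V: "V vh = h" "V vu = u"
    and h: "h < length Q" "length Q \<le> QM" and conf: "conf (Q ! h)" and u: "u < n"
    and cont: "\<And>V'. agree {vf, vi} V V' \<Longrightarrow> V' vf = of_bool (legal u (Q ! h)) \<Longrightarrow> R V' A"
  shows "runs legal_prog (200 * k) V A R"
proof -
  let ?c = "Q ! h"
  note S' = staticD[OF st]
  have c: "A aQ (h * k + i) = ?c ! i" "?c ! i < n" if "i < k" for i
    using qu h that confD(5)[OF conf that] by (auto simp: queue_def)
  have c0: "A aQ (h * k) = ?c ! 0" "?c ! 0 < n" using c[of 0] k by auto
  have addr: "S + 8 * (h * k + i) + 8 < W" if "i < k" for i
    using entry_address[of h i] h that by simp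
  have addr0: "S + 8 * (h * k) + 8 < W" using addr[of 0] k by simp
  have cell: "2 + u * n + ?c ! 0 < S" using cell_address[OF u c0(2)] .
  have edge: "A 0 (2 + u * n + ?c ! 0) \<le> 1" "A 0 (2 + u * n + ?c ! 0) + 2 div Suc k \<noteq> 0 \<longleftrightarrow> E u (?c ! 0)"
    using S'(5,6)[OF u c0(2)] .
  have "2 div Suc k \<le> 2" by (rule div_le_dividend)
  then have quot: "2 div Suc k \<le> W" and sum: "A 0 (2 + u * n + ?c ! 0) + 2 div Suc k \<le> W"
    using edge(1) small by linarith+
  let ?e = "Var vk [-] Num 1" let ?t = "Get aQ (Var vh [*] Var vk [+] Var vi) [\<noteq>] Var vu"
  have loop: "runs (all_loop vi ?e ?t) ((k - 1) * (ecost ?t + ecost ?e + 20) + ecost ?e + 7) V' A R"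
    if V': "agree {vf} V V'" "V' vf = of_bool (E u (?c ! 0))" for V'
  proof (rule runs_all[where P = "\<lambda>i. ?c ! i \<noteq> u"])
    fix V1 assume a: "agree {vi, vf} V' V1"
    have [simp]: "V1 vk = k" "V1 vS = S" "V1 vh = h" "V1 vu = u" using a V' V S' by (auto simp: agree_def)
    show "safe W S ?e V1 A \<and> eval ?e V1 A = k - 1" using small by simp
    { fix i assume i: "V1 vi = i" "i < k - 1"
      then have "i < k" by simp
      then show "safe W S ?t V1 A \<and> (eval ?t V1 A \<noteq> 0 \<longleftrightarrow> ?c ! i \<noteq> u)"
        using small c[of i] addr[of i] i u h by (auto simp: valid_address_def address_def) }
    { assume "V1 vf = of_bool (E u (?c ! 0) \<and> (\<forall>i < k - 1. ?c ! i \<noteq> u))"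
      moreover have "E u (?c ! 0) \<and> (\<forall>i < k - 1. ?c ! i \<noteq> u) \<longleftrightarrow> legal u ?c"
        using u by (auto simp: legal_def less_diff_conv)
      moreover have "agree {vf, vi} V V1" using a V' by (auto simp: agree_def)
      ultimately show "R V1 A" using cont by simp }
  qed (use V' small in auto)
  let ?g = "Get 0 (Num 2 [+] Var vu [*] Var vn [+] Get aQ (Var vh [*] Var vk)) [+] (Num 2 [div] (Var vk [+] Num 1))"
  have cell': "safe W S ?g V' A" "eval ?g V' A \<noteq> 0 \<longleftrightarrow> E u (?c ! 0)" if "agree {vf} V V'" for V'
  proof -
    have [simp]: "V' vk = k" "V' vS = S" "V' vh = h" "V' vu = u" "V' vn = n"
      using that V S' by (auto simp: agree_def)
    show "eval ?g V' A \<noteq> 0 \<longleftrightarrow> E u (?c ! 0)" using edge c0 by simp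
    show "safe W S ?g V' A"
      using c0 cell addr0 h u small quot sum by (simp add: valid_address_def address_def)
  qed
  have "k - 1 \<le> k" by simp
  then have time: "(k - 1) * (ecost ?t + ecost ?e + 20) \<le> k * (ecost ?t + ecost ?e + 20)"
    by (rule mult_le_mono1)
  show ?thesis unfolding legal_prog_def
    apply (rule runs_time)
     apply ((rule runs_Seq runs_asg runs_cond runs_Skip loop)
       | (rule cell'(1), simp add: agree_upd; fail)
       | (use cell'(2)[of "V(vf := 1)"] small in \<open>simp add: agree_upd; fail\<close>))+
    using time k by simp
qed

lemma bfs_inv_conf: "bfs_inv Q par dep h u \<Longrightarrow> q < length Q \<Longrightarrow> conf (Q ! q)"
  by (simp add: bfs_inv_def)

text \<open>Parents precede their children. Depths therefore fit into words, and a path that is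
  written out has at most \<open>QM + k\<close> moves.\<close>

lemma bfs_inv_dep:
  assumes "bfs_inv Q par dep h u" "q < length Q"
  shows "dep q \<le> q"
  using assms(2)
proof (induction q rule: less_induct)
  case (less q)
  show ?case
  proof (cases "q = 0")
    case False
    then have "par q < q" "dep q = Suc (dep (par q))" using assms(1) less.prems by (auto simp: bfs_inv_def)
    then show ?thesis using less.IH[of "par q"] less.prems by simp
  qed (use assms(1) in \<open>simp add: bfs_inv_def\<close>)
qed

lemma bfs_invD:
  assumes "bfs_inv Q par dep h u"
  shows "Q \<noteq> []" "Q ! 0 = init" "dep 0 = 0" "h \<le> length Q"
    "q < length Q \<Longrightarrow> conf (Q ! q)" "q < length Q \<Longrightarrow> needed k (take q Q) (Q ! q)"
    "q < length Q \<Longrightarrow> 0 < q \<Longrightarrow> par q < q" "q < length Q \<Longrightarrow> 0 < q \<Longrightarrow> dep q = Suc (dep (par q))"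
    "q < length Q \<Longrightarrow> 0 < q \<Longrightarrow> step (Q ! par q) (Q ! q)"
    "q \<le> q' \<Longrightarrow> q' < length Q \<Longrightarrow> dep q \<le> dep q'"
    "h < length Q \<Longrightarrow> q < length Q \<Longrightarrow> dep q \<le> Suc (dep h)"
    "p < h \<or> p = h \<and> h < length Q \<and> v < u \<Longrightarrow> legal v (Q ! p) \<Longrightarrow>
       represented Q dep (move v (Q ! p)) (Suc (dep p))"
  using assms unfolding bfs_inv_def by simp_all

text \<open>Used after a rejection, when slot \<open>length Q\<close> of the parent and depth arrays
  still holds the values of the discarded candidate.\<close>

lemma bfs_inv_cong:
  assumes inv: "bfs_inv Q par dep h u"
    and par: "\<And>q. q < length Q \<Longrightarrow> par' q = par q" and dep: "\<And>q. q < length Q \<Longrightarrow> dep' q = dep q"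
  shows "bfs_inv Q par' dep' h u"
proof -
  note D = bfs_invD[OF inv]
  have rep: "represented Q dep' c m = represented Q dep c m" for c m
    using dep unfolding represented_def by (simp cong: conj_cong)
  have parent: "par' q < q \<and> dep' q = Suc (dep' (par' q)) \<and> step (Q ! par' q) (Q ! q)"
    if "q < length Q" "0 < q" for q
  proof -
    have "par q < length Q" using D(7)[OF that] that by simp
    then show ?thesis using D(7-9)[OF that] par dep that by simp
  qed
  have mono: "dep' q \<le> dep' q'" if "q \<le> q'" "q' < length Q" for q q'
    using D(10)[OF that] dep that by simp
  have level: "dep' q \<le> Suc (dep' h)" if "h < length Q" "q < length Q" for q
    using D(11)[OF that] dep that by simp
  have succ: "represented Q dep' (move v (Q ! p)) (Suc (dep' p))"
    if "p < h \<or> p = h \<and> h < length Q \<and> v < u" "legal v (Q ! p)" for p v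
  proof -
    have "p < length Q" using that(1) D(4) by auto
    then show ?thesis using D(12)[OF that] dep rep by simp
  qed
  have "dep' 0 = 0" using D(1,3) dep by simp
  then show ?thesis unfolding bfs_inv_def using D(1,2,4-6) parent mono level succ by blast
qed

lemma runs_build:
  assumes st: "static V A" and qu: "queue Q A" and V: "V vh = h" "V vu = u" "V vL = length Q"
    and h: "h < length Q" "length Q \<le> QM" and conf: "conf (Q ! h)" and u: "u < n"
    and dep: "A aD h < QM"
    and cont: "\<And>V' A'. agree {vi} V V' \<Longrightarrow> (\<And>a. a \<notin> {aQ, aP, aD} \<Longrightarrow> A' a = A a) \<Longrightarrow>
      queue (Q @ [move u (Q ! h)]) A' \<Longrightarrow> A' aP = (A aP)(length Q := h) \<Longrightarrow>
      A' aD = (A aD)(length Q := Suc (A aD h)) \<Longrightarrow> R V' A'"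
  shows "runs build_prog (200 * k) V A R"
proof -
  let ?c = "Q ! h" let ?b = "move u ?c" let ?L = "length Q"
  note S' = staticD(1-4)[OF st]
  let ?e = "Var vk [-] Num 1"
  let ?put = "put aQ (Var vL [*] Var vk [+] Var vi [+] Num 1) (Get aQ (Var vh [*] Var vk [+] Var vi))"
  let ?tput = "ecost (Var vL [*] Var vk [+] Var vi [+] Num 1) + ecost (Get aQ (Var vh [*] Var vk [+] Var vi)) + 6"
  let ?I = "\<lambda>i V' A'. agree {vi} V V' \<and> (\<forall>a. a \<noteq> aQ \<longrightarrow> A' a = A a) \<and>
    (\<forall>x < ?L * k. A' aQ x = A aQ x) \<and> (\<forall>i' \<le> i. A' aQ (?L * k + i') = ?b ! i')"
  have addr: "S + 8 * (q * k + i) + 8 < W" if "q \<le> ?L" "i \<le> k" for q i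
    using entry_address[of q i] h that by simp
  have loop: "runs (iter vi ?e ?put) (iter_time (k - 1) ?tput ?e) V1 A1 R1"
    if I0: "?I 0 V1 A1" and post: "\<And>V' A'. ?I (k - 1) V' A' \<Longrightarrow> R1 V' A'" for V1 A1 R1
  proof (rule runs_iter[where I = ?I])
    show "?I 0 (V1(vi := 0)) A1" using I0 by (simp add: agree_def)
    fix i V' A' assume I: "?I i V' A'" "V' vi = i"
    have [simp]: "V' vk = k" "V' vS = S" "V' vh = h" "V' vL = ?L" using I V S' by (auto simp: agree_def)
    show "safe W S ?e V' A' \<and> eval ?e V' A' = k - 1" using small by simp
    assume i: "i < k - 1"
    have lt: "h * k + i < ?L * k" using cell_bound[of h ?L i k] h i by simp
    then have src: "A' aQ (h * k + i) = ?c ! i" using I qu h i by (simp add: queue_def)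
    have b: "?b ! Suc i = ?c ! i" using nth_move(2)[OF conf] i by simp
    have a1: "S + 8 * (h * k + i) + 8 < W" using addr[of h i] h i by simp
    have a2: "S + 8 * (?L * k + Suc i) + 8 < W" using addr[of ?L "Suc i"] i by simp
    show "runs ?put ?tput V' A' (step_post vi ?I i)"
    proof (rule runs_put)
      let ?A = "A'(aQ := (A' aQ)(?L * k + i + 1 := ?c ! i))"
      have "?I (Suc i) (V'(vi := Suc i)) ?A"
        using I b by (auto simp: agree_def le_Suc_eq)
      then show "V' vi = i \<and> ?I (Suc i) (V'(vi := Suc i)) (A'(aQ := (A' aQ)(eval (Var vL [*] Var vk [+] Var vi [+] Num 1) V' A'
          := eval (Get aQ (Var vh [*] Var vk [+] Var vi)) V' A')))"
        using I src by simp
    qed (use a1 a2 small I(2) h in \<open>auto simp: valid_address_def address_def\<close>)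
  qed (use post small in auto)
  have loop': "runs (iter vi ?e ?put) (iter_time (k - 1) ?tput ?e) V
      (A(aQ := (A aQ)(?L * k := u))) R1"
    if "\<And>V' A'. ?I (k - 1) V' A' \<Longrightarrow> R1 V' A'" for R1
    by (rule loop) (use that nth_move(1)[OF conf] in auto)
  have last: "runs (put aD (Var vL) (Get aD (Var vh) [+] Num 1))
      (ecost (Var vL) + ecost (Get aD (Var vh) [+] Num 1) + 6) V' (A'(aP := (A' aP)(?L := h))) R"
    if I: "?I (k - 1) V' A'" for V' A'
  proof (rule runs_put)
    have [simp]: "V' vk = k" "V' vS = S" "V' vh = h" "V' vL = ?L" using I V S' by (auto simp: agree_def)
    let ?A = "A'(aP := (A' aP)(?L := h))"
    let ?B = "?A(aD := (A' aD)(?L := Suc (A aD h)))"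
    have "queue (Q @ [?b]) ?B" unfolding queue_def
    proof (intro allI impI)
      fix q i assume q: "q < length (Q @ [?b])" and i: "i < k"
      show "?B aQ (q * k + i) = (Q @ [?b]) ! q ! i"
      proof (cases "q < ?L")
        case True
        then have "q * k + i < ?L * k" using cell_bound i by simp
        then show ?thesis using True I qu i by (simp add: queue_def nth_append)
      next
        case False
        then have "q = ?L" using q by simp
        then show ?thesis using I i by (simp add: nth_append)
      qed
    qed
    then have "R V' ?B" using I by (intro cont) auto
    then show "R V' (?A(aD := (?A aD)(eval (Var vL) V' ?A := eval (Get aD (Var vh) [+] Num 1) V' ?A)))"
      using I by simp
    have "A' aD = A aD" using I by simp
    then show "safe W S (Get aD (Var vh) [+] Num 1) V' ?A" "safe W S (Var vL) V' ?A"
      "valid_address W S aD (eval (Var vL) V' ?A) V'"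
      using small h dep index_address[of h] index_address[of ?L]
      by (auto simp: valid_address_def address_def)
  qed
  have put_P: "runs (put aP (Var vL) (Var vh)) (ecost (Var vL) + ecost (Var vh) + 6) V' A'
      (\<lambda>V' A'. runs (put aD (Var vL) (Get aD (Var vh) [+] Num 1))
      (ecost (Var vL) + ecost (Get aD (Var vh) [+] Num 1) + 6) V' A' R)"
    if I: "?I (k - 1) V' A'" for V' A'
  proof -
    have [simp]: "V' vS = S" "V' vh = h" "V' vL = ?L" using I V S' by (auto simp: agree_def)
    show ?thesis
      by (rule runs_put)
        (use last[OF I] small h index_address[of ?L] in \<open>simp_all add: valid_address_def address_def\<close>)
  qed
  have start: "safe W S (Var vL [*] Var vk) V A" "valid_address W S aQ (eval (Var vL [*] Var vk) V A) V"
    "safe W S (Var vu) V A"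
    using V S' h u small addr[of ?L 0] by (auto simp: valid_address_def address_def)
  have "k - 1 \<le> k" by simp
  then have time: "(k - 1) * (?tput + ecost ?e + 10) \<le> k * (?tput + ecost ?e + 10)" by (rule mult_le_mono1)
  show ?thesis unfolding build_prog_def
    apply (rule runs_time)
     apply (rule runs_Seq, rule runs_put, rule runs_Seq)
        apply (simp only: eval.simps apply_op.simps V S')
        apply (rule loop', rule runs_Seq, rule put_P, assumption)
       apply (rule start)+
    using time k by simp
qed

end

section \<open>Scanning the queue\<close>

context snake_machine
begin

lemma digit_lt: "P mod (k * k) div k < k" "P mod (k * k) mod k < k"
  using k by (simp_all add: less_mult_imp_div_less)

lemma runs_scan:
  assumes st: "static V A" and qu: "queue (Q @ [b]) A" and confs: "\<And>c. c \<in> set (Q @ [b]) \<Longrightarrow> conf c"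
    and V: "V vL = length Q" "V vu = u" "V vp = p" and b: "b ! 0 = u" and Q: "length Q \<le> QM"
    and p: "p < codes k"
    and cont: "\<And>V' A'. agree {vf, vi, vj, vP, vm, vq} V V' \<Longrightarrow> (\<And>a. a \<noteq> aX \<Longrightarrow> A' a = A a) \<Longrightarrow>
      V' vf \<le> 1 \<Longrightarrow> V' vm \<le> QM + 1 \<Longrightarrow> (V' vf \<noteq> 0 \<and> V' vm \<le> k \<longleftrightarrow> accepts k Q b p) \<Longrightarrow> R V' A'"
  shows "runs scan_prog (2000 * (k * k * QM)) V A R"
proof -
  let ?cs = "Q @ [b]" let ?N = "Suc (length Q)"
  let ?U = "{vf, vi, vj, vP, vm, vq}"
  define s where "s q = scan k u (take q ?cs) (start p)" for q
  have s0: "s 0 = start p" by (simp add: s_def)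
  have s_Suc: "s (Suc q) = scan_step k u (?cs ! q) (s q)" if "q < ?N" for q
  proof -
    have "take (Suc q) ?cs = take q ?cs @ [?cs ! q]" using that by (intro take_Suc_conv_app_nth) simp
    then show ?thesis unfolding s_def by (simp only: scan_append scan_Cons scan_Nil)
  qed
  \<comment> \<open>The recorded future is compared with the array only below \<open>k\<close>, the
    range read by \<open>admits\<close>. \<open>p' \<le> p\<close>, \<open>m \<le> q\<close> and
    \<open>X j \<le> n\<close> keep all values within words. The last clause remembers the test of
    the entry just treated, which after the final round is the candidate.\<close>
  define P where "P i X p' m q V' \<longleftrightarrow> s q = (X, p', m) \<and> (\<forall>j < k. i j = X j \<and> X j \<le> n) \<and> p' \<le> p \<and> m \<le> q \<and>
     V' vP = p' \<and> V' vm = m \<and> (\<forall>q'. q = Suc q' \<longrightarrow>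
       V' vf = of_bool (?cs ! q' ! 0 = u \<and> admits k (fst (s q')) (?cs ! q')))"
    for i :: "nat \<Rightarrow> nat" and X :: "nat \<Rightarrow> nat" and p' m q :: nat and V' :: vars
  let ?I = "\<lambda>q V' A'. agree ?U V V' \<and> (\<forall>a. a \<noteq> aX \<longrightarrow> A' a = A a) \<and> (\<exists>X p' m. P (A' aX) X p' m q V')"
  note S' = staticD(1-4)[OF st]
  have u: "u < n" using confD(5)[OF confs[of b], of 0] b k by simp
  have entry: "A aQ (q * k + i) = ?cs ! q ! i" "?cs ! q ! i < n" if "q < ?N" "i < k" for q i
    using qu that confD(5)[OF confs that(2)] nth_mem[of q ?cs] by (simp_all add: queue_def del: nth_append)
  have view: "V' vk = k" "V' vS = S" "V' vL = length Q" "V' vu = u" "V' vp = p"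
    if "agree ?U V V'" for V' using that V S' by (auto simp: agree_def)
  let ?put = "put aX (digit_expr [mod] Var vk) (Get aQ (Var vq [*] Var vk [+] digit_expr [div] Var vk) [+] Num 1)"
  let ?asg1 = "asg vP (Var vP [div] (Var vk [*] Var vk))" let ?asg2 = "asg vm (Var vm [+] Num 1)"
  let ?cond = "cond (Var vf) (Seq ?put (Seq ?asg1 ?asg2)) Skip"
  have body: "runs (Seq admits_prog ?cond) (430 * (k * k)) V' A'
      (step_post vq ?I q)"
    if I: "?I q V' A'" and vq: "V' vq = q" and q: "q < ?N" for q V' A'
  proof -
    obtain X p' m where P: "P (A' aX) X p' m q V'" using I by blast
    have ag: "agree ?U V V'" and A': "\<And>a. a \<noteq> aX \<Longrightarrow> A' a = A a" using I by auto
    let ?c = "?cs ! q"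
    have sq: "s q = (X, p', m)" and m: "m \<le> q" and p': "p' \<le> p" using P by (auto simp: P_def)
    let ?ok = "?c ! 0 = u \<and> admits k X ?c"
    have "runs ?cond (2 + (60 + (20 + 20)) + 1 + 1) V1 A'
        (step_post vq ?I q)"
      if a: "agree {vf, vi, vj} V' V1" and f: "V1 vf = of_bool ?ok" for V1
    proof -
      have ag1: "agree ?U V V1" by (rule agree_trans[OF ag a]) auto
      have v1: "V1 vq = q" "V1 vP = p'" "V1 vm = m" using a vq P by (auto simp: agree_def P_def)
      note v = view[OF ag1] v1
      have step: "s (Suc q) = (if ?ok then (X(p' mod (k * k) mod k := Suc (?c ! (p' mod (k * k) div k))),
          p' div (k * k), Suc m) else (X, p', m))"
        using s_Suc[OF q] sq by simp
      have Xn: "A' aX j = X j" "X j \<le> n" if "j < k" for j using P that by (auto simp: P_def)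
      have ff: "V1 vf = of_bool (?cs ! q ! 0 = u \<and> admits k (fst (s q)) (?cs ! q))" using f sq by simp
      show ?thesis
      proof (rule runs_time, rule runs_cond)
        assume "eval (Var vf) V1 A' \<noteq> 0"
        then have ok: ?ok using f by (simp split: if_splits)
        let ?d = "p' mod (k * k)"
        let ?A = "A'(aX := (A' aX)(?d mod k := Suc (?c ! (?d div k))))"
        let ?V2 = "V1(vP := p' div (k * k))" let ?V3 = "?V2(vm := Suc m)"
        have src: "A aQ (q * k + ?d div k) = ?c ! (?d div k)" "?c ! (?d div k) < n"
          using entry[OF q digit_lt(1)] .
        have "P (?A aX) (X(?d mod k := Suc (?c ! (?d div k)))) (p' div (k * k)) (Suc m) (Suc q) (?V3(vq := Suc q))"
          unfolding P_def using step ok src(2) Xn m p' ff v1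
          by (auto intro: order_trans[OF div_le_dividend])
        moreover have "agree ?U V (?V3(vq := Suc q))" using ag1 by (auto simp: agree_def)
        ultimately have fin: "?V3 vq = q \<and> ?I (Suc q) (?V3(vq := Suc q)) ?A"
          using A' v1 by auto
        have asg2: "runs ?asg2 (ecost (Var vm [+] Num 1) + 2) ?V2 ?A
            (step_post vq ?I q)"
        proof (rule runs_asg)
          show "(?V2(vm := eval (Var vm [+] Num 1) ?V2 ?A)) vq = q \<and>
            ?I (Suc q) (?V2(vm := eval (Var vm [+] Num 1) ?V2 ?A, vq := Suc q)) ?A"
            using fin v1 by simp
        qed (use v1 m q Q W in simp_all)
        have asg1: "runs (Seq ?asg1 ?asg2) (ecost (Var vP [div] (Var vk [*] Var vk)) + 2 + (ecost (Var vm [+] Num 1) + 2))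
           V1 ?A (step_post vq ?I q)"
        proof (rule runs_Seq, rule runs_asg)
          show "runs ?asg2 (ecost (Var vm [+] Num 1) + 2)
             (V1(vP := eval (Var vP [div] (Var vk [*] Var vk)) V1 ?A)) ?A
             (step_post vq ?I q)"
            using asg2 v by simp
          have "p' div (k * k) \<le> W" using p' p small by (meson div_le_dividend le_trans less_imp_le)
          then show "safe W S (Var vP [div] (Var vk [*] Var vk)) V1 ?A"
            "eval (Var vP [div] (Var vk [*] Var vk)) V1 ?A \<le> W"
            using v p' p small by simp_all
        qed simp
        show "runs (Seq ?put (Seq ?asg1 ?asg2)) (ecost (digit_expr [mod] Var vk)
           + ecost (Get aQ (Var vq [*] Var vk [+] digit_expr [div] Var vk) [+] Num 1) + 6
           + (ecost (Var vP [div] (Var vk [*] Var vk)) + 2 + (ecost (Var vm [+] Num 1) + 2))) V1 A'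
           (step_post vq ?I q)"
        proof (rule runs_Seq, rule runs_put)
          have A2: "A' aQ (q * k + ?d div k) = ?c ! (?d div k)" using src A' by simp
          show "runs (Seq ?asg1 ?asg2) (ecost (Var vP [div] (Var vk [*] Var vk)) + 2 + (ecost (Var vm [+] Num 1) + 2))
            V1 (A'(aX := (A' aX)(eval (digit_expr [mod] Var vk) V1 A' :=
                eval (Get aQ (Var vq [*] Var vk [+] digit_expr [div] Var vk) [+] Num 1) V1 A')))
            (step_post vq ?I q)"
            using asg1 v A2 by (simp add: digit_expr_def)
          have "?d \<le> k * k" using k by (simp add: order_less_imp_le)
          then have d: "?d \<le> W" using small by linarith
          have d2: "?d div k \<le> W" "?d mod k \<le> W" using digit_lt[of p'] small by linarith+
          have a1: "S + 8 * (q * k + ?d div k) + 8 < W"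
            using entry_address[of q "?d div k"] digit_lt(1)[of p'] q Q by simp
          have a2: "S + 8 * (?d mod k) + 8 < W"
            using index_address[of "?d mod k"] digit_lt(2)[of p'] k_le_QM by simp
          have p'W: "p' \<le> W" "q \<le> W" using p' p q Q small W by linarith+
          show "safe W S (Get aQ (Var vq [*] Var vk [+] digit_expr [div] Var vk) [+] Num 1) V1 A'"
            "safe W S (digit_expr [mod] Var vk) V1 A'"
            "valid_address W S aX (eval (digit_expr [mod] Var vk) V1 A') V1"
            using v A2 src(2) d d2 a1 a2 small p'W by (simp_all add: digit_expr_def valid_address_def address_def)
        qed
      next
        assume "eval (Var vf) V1 A' = 0"
        then have ok: "\<not> ?ok" using f by (simp split: if_splits)
        have "P (A' aX) X p' m (Suc q) (V1(vq := Suc q))"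
          unfolding P_def using step ok Xn m p' ff v1 by auto
        moreover have "agree ?U V (V1(vq := Suc q))" using ag1 by (auto simp: agree_def)
        ultimately show "runs Skip 1 V1 A' (step_post vq ?I q)"
          using A' v1 by (intro runs_Skip) blast
      qed (use f small in \<open>simp_all add: digit_expr_def\<close>)
    qed
    then have "runs admits_prog (300 * (k * k)) V' A' (\<lambda>V' A'. runs ?cond (2 + (60 + (20 + 20)) + 1 + 1) V' A'
        (step_post vq ?I q))"
      using q Q
      by (intro runs_admits[where c = ?c and X = X, OF view(1,2)[OF ag] vq view(4)[OF ag] _ u])
        (use A' entry[OF q] P in \<open>auto simp: P_def\<close>)
    from runs_Seq[OF this] show ?thesis
      by (rule runs_time) (use k_le_kk in linarith)
  qed
  let ?lq = "Var vL [+] Num 1"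
  have scan: "runs (iter vq ?lq (Seq admits_prog ?cond)) (iter_time ?N (430 * (k * k)) ?lq) V' A' R"
    if "agree ?U V V'" "\<And>a. a \<noteq> aX \<Longrightarrow> A' a = A a" "V' vP = p" "V' vm = 0" "\<And>j. j < k \<Longrightarrow> A' aX j = 0" for V' A'
  proof (rule runs_iter[where I = ?I])
    have "P (A' aX) (\<lambda>_. 0) p 0 0 (V'(vq := 0))" using that s0 by (simp add: P_def)
    then show "?I 0 (V'(vq := 0)) A'" using that by (auto simp: agree_def)
    fix q V1 A1 assume I: "?I q V1 A1" "V1 vq = q"
    show "safe W S ?lq V1 A1 \<and> eval ?lq V1 A1 = ?N" using view[of V1] I Q W by simp
    { assume "q < ?N" with I body show "runs (Seq admits_prog ?cond) (430 * (k * k)) V1 A1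
        (step_post vq ?I q)" by blast }
  next
    fix V1 A1 assume I: "?I ?N V1 A1"
    then obtain X p' m where P: "P (A1 aX) X p' m ?N V1" by blast
    have cs: "?cs ! length Q = b" "s (length Q) = scan k u Q (start p)" by (simp_all add: s_def)
    obtain X0 p0 m0 where s: "s (length Q) = (X0, p0, m0)" by (metis surj_pair)
    have vf0: "V1 vf = of_bool (?cs ! length Q ! 0 = u \<and> admits k (fst (s (length Q))) (?cs ! length Q))"
      and vm: "V1 vm = m" "m \<le> ?N" using P unfolding P_def by blast+
    have vf: "V1 vf = of_bool (admits k X0 b)" using vf0 unfolding cs(1) s using b by simp
    have m: "m = (if admits k X0 b then Suc m0 else m0)"
    proof -
      have "s ?N = (X, p', m)" using P unfolding P_def by blast
      then show ?thesis using s_Suc[of "length Q", unfolded cs(1) s] b by (simp split: if_splits)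
    qed
    have acc: "accepts k Q b p \<longleftrightarrow> admits k X0 b \<and> m0 < k"
      unfolding accepts_def b cs(2)[symmetric] s by simp
    show "R V1 A1"
    proof (rule cont)
      show "V1 vf \<noteq> 0 \<and> V1 vm \<le> k \<longleftrightarrow> accepts k Q b p" using vf vm m acc by auto
    qed (use I Q vf vm in auto)
  qed (use Q W in auto)
  let ?J = "\<lambda>j V' A'. agree ?U V V' \<and> (\<forall>a. a \<noteq> aX \<longrightarrow> A' a = A a) \<and> V' vP = p \<and> V' vm = 0 \<and>
    (\<forall>j' < j. A' aX j' = 0)"
  let ?put0 = "put aX (Var vj) (Num 0)"
  have clear: "runs (iter vj (Var vk) ?put0) (iter_time k (ecost (Var vj) + ecost (Num 0) + 6) (Var vk)) V' A
     (\<lambda>V' A'. runs (iter vq ?lq (Seq admits_prog ?cond)) (iter_time ?N (430 * (k * k)) ?lq) V' A' R)"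
    if "agree ?U V V'" "V' vP = p" "V' vm = 0" for V'
  proof (rule runs_iter[where I = ?J])
    show "?J 0 (V'(vj := 0)) A" using that by (auto simp: agree_def)
    fix j V1 A1 assume J: "?J j V1 A1" "V1 vj = j"
    show "safe W S (Var vk) V1 A1 \<and> eval (Var vk) V1 A1 = k" using view[of V1] J small by simp
    assume j: "j < k"
    show "runs ?put0 (ecost (Var vj) + ecost (Num 0) + 6) V1 A1 (step_post vj ?J j)"
      by (rule runs_put) (use J view[of V1] j small index_address[of j] k_le_QM in
        \<open>auto simp: valid_address_def address_def agree_def less_Suc_eq\<close>)
  next
    fix V1 A1 assume "?J k V1 A1"
    then show "runs (iter vq ?lq (Seq admits_prog ?cond)) (iter_time ?N (430 * (k * k)) ?lq) V1 A1 R"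
      by (intro scan) auto
  qed (use small in auto)
  have time: "?N * (430 * (k * k) + ecost ?lq + 10) \<le> 900 * (k * k * QM)" "k \<le> k * k * QM" "1 \<le> k * k * QM"
  proof -
    have "?N \<le> 2 * QM" using Q k_le_QM k by linarith
    moreover have "430 * (k * k) + ecost ?lq + 10 \<le> 450 * (k * k)" unfolding ecost.simps using k_le_kk by linarith
    ultimately have "?N * (430 * (k * k) + ecost ?lq + 10) \<le> (2 * QM) * (450 * (k * k))" by (rule mult_le_mono)
    then show "?N * (430 * (k * k) + ecost ?lq + 10) \<le> 900 * (k * k * QM)" by (simp add: algebra_simps)
    have "k * k * 1 \<le> k * k * QM" using k k_le_QM by (intro mult_le_mono2) simp
    then show "k \<le> k * k * QM" "1 \<le> k * k * QM" using k_le_kk by linarith+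
  qed
  have sum_bound: "ecost (Var vp) + 2 + (ecost (Num 0) + 2 + (k * ((ecost (Var vj) + ecost (Num 0) + 6) + ecost (Var vk) + 10)
      + ecost (Var vk) + 7 + (X + ecost ?lq + 7))) \<le> 2000 * Y"
    if "X \<le> 900 * Y" "k \<le> Y" "1 \<le> Y" for X Y :: nat
    using that by simp
  show ?thesis unfolding scan_prog_def
    apply (rule runs_time)
     apply (rule runs_Seq, rule runs_asg, rule runs_Seq, rule runs_asg, rule runs_Seq, rule clear)
         apply (use V p small in \<open>auto simp: agree_def; fail\<close>)+
    using sum_bound[OF time] by simp
qed

end

section \<open>Breadth-first search\<close>

context snake_machine
begin

lemma time_unit: "1 \<le> codes k * (k * k * QM)" "k \<le> codes k * (k * k * QM)"
  "1 \<le> k * k * QM"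
proof -
  have "k * k * 1 \<le> k * k * QM" using k k_le_QM by (intro mult_le_mono2) simp
  then have Y: "k \<le> k * k * QM" "1 \<le> k * k * QM" using k_le_kk by linarith+
  then show "1 \<le> k * k * QM" by simp
  have "1 * (k * k * QM) \<le> codes k * (k * k * QM)" using codes_pos by (rule mult_le_mono1)
  then show "1 \<le> codes k * (k * k * QM)" "k \<le> codes k * (k * k * QM)" using Y by linarith+
qed

lemma runs_accept:
  assumes st: "static V A" and qu: "queue (Q @ [b]) A" and confs: "\<And>c. c \<in> set (Q @ [b]) \<Longrightarrow> conf c"
    and V: "V vL = length Q" "V vu = u" and b: "b ! 0 = u" and Q: "length Q \<le> QM"
    and cont: "\<And>V' A'. agree {vf, vi, vj, vP, vm, vq, vp, vacc} V V' \<Longrightarrow> (\<And>a. a \<noteq> aX \<Longrightarrow> A' a = A a) \<Longrightarrow>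
      V' vacc = of_bool (needed k Q b) \<Longrightarrow> R V' A'"
  shows "runs accept_prog (2100 * (codes k * (k * k * QM))) V A R"
proof -
  let ?U = "{vf, vi, vj, vP, vm, vq, vp, vacc}"
  let ?I = "\<lambda>p V' A'. agree ?U V V' \<and> (\<forall>a. a \<noteq> aX \<longrightarrow> A' a = A a) \<and>
    V' vacc = of_bool (\<exists>p' < p. accepts k Q b p')"
  let ?t = "Var vf [*] (Var vk [+] Num 1 [-] Var vm)"
  let ?cond = "cond ?t (asg vacc (Num 1)) Skip"
  let ?T = "2000 * (k * k * QM) + (ecost ?t + (ecost (Num 1) + 2) + 1 + 1)"
  note S' = staticD(1-4)[OF st]
  have loop: "runs (iter vp (Var vC) (Seq scan_prog ?cond)) (codes k * (?T + ecost (Var vC) + 10) + ecost (Var vC) + 7) V0 A R"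
    if "agree {vacc} V V0" "V0 vacc = 0" for V0
  proof (rule runs_iter[where I = ?I])
    show "?I 0 (V0(vp := 0)) A" using that by (auto simp: agree_def)
    fix p V' A' assume I: "?I p V' A'" "V' vp = p"
    have v: "V' vC = codes k" "V' vL = length Q" "V' vu = u" using I V S' by (auto simp: agree_def)
    then show "safe W S (Var vC) V' A' \<and> eval (Var vC) V' A' = codes k" using small by simp
    assume p: "p < codes k"
    have st': "static V' A'" using static_cong[OF st, of ?U V' A'] I by simp
    have qu': "queue (Q @ [b]) A'" using qu I by (simp add: queue_def)
    have "runs scan_prog (2000 * (k * k * QM)) V' A' (\<lambda>V' A'. runs ?cond (ecost ?t + (ecost (Num 1) + 2) + 1 + 1) V' A'
        (step_post vp ?I p))"
    proof (rule runs_scan[OF st' qu' confs v(2,3) I(2) b Q p])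
      fix V1 A1 assume a: "agree {vf, vi, vj, vP, vm, vq} V' V1" "\<And>a. a \<noteq> aX \<Longrightarrow> A1 a = A' a"
        and f: "V1 vf \<le> 1" "V1 vm \<le> QM + 1" "V1 vf \<noteq> 0 \<and> V1 vm \<le> k \<longleftrightarrow> accepts k Q b p"
      have ag: "agree ?U V V1" by (rule agree_trans[OF conjunct1[OF I(1)] a(1)]) auto
      have v1: "V1 vk = k" "V1 vp = p" "V1 vacc = of_bool (\<exists>p' < p. accepts k Q b p')"
        using ag a I S' by (auto simp: agree_def)
      have A1: "\<forall>a. a \<noteq> aX \<longrightarrow> A1 a = A a" using a(2) I by simp
      have test: "eval ?t V1 A1 \<noteq> 0 \<longleftrightarrow> accepts k Q b p" using f(3) v1 by auto
      have "V1 vf * (k + 1 - V1 vm) \<le> 1 * (k + 1)" by (rule mult_le_mono) (use f in auto)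
      then have safe: "safe W S ?t V1 A1" using v1 f small W by simp
      show "runs ?cond (ecost ?t + (ecost (Num 1) + 2) + 1 + 1) V1 A1
          (step_post vp ?I p)"
      proof (rule runs_cond)
        assume "eval ?t V1 A1 \<noteq> 0"
        then have "accepts k Q b p" using test by simp
        moreover have "agree ?U V (V1(vacc := 1, vp := Suc p))" using ag by (auto simp: agree_def)
        ultimately show "runs (asg vacc (Num 1)) (ecost (Num 1) + 2) V1 A1
            (step_post vp ?I p)"
          using v1 A1 small by (intro runs_asg) (auto simp: less_Suc_eq)
      next
        assume "eval ?t V1 A1 = 0"
        then have "\<not> accepts k Q b p" using test by simp
        moreover have "agree ?U V (V1(vp := Suc p))" using ag by (auto simp: agree_def)
        ultimately show "runs Skip 1 V1 A1
            (step_post vp ?I p)"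
          using v1 A1 by (intro runs_Skip) (auto simp: less_Suc_eq)
      qed (rule safe)
    qed
    then show "runs (Seq scan_prog ?cond) ?T V' A' (step_post vp ?I p)"
      by (rule runs_Seq)
  next
    fix V' A' assume "?I (codes k) V' A'"
    then show "R V' A'" by (intro cont) (auto simp: needed_def)
  qed (use small in auto)
  have "?T + ecost (Var vC) + 10 \<le> 2050 * (k * k * QM)" unfolding ecost.simps using time_unit(3) by linarith
  then have "codes k * (?T + ecost (Var vC) + 10) \<le> codes k * (2050 * (k * k * QM))" by (rule mult_le_mono2)
  also have "\<dots> = 2050 * (codes k * (k * k * QM))" by (rule mult.left_commute)
  finally have time: "codes k * (?T + ecost (Var vC) + 10) \<le> 2050 * (codes k * (k * k * QM))" .
  have sum_bound: "ecost (Num 0) + 2 + (X + ecost (Var vC) + 7) \<le> 2100 * Y" if "X \<le> 2050 * Y" "1 \<le> Y" for X Y :: nat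
    using that by simp
  show ?thesis unfolding accept_prog_def
    apply (rule runs_time)
     apply (rule runs_Seq, rule runs_asg, rule loop)
         apply (simp add: agree_def)+
    using sum_bound[OF time time_unit(1)] by simp
qed

definition bfs_state :: "nat list list \<Rightarrow> nat \<Rightarrow> nat \<Rightarrow> vars \<Rightarrow> arrays \<Rightarrow> bool" where
  "bfs_state Q h u V A \<longleftrightarrow> static V A \<and> queue Q A \<and> V vL = length Q \<and> V vh = h \<and>
     bfs_inv Q (A aP) (A aD) h u"

lemma bfs_length: "bfs_inv Q par dep h u \<Longrightarrow> length Q \<le> QM"
  using bfs_inv_length by (simp add: QM)

lemma runs_extend:
  assumes st: "bfs_state Q h u V A" and vu: "V vu = u" and u: "u < n" and h: "h < length Q"
  shows "runs extend_prog (3000 * (codes k * (k * k * QM))) V A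
    (\<lambda>V' A'. V' vu = u \<and> (\<exists>Q'. bfs_state Q' h (Suc u) V' A' \<and> h < length Q'))"
proof -
  let ?R = "\<lambda>V' A'. V' vu = u \<and> (\<exists>Q'. bfs_state Q' h (Suc u) V' A' \<and> h < length Q')"
  let ?b = "move u (Q ! h)" let ?Q = "Q @ [?b]"
  have S: "static V A" "queue Q A" "V vL = length Q" "V vh = h" and inv: "bfs_inv Q (A aP) (A aD) h u"
    using st by (auto simp: bfs_state_def)
  note len = bfs_length[OF inv]
  have conf: "conf (Q ! h)" using bfs_inv_conf[OF inv h] .
  let ?extend = "cond (Var vacc) (asg vL (Var vL [+] Num 1)) Skip"
  let ?text = "ecost (Var vacc) + (ecost (Var vL [+] Num 1) + 2) + 1 + 1"
  have main: "runs (Seq build_prog (Seq accept_prog ?extend))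
      (200 * k + (2100 * (codes k * (k * k * QM)) + ?text)) V1 A ?R"
    if legal: "legal u (Q ! h)" and a1: "agree {vf, vi} V V1" for V1
  proof -
    have v1: "V1 vh = h" "V1 vu = u" "V1 vL = length Q" using a1 S vu by (auto simp: agree_def)
    have st1: "static V1 A" by (rule static_cong[OF S(1) a1]) simp_all
    have dep: "A aD h < QM" using bfs_inv_dep[OF inv h] h len by simp
    show ?thesis
    proof (rule runs_Seq, rule runs_build[OF st1 S(2) v1 h len conf u dep])
      fix V2 A2 assume a2: "agree {vi} V1 V2" and A2: "\<And>a. a \<notin> {aQ, aP, aD} \<Longrightarrow> A2 a = A a"
        and qu2: "queue ?Q A2" and P2: "A2 aP = (A aP)(length Q := h)"
        and D2: "A2 aD = (A aD)(length Q := Suc (A aD h))"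
      have st2: "static V2 A2" by (rule static_cong[OF st1 a2]) (simp_all add: A2)
      have v2: "V2 vL = length Q" "V2 vu = u" using a2 v1 by (auto simp: agree_def)
      have b: "?b ! 0 = u" using nth_move(1)[OF conf] .
      have confs: "conf c" if "c \<in> set ?Q" for c
        using that conf_move[OF conf legal] bfs_inv_conf[OF inv] by (auto simp: in_set_conv_nth[of c Q])
      show "runs (Seq accept_prog ?extend) (2100 * (codes k * (k * k * QM)) + ?text) V2 A2 ?R"
      proof (rule runs_Seq, rule runs_accept[OF st2 qu2 confs v2 b len])
        fix V3 A3 assume a3: "agree {vf, vi, vj, vP, vm, vq, vp, vacc} V2 V3"
          and A3: "\<And>a. a \<noteq> aX \<Longrightarrow> A3 a = A2 a" and acc: "V3 vacc = of_bool (needed k Q ?b)"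
        have st3: "static V3 A3" by (rule static_cong[OF st2 a3]) (simp_all add: A3)
        have v3: "V3 vL = length Q" "V3 vu = u" "V3 vh = h" using a2 a3 v1 v2 by (auto simp: agree_def)
        have qu3: "queue ?Q A3" using qu2 A3 by (simp add: queue_def)
        show "runs ?extend ?text V3 A3 ?R"
        proof (rule runs_cond)
          assume "eval (Var vacc) V3 A3 \<noteq> 0"
          then have nd: "needed k Q ?b" using acc by (simp split: if_splits)
          have "bfs_inv ?Q (A3 aP) (A3 aD) h (Suc u)"
            by (rule bfs_inv_add[OF inv h legal nd]) (use A3 P2 D2 in auto)
          moreover have "static (V3(vL := length ?Q)) A3"
            by (rule static_cong[OF st3, of "{vL}"]) (auto simp: agree_def)
          ultimately have "bfs_state ?Q h (Suc u) (V3(vL := length ?Q)) A3"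
            using qu3 v3 by (simp add: bfs_state_def)
          moreover have "h < length ?Q" using h by simp
          ultimately have "?R (V3(vL := length ?Q)) A3" using v3(2) by auto
          then show "runs (asg vL (Var vL [+] Num 1)) (ecost (Var vL [+] Num 1) + 2) V3 A3 ?R"
            using v3 len small by (intro runs_asg) auto
        next
          assume "eval (Var vacc) V3 A3 = 0"
          then have nd: "\<not> needed k Q ?b" using acc by (simp split: if_splits)
          have "bfs_inv Q (A aP) (A aD) h (Suc u)" by (rule bfs_inv_skip[OF inv h]) (use nd in simp)
          then have "bfs_inv Q (A3 aP) (A3 aD) h (Suc u)"
            by (rule bfs_inv_cong) (use A3 P2 D2 in auto)
          moreover have "queue Q A3" using qu3 unfolding queue_def by (auto simp: nth_append)
          ultimately have "bfs_state Q h (Suc u) V3 A3" using st3 v3 by (simp add: bfs_state_def)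
          then show "runs Skip 1 V3 A3 ?R" using v3 h by (intro runs_Skip) auto
        qed (use acc small in simp)
      qed
    qed
  qed
  have sum_bound: "200 * k + (ecost (Var vf) + (200 * k + (2100 * X + ?text)) + 1 + 1) \<le> 3000 * X"
    if "1 \<le> X" "k \<le> X" for X using that by simp
  show ?thesis unfolding extend_prog_def
  proof (rule runs_time, rule runs_Seq, rule runs_legal[OF S(1,2,4) vu h len conf u])
    fix V1 assume a1: "agree {vf, vi} V V1" and f: "V1 vf = of_bool (legal u (Q ! h))"
    show "runs (cond (Var vf) (Seq build_prog (Seq accept_prog ?extend)) Skip)
        (ecost (Var vf) + (200 * k + (2100 * (codes k * (k * k * QM)) + ?text)) + 1 + 1) V1 A ?R"
    proof (rule runs_cond)
      assume "eval (Var vf) V1 A \<noteq> 0"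
      then have "legal u (Q ! h)" using f by (simp split: if_splits)
      then show "runs (Seq build_prog (Seq accept_prog ?extend))
        (200 * k + (2100 * (codes k * (k * k * QM)) + ?text)) V1 A ?R" using main a1 by blast
    next
      assume "eval (Var vf) V1 A = 0"
      then have "\<not> legal u (Q ! h)" using f by (simp split: if_splits)
      then have "bfs_inv Q (A aP) (A aD) h (Suc u)" using bfs_inv_skip[OF inv h] by blast
      moreover have "static V1 A" by (rule static_cong[OF S(1) a1]) simp_all
      ultimately have "bfs_state Q h (Suc u) V1 A" using S a1 by (auto simp: bfs_state_def agree_def)
      then show "runs Skip 1 V1 A ?R" using a1 vu h by (intro runs_Skip) (auto simp: agree_def)
    qed (use f small in simp)
  next
    show "200 * k + (ecost (Var vf) + (200 * k + (2100 * (codes k * (k * k * QM)) + ?text)) + 1 + 1)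
        \<le> 3000 * (codes k * (k * k * QM))"
      using sum_bound[OF time_unit(1,2)] .
  qed
qed

text \<open>The queue grows while it is traversed, so the invariant quantifies over it. The number
  of rounds is at most \<open>QM\<close> because every queue that satisfies the invariant is that
  short.\<close>

lemma runs_bfs:
  assumes st: "static V A" and qu: "queue [init] A" and dep: "A aD 0 = 0"
    and cont: "\<And>V' A' Q. bfs_state Q (length Q) 0 V' A' \<Longrightarrow> R V' A'"
  shows "runs bfs_prog (4000 * (QM * (n * (codes k * (k * k * QM))))) V A R"
proof -
  let ?Y = "codes k * (k * k * QM)"
  let ?e = "Var vL [-] Var vh" let ?h = "Var vh [+] Num 1"
  let ?J = "\<lambda>h u V A. \<exists>Q. bfs_state Q h u V A \<and> h < length Q"
  let ?I = "\<lambda>h V A. \<exists>Q. bfs_state Q h 0 V A"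
  let ?Tu = "n * (3000 * ?Y + ecost (Var vn) + 10) + ecost (Var vn) + 7"
  have row: "runs (iter vu (Var vn) extend_prog) ?Tu V A
      (\<lambda>V A. runs (asg vh ?h) (ecost ?h + 2) V A (?I (Suc h)))"
    if "bfs_state Q h 0 V A" "h < length Q" for Q h V A
  proof (rule runs_iter[where I = "?J h"])
    have "static (V(vu := 0)) A"
      by (rule static_cong[of V A "{vu}"]) (use that in \<open>auto simp: bfs_state_def agree_def\<close>)
    then show "?J h 0 (V(vu := 0)) A" using that by (auto simp: bfs_state_def)
    fix u V1 A1 assume J: "?J h u V1 A1" "V1 vu = u"
    then show "safe W S (Var vn) V1 A1 \<and> eval (Var vn) V1 A1 = n"
      using small by (auto simp: bfs_state_def staticD)
    assume u: "u < n"
    from J(1) obtain Q1 where "bfs_state Q1 h u V1 A1" "h < length Q1" by blast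
    from runs_extend[OF this(1) J(2) u this(2)]
    show "runs extend_prog (3000 * ?Y) V1 A1 (\<lambda>V A. V vu = u \<and> ?J h (Suc u) (V(vu := Suc u)) A)"
    proof (rule runs_mono)
      fix V2 A2 assume R: "V2 vu = u \<and> (\<exists>Q'. bfs_state Q' h (Suc u) V2 A2 \<and> h < length Q')"
      then obtain Q' where Q': "bfs_state Q' h (Suc u) V2 A2" "h < length Q'" by blast
      have "static (V2(vu := Suc u)) A2"
        by (rule static_cong[of V2 A2 "{vu}"]) (use Q' in \<open>auto simp: bfs_state_def agree_def\<close>)
      then have "bfs_state Q' h (Suc u) (V2(vu := Suc u)) A2" using Q' by (simp add: bfs_state_def)
      then show "V2 vu = u \<and> ?J h (Suc u) (V2(vu := Suc u)) A2" using R Q' by blast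
    qed simp
  next
    fix V1 A1 assume "?J h n V1 A1"
    then obtain Q1 where Q1: "bfs_state Q1 h n V1 A1" "h < length Q1" by blast
    then have inv: "bfs_inv Q1 (A1 aP) (A1 aD) h n" and v: "V1 vh = h" by (auto simp: bfs_state_def)
    have "static (V1(vh := Suc h)) A1"
      by (rule static_cong[of V1 A1 "{vh}"]) (use Q1 in \<open>auto simp: bfs_state_def agree_def\<close>)
    then have "bfs_state Q1 (Suc h) 0 (V1(vh := Suc h)) A1"
      using Q1 bfs_inv_next_head[OF inv Q1(2)] by (simp add: bfs_state_def)
    then show "runs (asg vh ?h) (ecost ?h + 2) V1 A1 (?I (Suc h))"
      using v Q1(2) bfs_length[OF inv] small by (intro runs_asg) auto
  qed (use small in auto)
  have loop: "runs (loop ?e (Seq (iter vu (Var vn) extend_prog) (asg vh ?h)))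
      (QM * ((?Tu + (ecost ?h + 2)) + ecost ?e + 1) + ecost ?e + 1) V A R" if I0: "?I 0 V A" for V A
  proof (rule runs_loop[where I = ?I])
    fix h V1 A1 assume "?I h V1 A1"
    then obtain Q1 where Q1: "bfs_state Q1 h 0 V1 A1" by blast
    then have inv: "bfs_inv Q1 (A1 aP) (A1 aD) h 0" and v: "V1 vh = h" "V1 vL = length Q1"
      by (auto simp: bfs_state_def)
    have len: "length Q1 \<le> QM" "h \<le> length Q1" using bfs_length[OF inv] bfs_invD(4)[OF inv] by auto
    show "safe W S ?e V1 A1" using v len small by simp
    { assume "eval ?e V1 A1 \<noteq> 0"
      then have h: "h < length Q1" using v by simp
      then show "h < QM \<and> runs (Seq (iter vu (Var vn) extend_prog) (asg vh ?h)) (?Tu + (ecost ?h + 2)) V1 A1 (?I (Suc h))"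
        using runs_Seq[OF row[OF Q1 h]] len by simp }
    { assume "eval ?e V1 A1 = 0"
      then have "h = length Q1" using v len by simp
      then show "R V1 A1" using Q1 cont by simp }
  qed (rule I0)
  have inv0: "bfs_inv [init] (A aP) (A aD) 0 0" using bfs_inv_init[OF needed_Nil] dep by blast
  have "static (V(vL := 1, vh := 0)) A"
    by (rule static_cong[OF st, of "{vL, vh}"]) (auto simp: agree_def)
  then have I0: "?I 0 (V(vL := 1, vh := 0)) A" using qu inv0 by (auto simp: bfs_state_def)
  have "?Tu + (ecost ?h + 2) + ecost ?e + 1 \<le> 3500 * (n * ?Y)"
  proof -
    have Y: "n \<le> n * ?Y" using mult_le_mono2[OF time_unit(1), of n] by simp
    have eq: "n * (3000 * ?Y + ecost (Var vn) + 10) = 3000 * (n * ?Y) + 12 * n" by (simp add: algebra_simps)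
    have "3000 * Z + 12 * n + ecost (Var vn) + 7 + (ecost ?h + 2) + ecost ?e + 1 \<le> 3500 * Z" if "n \<le> Z" for Z
      using that n_pos by simp
    from this[OF Y] show ?thesis unfolding eq .
  qed
  then have "QM * (?Tu + (ecost ?h + 2) + ecost ?e + 1) \<le> QM * (3500 * (n * ?Y))" by (rule mult_le_mono2)
  also have "\<dots> = 3500 * (QM * (n * ?Y))" by (rule mult.left_commute)
  finally have time: "QM * (?Tu + (ecost ?h + 2) + ecost ?e + 1) \<le> 3500 * (QM * (n * ?Y))" .
  have unit: "1 \<le> QM * (n * ?Y)" using time_unit(1) n_pos k_le_QM k by simp
  have sum_bound: "ecost (Num 1) + 2 + (ecost (Num 0) + 2 + (X + ecost ?e + 1)) \<le> 4000 * Z"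
    if "X \<le> 3500 * Z" "1 \<le> Z" for X Z :: nat using that by simp
  show ?thesis unfolding bfs_prog_def
    apply (rule runs_time)
     apply (rule runs_Seq, rule runs_asg, rule runs_Seq, rule runs_asg, rule loop)
           apply (use I0 small in \<open>simp; fail\<close>)+
    using sum_bound[OF time unit] by simp
qed

end

section \<open>Reaching the final configuration\<close>

text \<open>From here on \<open>vP\<close> holds the number of remaining moves; \<open>vb\<close>, \<open>vbq\<close>, \<open>vbL\<close> record the first solution.\<close>

abbreviation (input) vz :: nat where "vz \<equiv> 15"
abbreviation (input) vb :: nat where "vb \<equiv> 16"
abbreviation (input) vbq :: nat where "vbq \<equiv> 17"
abbreviation (input) vbL :: nat where "vbL \<equiv> 18"
abbreviation (input) vD :: nat where "vD \<equiv> 23"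
abbreviation (input) vt :: nat where "vt \<equiv> 24"
abbreviation (input) vs' :: nat where "vs' \<equiv> 25"
abbreviation (input) vcur :: nat where "vcur \<equiv> 26"

definition edge_expr :: expr where
  "edge_expr = Get 0 (Num 2 [+] Get aF (Var vP [-] Num 1) [*] Var vn [+] Get aQ (Var vq [*] Var vk)) [+]
     (Num 2 [div] (Var vk [+] Num 1))"

text \<open>The second summand is 1 exactly when \<open>vj \<ge> vP\<close>; then there is no move
  \<open>vj\<close> and the pair imposes no condition.\<close>

definition clash_expr :: expr where
  "clash_expr = (Get aF (Var vP [-] Num 1 [-] Var vj) [\<noteq>] Get aQ (Var vq [*] Var vk [+] Var vi)) [+]
     (Num 1 [-] (Var vP [-] Var vj))"

definition same_expr :: expr where
  "same_expr = Num 1 [-] (Get aF (Var vP [+] Var vi) [\<noteq>] Get aQ (Var vq [*] Var vk [+] Var vi))"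

definition ok_prog :: prog where
  "ok_prog = Seq (asg vf (Num 1)) (Seq (cond edge_expr Skip (asg vf (Num 0)))
     (Seq (iter vi (Var vk) (all_loop vj (Var vk [-] (Var vi [+] Num 1)) clash_expr))
       (all_loop vi (Var vk [-] Var vP) same_expr)))"

text \<open>The factor \<open>1 - vb\<close> freezes the first hit; candidates come in order of
  nondecreasing cost, so it is a cheapest one.\<close>

definition find_prog :: prog where
  "find_prog = Seq (asg vb (Num 0)) (iter vz (Var vL [+] (Var vk [-] Num 1))
     (Seq (asg vq (Var vz [-] (Var vk [-] Num 1)))
     (Seq (asg vP (Var vk [-] (Var vk [-] Num 1 [-] Var vz)))
     (Seq ok_prog (cond (Var vf [*] (Num 1 [-] Var vb))
       (Seq (asg vb (Num 1)) (Seq (asg vbq (Var vq)) (asg vbL (Var vP)))) Skip)))))"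

context snake_machine
begin

lemma distance_bound:
  fixes x y z m :: nat
  assumes "x < m" "y < m" "m < w"
  shows "x - y + (y - x) + (1 - z) \<le> w"
  using assms by linarith

lemma fin_address: "i < k \<Longrightarrow> S + 8 * i + 8 < W"
  using index_address[of i] k_le_QM by simp

lemma runs_ok:
  assumes st: "static V A" and qu: "queue Q A" and V: "V vq = q" "V vP = L"
    and q: "q < length Q" "length Q \<le> QM" and conf: "conf (Q ! q)" and L: "1 \<le> L" "L \<le> k"
    and cont: "\<And>V'. agree {vf, vi, vj} V V' \<Longrightarrow> V' vf = of_bool (ok (Q ! q) L) \<Longrightarrow> R V' A"
  shows "runs ok_prog (600 * (k * k)) V A R"
proof -
  let ?c = "Q ! q"
  note S' = staticD(1-4)[OF st]
  have view: "V' vk = k" "V' vS = S" "V' vq = q" "V' vP = L" "V' vn = n"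
    if "agree {vf, vi, vj} V V'" for V' using that V S' by (auto simp: agree_def)
  have c: "A aQ (q * k + i) = ?c ! i" "?c ! i < n" if "i < k" for i
    using qu q that confD(5)[OF conf that] by (auto simp: queue_def)
  have c0: "A aQ (q * k) = ?c ! 0" "?c ! 0 < n" using c[of 0] k by auto
  have F: "A aF i = fin ! i" "fin ! i < n" if "i < k" for i
    using staticD(7)[OF st that] confD(5)[OF conf_fin that] .
  have addr: "S + 8 * (q * k + i) + 8 < W" if "i < k" for i
    using entry_address[of q i] q that by simp
  have addr0: "S + 8 * (q * k) + 8 < W" using addr[of 0] k by simp
  let ?u = "fin ! (L - 1)"
  have L1: "L - 1 < k" using L by simp
  note FL = F[OF L1] and aL = fin_address[OF L1]
  have cell: "2 + ?u * n + ?c ! 0 < S" using cell_address[OF FL(2) c0(2)] .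
  have edge: "A 0 (2 + ?u * n + ?c ! 0) \<le> 1" "A 0 (2 + ?u * n + ?c ! 0) + 2 div Suc k \<noteq> 0 \<longleftrightarrow> E ?u (?c ! 0)"
    using staticD(5,6)[OF st FL(2) c0(2)] .
  have "2 div Suc k \<le> 2" by (rule div_le_dividend)
  then have quot: "2 div Suc k \<le> W" and sum: "A 0 (2 + ?u * n + ?c ! 0) + 2 div Suc k \<le> W"
    using edge(1) small by linarith+
  have edge': "safe W S edge_expr V' A" "eval edge_expr V' A \<noteq> 0 \<longleftrightarrow> E ?u (?c ! 0)" if "agree {vf} V V'" for V'
  proof -
    have [simp]: "V' vk = k" "V' vS = S" "V' vq = q" "V' vP = L" "V' vn = n"
      using that V S' by (auto simp: agree_def)
    show "eval edge_expr V' A \<noteq> 0 \<longleftrightarrow> E ?u (?c ! 0)" using edge c0 FL by (simp add: edge_expr_def)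
    show "safe W S edge_expr V' A"
      using FL aL c0 cell addr0 q L small quot sum
      by (simp add: edge_expr_def valid_address_def address_def)
  qed
  let ?e3 = "Var vk [-] Var vP"
  let ?P3 = "\<forall>i < k - L. fin ! (L + i) = ?c ! i"
  have suffix: "runs (all_loop vi ?e3 same_expr) (k * (ecost same_expr + ecost ?e3 + 20) + ecost ?e3 + 7) V1 A R"
    if a1: "agree {vf, vi, vj} V V1" and f: "V1 vf = of_bool B" and B: "B \<and> ?P3 \<longleftrightarrow> ok ?c L" for V1 B
  proof (rule runs_time, rule runs_all[where m = "k - L" and P = "\<lambda>i. fin ! (L + i) = ?c ! i"])
    fix V2 assume a2: "agree {vi, vf} V1 V2"
    have ag: "agree {vf, vi, vj} V V2" by (rule agree_trans[OF a1 a2]) auto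
    note v = view[OF ag]
    show "safe W S ?e3 V2 A \<and> eval ?e3 V2 A = k - L" using v small L by simp
    { fix i assume i: "V2 vi = i" "i < k - L"
      then have "i < k" "L + i < k" by auto
      from c[OF this(1)] addr[OF this(1)] F[OF this(2)] fin_address[OF this(2)]
      show "safe W S same_expr V2 A \<and> (eval same_expr V2 A \<noteq> 0 \<longleftrightarrow> fin ! (L + i) = ?c ! i)"
        using v i small q L by (simp add: same_expr_def valid_address_def address_def) auto }
    { assume "V2 vf = of_bool (B \<and> ?P3)"
      then show "R V2 A" using cont[OF ag] B by simp }
  qed (use f small in \<open>auto intro!: mult_le_mono1\<close>)
  let ?P2 = "\<lambda>i. \<forall>j < k - Suc i. \<not> (j < L \<and> fin ! (L - 1 - j) = ?c ! i)"
  let ?E = "E ?u (?c ! 0)"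
  have ok: "(?E \<and> (\<forall>i < k. ?P2 i)) \<and> ?P3 \<longleftrightarrow> ok ?c L"
  proof -
    have "(\<forall>i < k. ?P2 i) \<longleftrightarrow> (\<forall>i j. i + j + 1 < k \<and> j < L \<longrightarrow> fin ! (L - 1 - j) \<noteq> ?c ! i)"
      by (auto simp: less_diff_conv add.commute)
    moreover have "?P3 \<longleftrightarrow> (\<forall>i. L + i < k \<longrightarrow> fin ! (L + i) = ?c ! i)"
      by (auto simp: less_diff_conv add.commute)
    ultimately show ?thesis by (simp add: ok_def)
  qed
  let ?I = "\<lambda>i V' A'. A' = A \<and> agree {vf, vi, vj} V V' \<and> V' vf = of_bool (?E \<and> (\<forall>i' < i. ?P2 i'))"
  let ?e = "Var vk [-] (Var vi [+] Num 1)"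
  have inner: "runs (all_loop vj ?e clash_expr) (k * (ecost clash_expr + ecost ?e + 20) + ecost ?e + 7) V' A
      (step_post vi ?I i)"
    if I: "agree {vf, vi, vj} V V'" "V' vf = of_bool (?E \<and> (\<forall>i' < i. ?P2 i'))" "V' vi = i" "i < k" for V' i
  proof (rule runs_time, rule runs_all[where m = "k - Suc i" and P = "\<lambda>j. \<not> (j < L \<and> fin ! (L - 1 - j) = ?c ! i)"])
    fix V1 assume a: "agree {vj, vf} V' V1"
    have ag: "agree {vf, vi, vj} V V1" by (rule agree_trans[OF I(1) a]) auto
    have "V1 vi = i" using a I by (auto simp: agree_def)
    note v = view[OF ag] this
    { show "safe W S ?e V1 A \<and> eval ?e V1 A = k - Suc i" using v small I(4) by simp }
    { fix j assume j: "V1 vj = j" "j < k - Suc i"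
      have "L - 1 - j < k" using L1 by simp
      moreover have "L \<le> W" "L - 1 \<le> W" "L - j \<le> W" "j \<le> W" "1 - (L - j) \<le> W" "L - 1 - j \<le> W"
        using j(2) L(2) small by linarith+
      moreover note F[OF \<open>L - 1 - j < k\<close>] fin_address[OF \<open>L - 1 - j < k\<close>] c[OF I(4)] addr[OF I(4)]
      ultimately show "safe W S clash_expr V1 A \<and> (eval clash_expr V1 A \<noteq> 0 \<longleftrightarrow> \<not> (j < L \<and> fin ! (L - 1 - j) = ?c ! i))"
        using small q j v L I(4) distance_bound[OF F(2)[OF \<open>L - 1 - j < k\<close>] c(2)[OF I(4)] small(1), of "L - j"]
        by (simp add: clash_expr_def valid_address_def address_def) auto }
    { assume "V1 vf = of_bool ((?E \<and> (\<forall>i' < i. ?P2 i')) \<and> ?P2 i)"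
      then show "V1 vi = i \<and> ?I (Suc i) (V1(vi := Suc i)) A"
        using v ag by (auto simp: agree_def less_Suc_eq) }
  qed (use I small in \<open>auto intro!: mult_le_mono1\<close>)
  have outer: "runs (iter vi (Var vk) (all_loop vj ?e clash_expr))
      (iter_time k (k * (ecost clash_expr + ecost ?e + 20) + ecost ?e + 7) (Var vk)) V' A
      (\<lambda>V1 A1. runs (all_loop vi ?e3 same_expr) (k * (ecost same_expr + ecost ?e3 + 20) + ecost ?e3 + 7) V1 A1 R)"
    if "agree {vf} V V'" "V' vf = of_bool ?E" for V'
  proof (rule runs_iter[where I = ?I])
    fix i V' A' assume I: "?I i V' A'" "V' vi = i"
    then show "safe W S (Var vk) V' A' \<and> eval (Var vk) V' A' = k" using small view[of V'] by simp
    assume "i < k"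
    then show "runs (all_loop vj ?e clash_expr) (k * (ecost clash_expr + ecost ?e + 20) + ecost ?e + 7) V' A'
        (step_post vi ?I i)" using I inner by blast
  next
    fix V' A' assume "?I k V' A'"
    then show "runs (all_loop vi ?e3 same_expr) (k * (ecost same_expr + ecost ?e3 + 20) + ecost ?e3 + 7) V' A' R"
      using suffix[OF _ _ ok, of V'] by simp
  qed (use that small in \<open>auto simp: agree_def\<close>)
  have cond: "runs (cond edge_expr Skip (asg vf (Num 0))) (ecost edge_expr + 1 + (ecost (Num 0) + 2) + 1) V' A
      (\<lambda>V1 A1. A1 = A \<and> agree {vf} V V1 \<and> V1 vf = of_bool ?E)"
    if "agree {vf} V V'" "V' vf = 1" for V'
  proof (rule runs_cond)
    assume "eval edge_expr V' A \<noteq> 0"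
    then show "runs Skip 1 V' A (\<lambda>V1 A1. A1 = A \<and> agree {vf} V V1 \<and> V1 vf = of_bool ?E)"
      using edge'(2)[OF that(1)] that by (intro runs_Skip) simp
  next
    assume "eval edge_expr V' A = 0"
    then show "runs (asg vf (Num 0)) (ecost (Num 0) + 2) V' A (\<lambda>V1 A1. A1 = A \<and> agree {vf} V V1 \<and> V1 vf = of_bool ?E)"
      using edge'(2)[OF that(1)] that by (intro runs_asg) (auto intro: agree_upd)
  qed (rule edge'(1)[OF that(1)])
  show ?thesis unfolding ok_prog_def
    apply (rule runs_time)
     apply (rule runs_Seq, rule runs_asg, rule runs_Seq, rule runs_mono, rule cond)
         apply (simp add: agree_def)
        apply simp
       apply (rule order_refl)
      apply (rule runs_Seq)
      apply (elim conjE, simp only:)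
      apply (rule outer; simp)
     using small apply (simp_all add: edge_expr_def clash_expr_def same_expr_def algebra_simps)
    apply (use k_le_kk in linarith)
    done
qed

lemma runs_find:
  assumes st: "bfs_state Q (length Q) 0 V A"
    and cont: "\<And>V'. agree {vf, vi, vj, vz, vq, vP, vb, vbq, vbL} V V' \<Longrightarrow>
      V' vb = 0 \<and> (\<forall>z < length Q + (k - 1). \<not> cand Q z) \<or>
      V' vb = 1 \<and> (\<exists>z < length Q + (k - 1). cand Q z \<and> (\<forall>z' < z. \<not> cand Q z') \<and>
        V' vbq = z - (k - 1) \<and> V' vbL = k - (k - 1 - z)) \<Longrightarrow> R V' A"
  shows "runs find_prog (3000 * (k * k * QM)) V A R"
proof -
  let ?U = "{vf, vi, vj, vz, vq, vP, vb, vbq, vbL}"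
  have S: "static V A" "queue Q A" "V vL = length Q" and inv: "bfs_inv Q (A aP) (A aD) (length Q) 0"
    using st by (auto simp: bfs_state_def)
  note S' = staticD(1-4)[OF S(1)]
  note len = bfs_length[OF inv]
  have Q: "0 < length Q" using bfs_invD(1)[OF inv] by simp
  let ?Z = "length Q + (k - 1)"
  define B where "B z V' \<longleftrightarrow> V' vb = 0 \<and> (\<forall>z' < z. \<not> cand Q z') \<or>
      V' vb = 1 \<and> (\<exists>z' < z. cand Q z' \<and> (\<forall>z'' < z'. \<not> cand Q z'') \<and>
        V' vbq = z' - (k - 1) \<and> V' vbL = k - (k - 1 - z'))" for z :: nat and V' :: vars
  let ?I = "\<lambda>z V' A'. A' = A \<and> agree ?U V V' \<and> B z V'"
  let ?e = "Var vL [+] (Var vk [-] Num 1)"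
  let ?eq = "Var vz [-] (Var vk [-] Num 1)" let ?eL = "Var vk [-] (Var vk [-] Num 1 [-] Var vz)"
  let ?t = "Var vf [*] (Num 1 [-] Var vb)"
  let ?set = "Seq (asg vb (Num 1)) (Seq (asg vbq (Var vq)) (asg vbL (Var vP)))"
  let ?tset = "ecost (Num 1) + 2 + (ecost (Var vq) + 2 + (ecost (Var vP) + 2))"
  let ?body = "Seq (asg vq ?eq) (Seq (asg vP ?eL) (Seq ok_prog (cond ?t ?set Skip)))"
  let ?tbody = "ecost ?eq + 2 + (ecost ?eL + 2 + (600 * (k * k) + (ecost ?t + ?tset + 1 + 1)))"
  have "?Z < W" using len W by simp
  have body: "runs ?body ?tbody V1 A (step_post vz ?I z)"
    if I: "agree ?U V V1" "B z V1" "V1 vz = z" and z: "z < ?Z" for z V1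
  proof -
    let ?q = "z - (k - 1)" let ?L = "k - (k - 1 - z)"
    let ?V2 = "V1(vq := ?q, vP := ?L)"
    have v1: "V1 vk = k" "V1 vL = length Q" using I S S' by (auto simp: agree_def)
    have q: "?q < length Q" using z Q by linarith
    have L: "1 \<le> ?L" "?L \<le> k" using k by linarith+
    have ag2: "agree ?U V ?V2" using I(1) by (auto simp: agree_def)
    have st2: "static ?V2 A" by (rule static_cong[OF S(1) ag2]) simp_all
    have ok: "runs ok_prog (600 * (k * k)) ?V2 A (\<lambda>V' A'. runs (cond ?t ?set Skip) (ecost ?t + ?tset + 1 + 1) V' A'
        (step_post vz ?I z))"
    proof (rule runs_ok[OF st2 S(2) _ _ q len bfs_inv_conf[OF inv q] L])
      fix V3 assume a3: "agree {vf, vi, vj} ?V2 V3" and f: "V3 vf = of_bool (ok (Q ! ?q) ?L)"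
      have ag3: "agree ?U V V3" by (rule agree_trans[OF ag2 a3]) auto
      have v3: "V3 vz = z" "V3 vq = ?q" "V3 vP = ?L" "V3 vb = V1 vb" "V3 vbq = V1 vbq" "V3 vbL = V1 vbL"
        using a3 I by (auto simp: agree_def)
      have f': "V3 vf = of_bool (cand Q z)" using f by (simp add: cand_def)
      have b1: "V1 vb \<le> 1" using I(2) by (auto simp: B_def)
      show "runs (cond ?t ?set Skip) (ecost ?t + ?tset + 1 + 1) V3 A
          (step_post vz ?I z)"
      proof (rule runs_cond)
        assume "eval ?t V3 A \<noteq> 0"
        then have new: "cand Q z" "V1 vb = 0" using f' v3 b1 by (auto split: if_splits)
        then have "B (Suc z) (V3(vb := 1, vbq := ?q, vbL := ?L, vz := Suc z))"
          using I(2) unfolding B_def by auto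
        moreover have "agree ?U V (V3(vb := 1, vbq := ?q, vbL := ?L, vz := Suc z))"
          using ag3 by (auto simp: agree_def)
        ultimately have *: "?I (Suc z) (V3(vb := 1, vbq := ?q, vbL := ?L, vz := Suc z)) A" by simp
        show "runs ?set ?tset V3 A (step_post vz ?I z)"
          by (rule runs_Seq, rule runs_asg, rule runs_Seq, rule runs_asg, rule runs_asg)
            (use * v3 q len L small in simp_all)
      next
        assume "eval ?t V3 A = 0"
        then have "\<not> cand Q z \<or> V1 vb = 1" using f' v3 b1 by (auto split: if_splits)
        then have "B (Suc z) (V3(vz := Suc z))" using I(2) v3(4-6) unfolding B_def by (auto simp: less_Suc_eq)
        then show "runs Skip 1 V3 A (step_post vz ?I z)"
          using ag3 v3 by (intro runs_Skip) (auto simp: agree_def)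
      qed (use v3 b1 f' small in simp)
    qed simp_all
    have bounds: "k - Suc z \<le> W" "k - (k - Suc z) \<le> W" using small by linarith+
    show ?thesis
      by (rule runs_Seq, rule runs_asg, rule runs_Seq, rule runs_asg, rule runs_Seq)
        (use ok bounds v1 I(3) z \<open>?Z < W\<close> small in simp_all)
  qed
  have loop: "runs (iter vz ?e ?body) (iter_time ?Z ?tbody ?e) (V(vb := 0)) A R"
  proof (rule runs_iter[where I = ?I])
    show "?I 0 (V(vb := 0, vz := 0)) A" by (auto simp: agree_def B_def)
    fix z V1 A1 assume I: "?I z V1 A1" "V1 vz = z"
    have "V1 vk = k" "V1 vL = length Q" using I S S' by (auto simp: agree_def)
    then show "safe W S ?e V1 A1 \<and> eval ?e V1 A1 = ?Z" using small len \<open>?Z < W\<close> by simp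
    assume "z < ?Z"
    then show "runs ?body ?tbody V1 A1 (step_post vz ?I z)"
      using I body by blast
  next
    fix V1 A1 assume "?I ?Z V1 A1"
    then show "R V1 A1" using cont[of V1] unfolding B_def by blast
  qed (use \<open>?Z < W\<close> in auto)
  have "?tbody + ecost ?e + 10 \<le> 700 * (k * k)" unfolding ecost.simps using k_le_kk by linarith
  moreover have "?Z \<le> 2 * QM" using len k_le_QM by linarith
  ultimately have "?Z * (?tbody + ecost ?e + 10) \<le> 2 * QM * (700 * (k * k))" by (rule mult_le_mono[rotated])
  also have "\<dots> = 1400 * (k * k * QM)" by (simp add: mult_ac)
  finally have time: "?Z * (?tbody + ecost ?e + 10) \<le> 1400 * (k * k * QM)" .
  have sum_bound: "ecost (Num 0) + 2 + (X + ecost ?e + 7) \<le> 3000 * Y" if "X \<le> 1400 * Y" "1 \<le> Y" for X Y :: nat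
    using that by simp
  show ?thesis unfolding find_prog_def
    apply (rule runs_time)
     apply (rule runs_Seq, rule runs_asg)
        apply (use loop in simp)
       apply simp
      apply simp
     apply simp
    using sum_bound[OF time time_unit(3)] by simp
qed

end

section \<open>Writing the path\<close>

abbreviation (input) cell_expr :: expr where
  "cell_expr \<equiv> Num 2 [+] Var vk [*] (Var vD [+] Var vbL [-] Var vt) [+] Var vi"

definition item_prog :: prog where
  "item_prog = cond (Var vs' [-] Var vi)
     (put 0 cell_expr (Get aF (Var vbL [-] Var vs' [+] Var vi)))
     (put 0 cell_expr (Get aQ (Var vcur [*] Var vk [+] (Var vi [-] Var vs'))))"

text \<open>\<open>vs'\<close> is the number of moves made after leaving the queue entry.
  \<open>vcur\<close> climbs to its parent only when these moves are used up, and not in the final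
  round, where it is the root and has no parent.\<close>

definition row_prog :: prog where
  "row_prog = Seq (asg vs' (Var vbL [-] Var vt)) (Seq (iter vi (Var vk) item_prog)
     (cond (Var vs' [+] (Num 1 [-] (Var vD [+] Var vbL [-] Var vt))) Skip (asg vcur (Get aP (Var vcur)))))"

definition write_prog :: prog where
  "write_prog = Seq (asg vD (Get aD (Var vbq))) (Seq (put 0 (Num 1) (Var vD [+] Var vbL [+] Num 1))
     (Seq (asg vcur (Var vbq)) (iter vt (Var vD [+] Var vbL [+] Num 1) row_prog)))"

definition same_conf_expr :: expr where
  "same_conf_expr = Num 1 [-] (Get aF (Var vi) [\<noteq>] Get aQ (Var vi))"

text \<open>If the two configurations coincide, resetting \<open>vbq\<close> and \<open>vbL\<close>
  selects the trivial path, while the answer \<open>vb\<close> still refers to plays with at least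
  one move.\<close>

definition output_prog :: prog where
  "output_prog = Seq (asg vf (Num 1)) (Seq (all_loop vi (Var vk) same_conf_expr)
     (Seq (cond (Var vf) (Seq (asg vbq (Num 0)) (asg vbL (Num 0))) Skip)
     (Seq (put 0 (Num 0) (Var vb))
       (cond (Var vf [+] Var vb) write_prog (put 0 (Num 1) (Num 0))))))"

context snake_machine
begin

lemma runs_write:
  assumes V: "V vk = k" "V vS = S" "V vbq = q" "V vbL = L"
    and fin: "\<And>i. i < k \<Longrightarrow> A aF i = fin ! i" and qu: "queue Q A"
    and inv: "bfs_inv Q (A aP) (A aD) h u" and q: "q < length Q" and L: "L \<le> k"
    and cont: "\<And>V' A'. A' 0 0 = A 0 0 \<Longrightarrow> A' 0 1 = A aD q + L + 1 \<Longrightarrow>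
      (\<And>t i. t \<le> A aD q + L \<Longrightarrow> i < k \<Longrightarrow>
        A' 0 (2 + k * (A aD q + L - t) + i) = trace Q (A aP) q L t ! i) \<Longrightarrow> R V' A'"
  shows "runs write_prog (1000 * (k * k * QM)) V A R"
proof -
  let ?D = "A aD q" let ?T = "A aD q + L"
  let ?U = "{vD, vt, vs', vcur, vi}"
  let ?cur = "\<lambda>t. (A aP ^^ (t - L)) q"
  let ?tr = "trace Q (A aP) q L"
  have len: "length Q \<le> QM" by (rule bfs_length[OF inv])
  have D: "?D < QM" using bfs_inv_dep[OF inv q] q len by simp
  have cur: "?cur t < length Q" if "t \<le> ?T" for t using ancestor[OF inv q, of "t - L"] that by simp
  have W': "?T + 1 < W" using D L W by simp
  have TW: "?T \<le> QM + k" using D L by simp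
  have tr: "?tr t ! i = (if i < L - t then fin ! (L - (L - t) + i) else Q ! ?cur t ! (i - (L - t)))" if "i < k" for t i
    using that by (simp add: trace_def window_nth)
  have below: "2 + k * (?T - t) + i < S" if "i < k" for t i
  proof -
    have "?T - t < QM + k + 1" using TW by simp
    from cell_bound[OF this that] have "(?T - t) * k + i < (QM + k + 1) * k" .
    moreover have "k * (?T - t) = (?T - t) * k" "k * (QM + k + 1) = (QM + k + 1) * k"
      by (rule mult.commute)+
    ultimately show ?thesis using S by linarith
  qed
  \<comment> \<open>Different rows occupy disjoint blocks of cells, so rows already written survive
    the later writes.\<close>
  have ne: "2 + k * (?T - t) + i \<noteq> 2 + k * (?T - t') + i'" if "t' < t" "t \<le> ?T" "i < k" for t t' i i'
  proof -
    have "?T - t < ?T - t'" using that by simp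
    from cell_bound[OF this that(3)] have "(?T - t) * k + i < (?T - t') * k" .
    moreover have "k * (?T - t) = (?T - t) * k" "k * (?T - t') = (?T - t') * k" by (rule mult.commute)+
    ultimately show ?thesis by linarith
  qed
  define wr where "wr t A' \<longleftrightarrow> (\<forall>a. a \<noteq> 0 \<longrightarrow> A' a = A a) \<and> A' 0 0 = A 0 0 \<and> A' 0 1 = ?T + 1 \<and>
    (\<forall>t' < t. \<forall>i < k. A' 0 (2 + k * (?T - t') + i) = ?tr t' ! i)" for t :: nat and A' :: arrays
  define vals where "vals t V' \<longleftrightarrow> V' vk = k \<and> V' vS = S \<and> V' vbL = L \<and> V' vD = ?D \<and> V' vt = t \<and> V' vcur = ?cur t"
    for t :: nat and V' :: vars
  let ?J = "\<lambda>t i V' A'. wr t A' \<and> vals t V' \<and> V' vs' = L - t \<and> (\<forall>i' < i. A' 0 (2 + k * (?T - t) + i') = ?tr t ! i')"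
  let ?F = "Get aF (Var vbL [-] Var vs' [+] Var vi)"
  let ?G = "Get aQ (Var vcur [*] Var vk [+] (Var vi [-] Var vs'))"
  let ?titem = "ecost (Var vs' [-] Var vi) + (ecost cell_expr + ecost ?F + 6) + (ecost cell_expr + ecost ?G + 6) + 1"
  have item: "runs item_prog ?titem V' A' (step_post vi (?J t) i)"
    if J: "?J t i V' A'" and i: "V' vi = i" "i < k" and t: "t \<le> ?T" for t i V' A'
  proof -
    have v: "V' vk = k" "V' vS = S" "V' vbL = L" "V' vD = ?D" "V' vt = t" "V' vcur = ?cur t" "V' vs' = L - t"
      using J by (auto simp: vals_def)
    let ?x = "2 + k * (?T - t) + i"
    have x: "?x < S" by (rule below[OF i(2)])
    have kx: "k * (?T - t) \<le> W" "2 + k * (?T - t) \<le> W" "?x \<le> W" "?T - t \<le> W" "?T \<le> W"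
      using x small W' by linarith+
    have cell: "safe W S cell_expr V' A'" "eval cell_expr V' A' = ?x" "valid_address W S 0 (eval cell_expr V' A') V'"
      using v i t kx x W' small D L by (simp_all add: valid_address_def)
    have upd: "?J t (Suc i) (V'(vi := Suc i)) (A'(0 := (A' 0)(?x := ?tr t ! i)))"
      using J i ne[of _ t i, symmetric] t unfolding wr_def vals_def
      by (auto simp: less_Suc_eq)
    have Aa: "A' aF = A aF" "A' aQ = A aQ" using J by (simp_all add: wr_def)
    show ?thesis unfolding item_prog_def
    proof (rule runs_cond)
      assume "eval (Var vs' [-] Var vi) V' A' \<noteq> 0"
      then have lt: "i < L - t" using v i by simp
      then have val: "eval ?F V' A' = ?tr t ! i" using tr[OF i(2), of t] v i L fin Aa by simp
      have "L - (L - t) + i < k" using lt L by linarith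
      moreover have "L - t \<le> W" "L - (L - t) \<le> W" "L \<le> W" using L small by linarith+
      ultimately have sF: "safe W S ?F V' A'"
        using v i small L fin_address[of "L - (L - t) + i"] by (simp add: valid_address_def address_def)
      show "runs (put 0 cell_expr ?F) (ecost cell_expr + ecost ?F + 6) V' A'
          (step_post vi (?J t) i)"
        by (rule runs_put[OF _ sF cell(1,3)]) (use cell(2) val upd i in \<open>simp del: eval.simps\<close>)
    next
      assume "eval (Var vs' [-] Var vi) V' A' = 0"
      then have ge: "\<not> i < L - t" using v i by simp
      have lt: "i - (L - t) < k" using i by linarith
      have "A aQ (?cur t * k + (i - (L - t))) = Q ! ?cur t ! (i - (L - t))"
        using qu cur[OF t] lt unfolding queue_def by blast
      then have val: "eval ?G V' A' = ?tr t ! i" using tr[OF i(2), of t] ge v i Aa by simp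
      have "S + 8 * (?cur t * k + (i - (L - t))) + 8 < W"
        using entry_address[of "?cur t" "i - (L - t)"] cur[OF t] len lt by simp
      moreover have "L - t \<le> W" "i - (L - t) \<le> W" using L i small by linarith+
      ultimately have sG: "safe W S ?G V' A'" using v i small L cur[OF t] len
        by (simp add: valid_address_def address_def)
      show "runs (put 0 cell_expr ?G) (ecost cell_expr + ecost ?G + 6) V' A'
          (step_post vi (?J t) i)"
        by (rule runs_put[OF _ sG cell(1,3)]) (use cell(2) val upd i in \<open>simp del: eval.simps\<close>)
    next
      have "L - t - i \<le> W" "L - t \<le> W" using small L by linarith+
      then show "safe W S (Var vs' [-] Var vi) V' A'" using v i small by simp
    qed
  qed
  let ?I = "\<lambda>t V' A'. t \<le> ?T \<longrightarrow> wr t A' \<and> vals t V'"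
  let ?next = "Var vs' [+] (Num 1 [-] (Var vD [+] Var vbL [-] Var vt))"
  let ?cond = "cond ?next Skip (asg vcur (Get aP (Var vcur)))"
  let ?tcond = "ecost ?next + 1 + (ecost (Get aP (Var vcur)) + 2) + 1"
  let ?K = "\<lambda>t V' A'. wr t A' \<and> V' vk = k \<and> V' vS = S \<and> V' vbL = L \<and> V' vD = ?D \<and> (t \<le> ?T \<longrightarrow> V' vcur = ?cur t)"
  have advance: "runs ?cond ?tcond V' A' (step_post vt ?K t)"
    if J: "?J t k V' A'" and t: "t \<le> ?T" for t V' A'
  proof -
    have v: "V' vk = k" "V' vS = S" "V' vbL = L" "V' vD = ?D" "V' vt = t" "V' vcur = ?cur t" "V' vs' = L - t"
      using J by (auto simp: vals_def)
    have wr: "wr (Suc t) A'" using J unfolding wr_def by (auto simp: less_Suc_eq)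
    show ?thesis
    proof (rule runs_cond)
      assume "eval ?next V' A' \<noteq> 0"
      then have "t < L \<or> t = ?T" using v t by auto
      then have "Suc t \<le> ?T \<longrightarrow> ?cur (Suc t) = ?cur t" by auto
      then show "runs Skip 1 V' A' (step_post vt ?K t)"
        using v wr by (intro runs_Skip) simp
    next
      assume "eval ?next V' A' = 0"
      then have "L \<le> t" "t < ?T" using v t by auto
      then have next_cur: "?cur (Suc t) = A aP (?cur t)" by (simp add: Suc_diff_le)
      have lt: "?cur (Suc t) < length Q" using cur[of "Suc t"] \<open>t < ?T\<close> by simp
      have AP: "A' aP = A aP" using J by (simp add: wr_def)
      show "runs (asg vcur (Get aP (Var vcur))) (ecost (Get aP (Var vcur)) + 2) V' A'
          (step_post vt ?K t)"
        by (rule runs_asg)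
          (use v wr next_cur AP lt len small cur[OF t] index_address[of "?cur t"] in
            \<open>simp_all add: valid_address_def address_def\<close>)
    next
      have "L - t \<le> W" "?T - t \<le> W" "?T \<le> W" "L - t + (1 - (?T - t)) \<le> W" "1 - (?T - t) \<le> W"
        using small L W' k_le_QM by linarith+
      then show "safe W S ?next V' A'" using v small t W' D L by simp
    qed
  qed
  let ?trow = "ecost (Var vbL [-] Var vt) + 2 + (iter_time k ?titem (Var vk) + ?tcond)"
  have row: "runs row_prog ?trow V' A' (step_post vt ?K t)"
    if K: "?K t V' A'" and v: "V' vt = t" and t: "t \<le> ?T" for t V' A'
  proof -
    have vals: "vals t V'" and wr: "wr t A'" using K v t by (auto simp: vals_def)
    let ?V = "V'(vs' := L - t)"
    have rows: "runs (iter vi (Var vk) item_prog) (iter_time k ?titem (Var vk)) ?V A'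
      (\<lambda>V' A'. runs ?cond ?tcond V' A' (step_post vt ?K t))"
    proof (rule runs_iter[where I = "?J t"])
      show "?J t 0 (?V(vi := 0)) A'" using vals wr by (simp add: vals_def)
      fix i V1 A1 assume J: "?J t i V1 A1" "V1 vi = i"
      then show "safe W S (Var vk) V1 A1 \<and> eval (Var vk) V1 A1 = k" using small by (simp add: vals_def)
      assume "i < k"
      with J show "runs item_prog ?titem V1 A1 (step_post vi (?J t) i)"
        using item t by blast
    next
      fix V1 A1 assume "?J t k V1 A1"
      then show "runs ?cond ?tcond V1 A1 (step_post vt ?K t)"
        using advance t by blast
    qed (use small in auto)
    have "L - t \<le> W" "L \<le> W" "t \<le> W" using small L t W' by linarith+
    then show ?thesis unfolding row_prog_def
      using rows vals v by (intro runs_Seq runs_asg) (simp_all add: vals_def)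
  qed
  let ?eT = "Var vD [+] Var vbL [+] Num 1"
  have rows: "runs (iter vt ?eT row_prog) (iter_time (?T + 1) ?trow ?eT) V' A' R"
    if "?K 0 V' A'" for V' A'
  proof (rule runs_iter[where I = ?K])
    show "?K 0 (V'(vt := 0)) A'" using that by simp
    fix t V1 A1 assume K: "?K t V1 A1" "V1 vt = t"
    show "safe W S ?eT V1 A1 \<and> eval ?eT V1 A1 = ?T + 1" using K W' D L small by simp
    assume "t < ?T + 1"
    then have "t \<le> ?T" by simp
    from row[OF K this] show "runs row_prog ?trow V1 A1 (step_post vt ?K t)" .
  next
    fix V1 A1 assume "?K (?T + 1) V1 A1"
    then show "R V1 A1" by (intro cont) (auto simp: wr_def)
  qed (use W' in auto)
  let ?A = "A(0 := (A 0)(1 := ?T + 1))"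
  have wr0: "wr 0 ?A" by (simp add: wr_def)
  have first: "runs (Seq (asg vcur (Var vbq)) (iter vt ?eT row_prog))
      (ecost (Var vbq) + 2 + (iter_time (?T + 1) ?trow ?eT)) (V(vD := ?D)) ?A R"
    by (rule runs_Seq, rule runs_asg, rule rows) (use V wr0 q len small in simp_all)
  have "?trow + ecost ?eT + 10 \<le> 300 * k" using k by simp
  moreover have "?T + 1 \<le> 2 * QM" using D L k_le_QM by linarith
  ultimately have "(?T + 1) * (?trow + ecost ?eT + 10) \<le> 2 * QM * (300 * k)" by (rule mult_le_mono[rotated])
  also have "\<dots> = 600 * (k * QM)" by (simp add: mult_ac)
  also have "\<dots> \<le> 600 * (k * k * QM)" using k by simp
  finally have time: "(?T + 1) * (?trow + ecost ?eT + 10) \<le> 600 * (k * k * QM)" .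
  have sum_bound: "ecost (Get aD (Var vbq)) + 2 + (ecost (Num 1) + ecost ?eT + 6 +
      (ecost (Var vbq) + 2 + (X + ecost ?eT + 7))) \<le> 1000 * Y" if "X \<le> 600 * Y" "1 \<le> Y" for X Y :: nat
    using that by simp
  have "S > 1" using S by simp
  show ?thesis unfolding write_prog_def
    apply (rule runs_time)
     apply (rule runs_Seq, rule runs_asg, rule runs_Seq, rule runs_put)
            apply (use first V in simp)
           apply (use V q D L W' len small index_address[of q] \<open>S > 1\<close> in
             \<open>simp add: valid_address_def address_def; fail\<close>)+
    using sum_bound[OF time time_unit(3)] by simp
qed

lemma runs_output:
  assumes st: "bfs_state Q h u V A" and vb: "V vb \<le> 1"
    and best: "V vb = 1 \<Longrightarrow> V vbq < length Q \<and> V vbL \<le> k"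
    and no: "\<And>V' A'. fin \<noteq> init \<Longrightarrow> V vb = 0 \<Longrightarrow> A' 0 0 = 0 \<Longrightarrow> A' 0 1 = 0 \<Longrightarrow> R V' A'"
    and yes: "\<And>V' A' q L. fin = init \<and> q = 0 \<and> L = 0 \<or> fin \<noteq> init \<and> V vb = 1 \<and> q = V vbq \<and> L = V vbL \<Longrightarrow>
      A' 0 0 = V vb \<Longrightarrow> A' 0 1 = A aD q + L + 1 \<Longrightarrow>
      (\<And>t i. t \<le> A aD q + L \<Longrightarrow> i < k \<Longrightarrow>
        A' 0 (2 + k * (A aD q + L - t) + i) = trace Q (A aP) q L t ! i) \<Longrightarrow> R V' A'"
  shows "runs output_prog (2000 * (k * k * QM)) V A R"
proof -
  have S: "static V A" "queue Q A" and inv: "bfs_inv Q (A aP) (A aD) h u"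
    using st by (auto simp: bfs_state_def)
  note S' = staticD(1-4)[OF S(1)]
  have Q: "0 < length Q" "Q ! 0 = init" using bfs_invD(1,2)[OF inv] by simp_all
  have init: "A aQ i = init ! i" "init ! i < n" if "i < k" for i
    using S(2) Q that confD(5)[OF conf_init that] unfolding queue_def by force+
  have F: "A aF i = fin ! i" "fin ! i < n" if "i < k" for i
    using staticD(7)[OF S(1) that] confD(5)[OF conf_fin that] .
  let ?f = "of_bool (fin = init) :: nat"
  let ?reset = "cond (Var vf) (Seq (asg vbq (Num 0)) (asg vbL (Num 0))) Skip"
  let ?treset = "ecost (Var vf) + (ecost (Num 0) + 2 + (ecost (Num 0) + 2)) + 1 + 1"
  let ?write = "cond (Var vf [+] Var vb) write_prog (put 0 (Num 1) (Num 0))"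
  let ?twrite = "ecost (Var vf [+] Var vb) + 1000 * (k * k * QM) + (ecost (Num 1) + ecost (Num 0) + 6) + 1"
  let ?final = "Seq (put 0 (Num 0) (Var vb)) ?write"
  let ?tfinal = "ecost (Num 0) + ecost (Var vb) + 6 + ?twrite"
  have "S > 1" using S by (simp add: snake_machine.S[OF snake_machine_axioms])
  have final: "runs ?final ?tfinal V1 A R"
    if v: "V1 vf = ?f" "V1 vb = V vb" "V1 vk = k" "V1 vS = S"
      and r: "fin = init \<longrightarrow> V1 vbq = 0 \<and> V1 vbL = 0" "fin \<noteq> init \<longrightarrow> V1 vbq = V vbq \<and> V1 vbL = V vbL" for V1
  proof (rule runs_Seq, rule runs_put)
    let ?A = "A(0 := (A 0)(0 := V vb))"
    have "runs ?write ?twrite V1 ?A R"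
    proof (rule runs_cond)
      assume "eval (Var vf [+] Var vb) V1 ?A \<noteq> 0"
      then have c: "fin = init \<or> V vb = 1" using v vb by (auto split: if_splits)
      show "runs write_prog (1000 * (k * k * QM)) V1 ?A R"
      proof (rule runs_write[OF v(3,4) refl refl])
        show "queue Q ?A" using S(2) by (simp add: queue_def)
        show "bfs_inv Q (?A aP) (?A aD) h u" using inv by simp
        show "V1 vbq < length Q" "V1 vbL \<le> k" using c r best Q by (cases "fin = init"; simp)+
      qed (use F c r v in \<open>auto intro!: yes[of "V1 vbq" "V1 vbL"]\<close>)
    next
      assume "eval (Var vf [+] Var vb) V1 ?A = 0"
      then have c: "fin \<noteq> init" "V vb = 0" using v by (auto split: if_splits)
      show "runs (put 0 (Num 1) (Num 0)) (ecost (Num 1) + ecost (Num 0) + 6) V1 ?A R"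
        by (rule runs_put) (use c no \<open>S > 1\<close> small in \<open>auto simp: valid_address_def\<close>)
    qed (use v vb small in simp)
    then show "runs ?write ?twrite V1 (A(0 := (A 0)(eval (Num 0) V1 A := eval (Var vb) V1 A))) R" using v by simp
  qed (use v vb small \<open>S > 1\<close> in \<open>simp_all add: valid_address_def\<close>)
  have reset: "runs ?reset ?treset V1 A (\<lambda>V A. runs ?final ?tfinal V A R)"
    if "agree {vi, vf} V V1" "V1 vf = ?f" for V1
  proof (rule runs_cond)
    assume "eval (Var vf) V1 A \<noteq> 0"
    then have "fin = init" using that by (simp split: if_splits)
    then have reset: "runs ?final ?tfinal (V1(vbq := 0, vbL := 0)) A R"
      using that S' by (intro final) (auto simp: agree_def)
    show "runs (Seq (asg vbq (Num 0)) (asg vbL (Num 0))) (ecost (Num 0) + 2 + (ecost (Num 0) + 2)) V1 A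
        (\<lambda>V A. runs ?final ?tfinal V A R)"
      by (rule runs_Seq, rule runs_asg, rule runs_asg) (use reset in simp_all)
  next
    assume "eval (Var vf) V1 A = 0"
    then have "fin \<noteq> init" using that by (simp split: if_splits)
    then have skip: "runs ?final ?tfinal V1 A R" using that S' by (intro final) (auto simp: agree_def)
    show "runs Skip 1 V1 A (\<lambda>V A. runs ?final ?tfinal V A R)"
      using runs_Skip[of "\<lambda>V A. runs ?final ?tfinal V A R", OF skip] .
  qed (use that small in simp)
  have fin_init: "(\<forall>i < k. fin ! i = init ! i) \<longleftrightarrow> fin = init"
    using confD(1)[OF conf_fin] confD(1)[OF conf_init] by (auto intro: nth_equalityI)
  have same: "runs (all_loop vi (Var vk) same_conf_expr) (k * (ecost same_conf_expr + ecost (Var vk) + 20) + ecost (Var vk) + 7)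
      (V(vf := 1)) A (\<lambda>V A. runs (Seq ?reset ?final) (?treset + ?tfinal) V A R)"
  proof (rule runs_all[where P = "\<lambda>i. fin ! i = init ! i" and b = True])
    fix V1 assume a: "agree {vi, vf} (V(vf := 1)) V1"
    have v: "V1 vk = k" "V1 vS = S" using a S' by (auto simp: agree_def)
    then show "safe W S (Var vk) V1 A \<and> eval (Var vk) V1 A = k" using small by simp
    { fix i assume i: "V1 vi = i" "i < k"
      from F[OF i(2)] init[OF i(2)] fin_address[OF i(2)]
      show "safe W S same_conf_expr V1 A \<and> (eval same_conf_expr V1 A \<noteq> 0 \<longleftrightarrow> fin ! i = init ! i)"
        using v i small by (simp add: same_conf_expr_def valid_address_def address_def) auto }
    { assume f: "V1 vf = of_bool (True \<and> (\<forall>i < k. fin ! i = init ! i))"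
      have "agree {vi, vf} V V1" using a by (auto simp: agree_def)
      then show "runs (Seq ?reset ?final) (?treset + ?tfinal) V1 A R"
        using reset f fin_init by (intro runs_Seq) simp }
  qed (use small in auto)
  have "k \<le> k * k * QM" "1 \<le> k * k * QM"
    using k_le_QM mult_le_mono[OF k_le_kk(2) k_le_QM] time_unit(3) by simp_all
  moreover have "ecost (Num 1) + 2 + (k * (ecost same_conf_expr + ecost (Var vk) + 20) + ecost (Var vk) + 7
      + (?treset + (ecost (Num 0) + ecost (Var vb) + 6 + (ecost (Var vf [+] Var vb) + 1000 * Y +
        (ecost (Num 1) + ecost (Num 0) + 6) + 1)))) \<le> 2000 * Y" if "k \<le> Y" "1 \<le> Y" for Y :: nat
    using that by (simp add: same_conf_expr_def)
  ultimately have time: "ecost (Num 1) + 2 + (k * (ecost same_conf_expr + ecost (Var vk) + 20) + ecost (Var vk) + 7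
      + (?treset + ?tfinal)) \<le> 2000 * (k * k * QM)" by blast
  show ?thesis unfolding output_prog_def
    by (rule runs_time[OF _ time], rule runs_Seq, rule runs_asg, rule runs_Seq) (use same small in simp_all)
qed

end

section \<open>The complete program\<close>

abbreviation (input) vM :: nat where "vM \<equiv> 27"

definition base_expr :: expr where
  "base_expr = Num 10 [+] Var vn [*] Var vn [+] Num 2 [*] Var vk [+] Var vk [*] Var vk [+] Var vC [+]
     Var vk [*] (Var vM [+] Var vk [+] Num 1)"

text \<open>The output overwrites the input area, so both configurations are first moved to work
  arrays; \<open>init\<close> thereby becomes entry 0 of the queue.\<close>

definition copy_prog :: prog where
  "copy_prog = Seq (iter vi (Var vk) (put aF (Var vi) (Get 0 (Num 2 [+] Var vn [*] Var vn [+] Var vk [+] Var vi))))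
     (iter vi (Var vk) (put aQ (Var vi) (Get 0 (Num 2 [+] Var vn [*] Var vn [+] Var vi))))"

definition setup_prog :: prog where
  "setup_prog = Seq (asg vn (Get 0 (Num 0))) (Seq (asg vk (Get 0 (Num 1))) (Seq (asg vC (Num 1))
     (Seq (iter vi (Var vk) (asg vC (Var vk [*] Var vk [*] Var vC)))
     (Seq (asg vM (Var vn [*] Var vC [*] Var vk)) (Seq (asg vS base_expr) copy_prog)))))"

definition snake_prog :: prog where
  "snake_prog = Seq setup_prog (Seq bfs_prog (Seq find_prog output_prog))"

context snake_machine
begin

text \<open>\<open>A aD 0 = 0\<close> reflects the zero-initialised memory, which supplies the depth
  of the root without any instruction.\<close>

definition input :: "arrays \<Rightarrow> bool" where
  "input A \<longleftrightarrow> A 0 0 = n \<and> A 0 1 = k \<and> A aD 0 = 0 \<and>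
     (\<forall>u < n. \<forall>v < n. A 0 (2 + u * n + v) \<le> 1 \<and> (A 0 (2 + u * n + v) + 2 div Suc k \<noteq> 0 \<longleftrightarrow> E u v)) \<and>
     (\<forall>i < k. A 0 (2 + n * n + i) = init ! i \<and> A 0 (2 + n * n + k + i) = fin ! i)"

lemma inputD:
  assumes "input A"
  shows "A 0 0 = n" "A 0 1 = k" "A aD 0 = 0"
    "i < k \<Longrightarrow> A 0 (2 + n * n + i) = init ! i" "i < k \<Longrightarrow> A 0 (2 + n * n + k + i) = fin ! i"
  using assms by (simp_all add: input_def)

lemma runs_copy:
  assumes V: "V vn = n" "V vk = k" "V vS = S" "V vC = codes k" and input: "input A"
    and cont: "\<And>V' A'. static V' A' \<Longrightarrow> queue [init] A' \<Longrightarrow> A' aD 0 = 0 \<Longrightarrow> R V' A'"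
  shows "runs copy_prog (100 * k) V A R"
proof -
  note in' = inputD[OF input]
  let ?g = "Get 0 (Num 2 [+] Var vn [*] Var vn [+] Var vk [+] Var vi)"
  let ?h = "Get 0 (Num 2 [+] Var vn [*] Var vn [+] Var vi)"
  let ?I = "\<lambda>i V' A'. agree {vi} V V' \<and> (\<forall>a. a \<noteq> aF \<longrightarrow> A' a = A a) \<and> (\<forall>i' < i. A' aF i' = fin ! i')"
  let ?J = "\<lambda>i V' A'. agree {vi} V V' \<and> (\<forall>a. a \<noteq> aF \<and> a \<noteq> aQ \<longrightarrow> A' a = A a) \<and>
    (\<forall>i' < k. A' aF i' = fin ! i') \<and> (\<forall>i' < i. A' aQ i' = init ! i')"
  have size: "2 + n * n + k + k < S" using S by simp
  have queue: "runs (iter vi (Var vk) (put aQ (Var vi) ?h)) (iter_time k (ecost (Var vi) + ecost ?h + 6) (Var vk)) V' A' R"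
    if I: "?I k V' A'" for V' A'
  proof (rule runs_iter[where I = ?J])
    show "?J 0 (V'(vi := 0)) A'" using I by (auto simp: agree_def)
    fix i V1 A1 assume J: "?J i V1 A1" "V1 vi = i"
    have v: "V1 vn = n" "V1 vk = k" "V1 vS = S" using J V by (auto simp: agree_def)
    then show "safe W S (Var vk) V1 A1 \<and> eval (Var vk) V1 A1 = k" using small by simp
    assume i: "i < k"
    have "?J (Suc i) (V1(vi := Suc i)) (A1(aQ := (A1 aQ)(i := init ! i)))"
      using J by (auto simp: agree_def less_Suc_eq)
    then show "runs (put aQ (Var vi) ?h) (ecost (Var vi) + ecost ?h + 6) V1 A1
        (step_post vi ?J i)"
      by (intro runs_put) (use J v i in'(4)[OF i] size small fin_address[OF i] in
        \<open>simp_all add: valid_address_def address_def\<close>)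
  next
    fix V1 A1 assume J: "?J k V1 A1"
    show "R V1 A1"
    proof (rule cont)
      show "static V1 A1" using J V input unfolding static_def input_def by (auto simp: agree_def)
      show "queue [init] A1" using J by (simp add: queue_def)
      show "A1 aD 0 = 0" using J in' by simp
    qed
  qed (use small in auto)
  have fin: "runs (iter vi (Var vk) (put aF (Var vi) ?g)) (iter_time k (ecost (Var vi) + ecost ?g + 6) (Var vk)) V A
    (\<lambda>V' A'. runs (iter vi (Var vk) (put aQ (Var vi) ?h))
      (iter_time k (ecost (Var vi) + ecost ?h + 6) (Var vk)) V' A' R)"
  proof (rule runs_iter[where I = ?I])
    show "?I 0 (V(vi := 0)) A" by (auto simp: agree_def)
    fix i V1 A1 assume I: "?I i V1 A1" "V1 vi = i"
    have v: "V1 vn = n" "V1 vk = k" "V1 vS = S" using I V by (auto simp: agree_def)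
    then show "safe W S (Var vk) V1 A1 \<and> eval (Var vk) V1 A1 = k" using small by simp
    assume i: "i < k"
    have "?I (Suc i) (V1(vi := Suc i)) (A1(aF := (A1 aF)(i := fin ! i)))"
      using I by (auto simp: agree_def less_Suc_eq)
    then show "runs (put aF (Var vi) ?g) (ecost (Var vi) + ecost ?g + 6) V1 A1
        (step_post vi ?I i)"
      by (intro runs_put) (use I v i in'(5)[OF i] size small fin_address[OF i] in
        \<open>simp_all add: valid_address_def address_def\<close>)
  qed (use small queue in auto)
  show ?thesis unfolding copy_prog_def by (rule runs_time, rule runs_Seq, rule fin) (use k in simp)
qed

lemma runs_setup:
  assumes input: "input A"
    and cont: "\<And>V' A'. static V' A' \<Longrightarrow> queue [init] A' \<Longrightarrow> A' aD 0 = 0 \<Longrightarrow> R V' A'"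
  shows "runs setup_prog (400 * k) V A R"
proof -
  note in' = inputD[OF input]
  let ?V = "V(vn := n, vk := k, vC := 1)"
  let ?pow = "Var vk [*] Var vk [*] Var vC"
  let ?I = "\<lambda>i V' A'. A' = A \<and> agree {vi, vC} ?V V' \<and> V' vC = (k * k) ^ i"
  let ?rest = "Seq (asg vM (Var vn [*] Var vC [*] Var vk)) (Seq (asg vS base_expr) copy_prog)"
  let ?trest = "ecost (Var vn [*] Var vC [*] Var vk) + 2 + (ecost base_expr + 2 + 100 * k)"
  have "2 \<le> S" using S by simp
  have rest: "runs ?rest ?trest V1 A R" if I: "?I k V1 A" for V1
  proof -
    have v: "V1 vn = n" "V1 vk = k" "V1 vC = codes k" using I by (auto simp: agree_def codes_def)
    have "n * codes k \<le> QM" using k by (simp add: QM)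
    moreover have "QM + k + 1 \<le> k * (QM + k + 1)"
      using mult_le_mono1[OF k, of "QM + k + 1"] by (simp only: mult_1)
    moreover have "S \<le> W" "QM \<le> W" using small by simp_all
    ultimately have bounds: "n * codes k \<le> W" "QM + k \<le> W" "QM + k + 1 \<le> W" "k * (QM + k + 1) \<le> W"
      "10 + n * n \<le> W" "10 + n * n + 2 * k \<le> W" "2 * k \<le> W" "10 + n * n + 2 * k + k * k \<le> W"
      "10 + n * n + 2 * k + k * k + codes k \<le> W"
      using S by linarith+
    let ?W1 = "V1(vM := QM, vS := S)"
    have "runs copy_prog (100 * k) ?W1 A R" using v input cont by (intro runs_copy) simp_all
    moreover have "eval base_expr (V1(vM := QM)) A = S" unfolding S using v by (simp add: base_expr_def)
    ultimately have copy: "runs copy_prog (100 * k) (V1(vM := QM, vS := eval base_expr (V1(vM := QM)) A)) A R"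
      and S': "eval base_expr (V1(vM := QM)) A \<le> W" using \<open>S \<le> W\<close> by simp_all
    have safe: "safe W S base_expr (V1(vM := QM)) A"
      unfolding base_expr_def using v bounds small \<open>eval base_expr (V1(vM := QM)) A = S\<close>[unfolded base_expr_def]
      by (simp add: add.assoc[symmetric])
    have base: "runs (Seq (asg vS base_expr) copy_prog) (ecost base_expr + 2 + 100 * k) (V1(vM := QM)) A R"
      by (rule runs_Seq, rule runs_asg) (use copy safe S' in simp_all)
    show ?thesis
      by (rule runs_Seq, rule runs_asg) (use base v bounds small in \<open>simp_all add: QM[symmetric]\<close>)
  qed
  have power: "runs (iter vi (Var vk) (asg vC ?pow)) (iter_time k (ecost ?pow + 2) (Var vk)) ?V A
      (\<lambda>V A. runs ?rest ?trest V A R)"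
  proof (rule runs_iter[where I = ?I])
    show "?I 0 (?V(vi := 0)) A" by (auto simp: agree_def)
    fix i V1 A1 assume I: "?I i V1 A1" "V1 vi = i"
    have v: "V1 vk = k" "V1 vC = (k * k) ^ i" using I by (auto simp: agree_def)
    then show "safe W S (Var vk) V1 A1 \<and> eval (Var vk) V1 A1 = k" using small by simp
    assume i: "i < k"
    have "(k * k) ^ Suc i \<le> codes k" unfolding codes_def by (rule power_increasing) (use i k in auto)
    then have "k * k * (k * k) ^ i \<le> W" using small by simp
    moreover have "(k * k) ^ i \<le> W"
      using power_increasing[of i k "k * k"] i k small by (simp add: codes_def)
    moreover have "agree {vi, vC} ?V (V1(vC := x, vi := Suc i))" for x using I by (auto simp: agree_def)
    ultimately show "runs (asg vC ?pow) (ecost ?pow + 2) V1 A1 (step_post vi ?I i)"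
      by (intro runs_asg) (use I v small in simp_all)
  next
    fix V1 A1 assume "?I k V1 A1"
    then show "runs ?rest ?trest V1 A1 R" using rest by blast
  qed (use small in auto)
  show ?thesis unfolding setup_prog_def
    apply (rule runs_time)
     apply (rule runs_Seq, rule runs_asg, rule runs_Seq, rule runs_asg, rule runs_Seq, rule runs_asg, rule runs_Seq)
           apply (use power in' in \<open>simp add: fun_upd_twist\<close>)
          apply (use in' small \<open>2 \<le> S\<close> in \<open>simp add: valid_address_def; fail\<close>)+
    using k by (simp add: base_expr_def)
qed

definition reachable :: bool where
  "reachable \<longleftrightarrow> (\<exists>f l. 1 \<le> l \<and> walk f l init fin)"

text \<open>Minimality ranges over walks of any length, zero included, as
  \<open>shortest_path\<close> demands, whereas \<open>reachable\<close> asks for at least one move.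
  The bound on \<open>l\<close> places the whole output below \<open>S\<close>.\<close>

definition correct_result :: "arrays \<Rightarrow> bool" where
  "correct_result A \<longleftrightarrow> A 0 0 = of_bool reachable \<and>
     (if fin \<noteq> init \<and> \<not> reachable then A 0 1 = 0
      else \<exists>f l. walk f l init fin \<and> l \<le> QM + k \<and> A 0 1 = l + 1 \<and>
        (\<forall>t \<le> l. \<forall>i < k. A 0 (2 + k * t + i) = f t ! i) \<and> (\<forall>f' l'. walk f' l' init fin \<longrightarrow> l \<le> l'))"

lemma runs_snake:
  assumes "input A"
  shows "runs snake_prog (10000 * (QM * (n * (codes k * (k * k * QM))))) V A (\<lambda>_ A. correct_result A)"
proof -
  have "runs snake_prog (400 * k + (4000 * (QM * (n * (codes k * (k * k * QM)))) +
      (3000 * (k * k * QM) + 2000 * (k * k * QM)))) V A (\<lambda>_ A. correct_result A)"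
    unfolding snake_prog_def
  proof (rule runs_Seq, rule runs_setup[OF assms], rule runs_Seq, rule runs_bfs, assumption+, rule runs_Seq)
    fix V1 A1 Q assume st: "bfs_state Q (length Q) 0 V1 A1"
    have inv: "bfs_inv Q (A1 aP) (A1 aD) (length Q) 0" using st by (simp add: bfs_state_def)
    note D = bfs_invD[OF inv]
    have Q: "0 < length Q" "Q ! 0 = init" using D(1,2) by simp_all
    have len: "length Q \<le> QM" by (rule bfs_length[OF inv])
    show "runs find_prog (3000 * (k * k * QM)) V1 A1
        (\<lambda>V A. runs output_prog (2000 * (k * k * QM)) V A (\<lambda>_ A. correct_result A))"
    proof (rule runs_find[OF st])
      fix V2 assume a: "agree {vf, vi, vj, vz, vq, vP, vb, vbq, vbL} V1 V2"
        and res: "V2 vb = 0 \<and> (\<forall>z < length Q + (k - 1). \<not> cand Q z) \<or>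
          V2 vb = 1 \<and> (\<exists>z < length Q + (k - 1). cand Q z \<and> (\<forall>z' < z. \<not> cand Q z') \<and>
            V2 vbq = z - (k - 1) \<and> V2 vbL = k - (k - 1 - z))"
      have st2: "bfs_state Q (length Q) 0 V2 A1"
        using st static_cong[of V1 A1, OF _ a] a by (auto simp: bfs_state_def agree_def)
      have found: "V2 vbq < length Q \<and> 1 \<le> V2 vbL \<and> V2 vbL \<le> k \<and> ok (Q ! (V2 vbq)) (V2 vbL) \<and>
          (\<forall>f l. 1 \<le> l \<longrightarrow> walk f l init fin \<longrightarrow> A1 aD (V2 vbq) + V2 vbL \<le> l)" if "V2 vb = 1"
      proof -
        from that res obtain z where z: "z < length Q + (k - 1)" "cand Q z" "\<forall>z' < z. \<not> cand Q z'"
          "V2 vbq = z - (k - 1)" "V2 vbL = k - (k - 1 - z)" by auto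
        have "A1 aD (V2 vbq) + V2 vbL \<le> l" if l: "1 \<le> l" "walk f l init fin" for f l
        proof -
          obtain z' where z': "z' < length Q + (k - 1)" "cand Q z'" "cost (A1 aD) z' \<le> l"
            using walk_cand[OF inv l(2,1)] by blast
          then have "z \<le> z'" using z(3) by (meson not_le)
          from cost_mono[OF inv this z'(1)] z'(3) show ?thesis unfolding z(4,5) cost_def by linarith
        qed
        moreover have "V2 vbq < length Q" using z(1,4) Q by linarith
        moreover have "1 \<le> V2 vbL" "V2 vbL \<le> k" using z(5) k by linarith+
        moreover have "ok (Q ! (V2 vbq)) (V2 vbL)" using z(2,4,5) by (simp add: cand_def)
        ultimately show ?thesis by blast
      qed
      \<comment> \<open>A hit yields a play through \<open>trace_walk\<close>, of at least one move
        since \<open>V2 vbL\<close> is positive; conversely, \<open>walk_cand\<close> turns any play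
        into a hit.\<close>
      have reach: "V2 vb = of_bool reachable"
      proof (cases "V2 vb = 1")
        case True
        then have "walk (\<lambda>t. trace Q (A1 aP) (V2 vbq) (V2 vbL) (A1 aD (V2 vbq) + V2 vbL - t))
            (A1 aD (V2 vbq) + V2 vbL) init fin"
          using found trace_walk[OF inv] by blast
        moreover have "1 \<le> A1 aD (V2 vbq) + V2 vbL" using found True by simp
        ultimately show ?thesis using True unfolding reachable_def by auto
      next
        case False
        then have "V2 vb = 0" "\<not> reachable" using res walk_cand[OF inv] unfolding reachable_def by blast+
        then show ?thesis by simp
      qed
      show "runs output_prog (2000 * (k * k * QM)) V2 A1 (\<lambda>_ A. correct_result A)"
      proof (rule runs_output[OF st2])
        fix A' :: arrays
        assume "fin \<noteq> init" "V2 vb = 0" "A' 0 0 = 0" "A' 0 1 = 0"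
        then show "correct_result A'" using reach by (simp add: correct_result_def split: if_splits)
      next
        fix A' :: arrays and q L
        assume c: "fin = init \<and> q = 0 \<and> L = 0 \<or> fin \<noteq> init \<and> V2 vb = 1 \<and> q = V2 vbq \<and> L = V2 vbL"
          and A': "A' 0 0 = V2 vb" "A' 0 1 = A1 aD q + L + 1"
          and tr: "\<And>t i. t \<le> A1 aD q + L \<Longrightarrow> i < k \<Longrightarrow>
            A' 0 (2 + k * (A1 aD q + L - t) + i) = trace Q (A1 aP) q L t ! i"
        let ?l = "A1 aD q + L" let ?f = "\<lambda>t. trace Q (A1 aP) q L (?l - t)"
        have q: "q < length Q" "L \<le> k" "L = 0 \<and> Q ! q = fin \<or> ok (Q ! q) L" using c found Q by auto
        have walk: "walk ?f ?l init fin" by (rule trace_walk[OF inv q])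
        have "A1 aD q \<le> q" by (rule bfs_inv_dep[OF inv q(1)])
        then have l: "?l \<le> QM + k" using q len by simp
        have out: "A' 0 (2 + k * t + i) = ?f t ! i" if "t \<le> ?l" "i < k" for t i
          using tr[of "?l - t" i] that by simp
        have min: "?l \<le> l'" if "walk f' l' init fin" for f' l'
        proof (cases "fin = init")
          case True
          then show ?thesis using c D(3) by simp
        next
          case False
          then have "1 \<le> l'" using that by (cases l') (auto simp: walk_def)
          then show ?thesis using that found c False by blast
        qed
        have "fin = init \<or> reachable" using c reach by (auto split: if_splits)
        moreover have "\<exists>f l. walk f l init fin \<and> l \<le> QM + k \<and> A' 0 1 = l + 1 \<and>
            (\<forall>t \<le> l. \<forall>i < k. A' 0 (2 + k * t + i) = f t ! i) \<and> (\<forall>f' l'. walk f' l' init fin \<longrightarrow> l \<le> l')"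
          by (rule exI[of _ ?f], rule exI[of _ ?l]) (use walk l A'(2) out min in blast)
        ultimately show "correct_result A'" unfolding correct_result_def using A'(1) reach by auto
      qed (use reach found in auto)
    qed
  qed
  then show ?thesis
  proof (rule runs_time)
    have "1 \<le> n * codes k" using n_pos codes_pos by simp
    let ?X = "k * k * QM" let ?Z = "QM * (n * (codes k * ?X))"
    have "?Z = (QM * (n * codes k)) * ?X" by (simp only: mult_ac)
    moreover have "1 * 1 \<le> QM * (n * codes k)"
      using k_le_QM k n_pos codes_pos by (intro mult_le_mono) simp_all
    ultimately have X: "?X \<le> ?Z" using mult_le_mono1[of 1 "QM * (n * codes k)" ?X] by simp
    have "k \<le> ?X" using mult_le_mono[OF k_le_kk(1), of 1 QM] k_le_QM k by simp
    then show "400 * k + (4000 * ?Z + (3000 * ?X + 2000 * ?X)) \<le> 10000 * ?Z" using X by linarith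
  qed
qed

end

section \<open>Configurations of a numbered graph\<close>

lemma concat_nth_uniform:
  assumes "\<forall>x \<in> set xs. length x = k" "j < k * length xs"
  shows "concat xs ! j = xs ! (j div k) ! (j mod k)"
  using assms
proof (induction xs arbitrary: j)
  case (Cons x xs)
  then have k: "0 < k" by (cases k) auto
  show ?case
  proof (cases "j < k")
    case True
    then show ?thesis using Cons.prems by (simp add: nth_append)
  next
    case False
    then have "j - k < k * length xs" using Cons.prems(2) by simp
    then have "concat xs ! (j - k) = xs ! ((j - k) div k) ! ((j - k) mod k)"
      using Cons.IH Cons.prems(1) by simp
    moreover have "j div k = Suc ((j - k) div k)" "(j - k) mod k = j mod k"
      using False k by (simp_all add: le_div_geq le_mod_geq)
    ultimately show ?thesis using False Cons.prems(1) by (simp add: nth_append)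
  qed
qed simp

lemma outputsI: "(\<And>a. a < length xs \<Longrightarrow> snd s a = xs ! a) \<Longrightarrow> outputs s xs"
  unfolding outputs_def by (rule nth_equalityI) simp_all

lemma length_concat_uniform: "\<forall>x \<in> set xs. length x = k \<Longrightarrow> length (concat xs) = k * length xs"
  by (induction xs) auto

lemma vwalk_arcs_subset_iff:
  "set (vwalk_arcs p) \<subseteq> R \<longleftrightarrow> (\<forall>i. Suc i < length p \<longrightarrow> (p ! i, p ! Suc i) \<in> R)"
proof (induction p rule: vwalk_arcs.induct)
  case (3 x y xs)
  have split: "(\<forall>i. P i) \<longleftrightarrow> P 0 \<and> (\<forall>i. P (Suc i))" for P :: "nat \<Rightarrow> bool"
    by (metis not0_implies_Suc)
  show ?case using 3 by (subst split) simp
qed simp_all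

text \<open>For \<open>k = 1\<close> consecutive vertices of a walk need not be adjacent, which the complete relation
  expresses.\<close>
definition adjacent :: "'a pair_pre_digraph \<Rightarrow> nat \<Rightarrow> 'a list \<Rightarrow> nat \<Rightarrow> nat \<Rightarrow> bool" where
  "adjacent G k vs u v \<longleftrightarrow> k = 1 \<or> (vs ! u, vs ! v) \<in> parcs G"

locale numbered_instance =
  fixes G :: "'a pair_pre_digraph" and k :: nat and init fin vs :: "'a list"
  assumes inst: "snake_instance G k init fin" and distinct: "distinct vs" and vs: "set vs = pverts G"
begin

abbreviation "n \<equiv> length vs"
abbreviation "label \<equiv> map ((!) vs)"
abbreviation "number \<equiv> map (index vs)"

lemma index_nth: "i < n \<Longrightarrow> index vs (vs ! i) = i"
  unfolding index_def using distinct by (intro the_inv_into_f_f) (auto intro: inj_on_nth)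

lemma bij_nth: "bij_betw ((!) vs) {..<n} (pverts G)"
  using distinct vs by (intro bij_betw_nth) auto

lemma nth_index:
  assumes "v \<in> pverts G"
  shows "vs ! index vs v = v" "index vs v < n"
proof -
  obtain i where "i < n" "v = vs ! i" using assms vs by (metis in_set_conv_nth)
  then show "vs ! index vs v = v" "index vs v < n" using index_nth by auto
qed

lemma number_label: "set c \<subseteq> {..<n} \<Longrightarrow> number (label c) = c"
  by (induction c) (auto simp: index_nth)

lemma label_number: "set c \<subseteq> pverts G \<Longrightarrow> label (number c) = c"
  by (induction c) (auto simp: nth_index)

lemma instD: "1 \<le> k" "configuration G k init" "configuration G k fin"
  using inst by (auto simp: snake_instance_def)

text \<open>Interpreted in two stages: \<open>conf_number\<close>, proved with the notions of this
  first one, discharges the assumptions of \<open>snake_input\<close> below.\<close>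

sublocale index: snake n k "adjacent G k vs" "number init" "number fin" .

lemma conf_iff:
  assumes "set c \<subseteq> {..<n}"
  shows "index.conf c \<longleftrightarrow> configuration G k (label c)"
proof -
  have "distinct (label c) \<longleftrightarrow> distinct c"
    using inj_on_subset[OF bij_betw_imp_inj_on[OF bij_nth] assms] by (simp add: distinct_map)
  moreover have "set (label c) \<subseteq> pverts G" using assms nth_mem[of _ vs] unfolding vs by auto
  moreover have "adjacent G k vs (c ! i) (c ! Suc i) \<longleftrightarrow> (label c ! i, label c ! Suc i) \<in> parcs G"
    if "Suc i < k" "length c = k" for i using that by (auto simp: adjacent_def)
  ultimately show ?thesis using assms unfolding index.conf_def configuration_def by auto
qed

lemma conf_number:
  assumes "configuration G k c"
  shows "index.conf (number c)" "label (number c) = c"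
proof -
  have c: "set c \<subseteq> pverts G" using assms by (simp add: configuration_def)
  then show "label (number c) = c" by (rule label_number)
  moreover have "set (number c) \<subseteq> {..<n}" using c nth_index by auto
  ultimately show "index.conf (number c)" using conf_iff assms by simp
qed

sublocale index: snake_input n k "adjacent G k vs" "number init" "number fin"
  using instD conf_number by unfold_locales auto

lemma conf_label: "index.conf c \<Longrightarrow> configuration G k (label c) \<and> number (label c) = c"
  using conf_iff index.confD(2) number_label by blast

text \<open>A 1-transition states no edge between the new and the old head. For
  \<open>k \<ge> 2\<close> it is the first edge of the new configuration, whose second vertex is the
  old head; for \<open>k = 1\<close> \<open>adjacent\<close> holds for all pairs.\<close>

lemma step_iff:
  assumes "index.conf c" "index.conf c'"
  shows "index.step c c' \<longleftrightarrow> one_transition G k (label c) (label c')"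
proof
  have len: "length c = k" "length c' = k" using assms index.confD(1) by auto
  have inj: "vs ! (c' ! 0) = vs ! (c ! i) \<longleftrightarrow> c' ! 0 = c ! i" if "i < k" for i
    using that index.confD(5)[OF assms(1), of i] index.confD(5)[OF assms(2), of 0] distinct
    by (simp add: nth_eq_iff_index_eq)
  {
    assume s: "index.step c c'"
    have l: "index.legal (c' ! 0) c" using index.step_nth(2)[OF s] .
    have "c' ! i = c ! (i - 1)" if "1 \<le> i \<and> i < k" for i
      using index.step_nth(1)[OF s, of "i - 1"] that by simp
    then show "one_transition G k (label c) (label c')"
      using l inj conf_label assms len instD(1) unfolding one_transition_def
      by (auto simp: index.legal_def less_diff_conv)
  next
    assume t: "one_transition G k (label c) (label c')"
    have tl: "c' ! Suc i = c ! i" if "Suc i < k" for i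
    proof -
      have "label c' ! Suc i = label c ! i" using t that unfolding one_transition_def
        by (metis Suc_eq_plus1 add_diff_cancel_right' le_add2)
      then have "vs ! (c' ! Suc i) = vs ! (c ! i)" using that len by simp
      then show ?thesis using that index.confD(5)[OF assms(1), of i] index.confD(5)[OF assms(2), of "Suc i"] distinct
        by (simp add: nth_eq_iff_index_eq)
    qed
    have "c ! i \<noteq> c' ! 0" if "Suc i < k" for i
    proof -
      have "label c' ! 0 \<noteq> label c ! i" using t that unfolding one_transition_def by auto
      then show ?thesis using that len by auto
    qed
    moreover have "adjacent G k vs (c' ! 0) (c ! 0)"
    proof (cases "k = 1")
      case False
      then have "Suc 0 < k" using instD(1) by simp
      then show ?thesis using index.confD(4)[OF assms(2), of 0] tl[of 0] by simp
    qed (simp add: adjacent_def)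
    ultimately have "index.legal (c' ! 0) c"
      using index.confD(5)[OF assms(2), of 0] instD(1) by (auto simp: index.legal_def)
    moreover have "c' = index.move (c' ! 0) c"
    proof (rule nth_equalityI)
      fix i assume "i < length c'"
      then show "c' ! i = index.move (c' ! 0) c ! i"
        using tl index.nth_move[OF assms(1)] len by (cases i) auto
    qed (simp add: index.nth_move(3)[OF assms(1)] len)
    ultimately show "index.step c c'" using assms(1) by (auto simp: index.step_def)
  }
qed

lemma walk_label:
  assumes "index.walk f l (number init) (number fin)"
  shows "label (f 0) = init" "label (f l) = fin"
    "t \<le> l \<Longrightarrow> configuration G k (label (f t))"
    "t < l \<Longrightarrow> one_transition G k (label (f t)) (label (f (Suc t)))"
proof -
  note c = index.walk_conf[OF assms index.conf_init]
  show "label (f 0) = init" "label (f l) = fin"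
    using assms conf_number(2) instD by (simp_all add: index.walk_def)
  show "t \<le> l \<Longrightarrow> configuration G k (label (f t))" using c conf_label by blast
  show "t < l \<Longrightarrow> one_transition G k (label (f t)) (label (f (Suc t)))"
    using step_iff[OF c[of t] c[of "Suc t"]] assms by (simp add: index.walk_def)
qed

lemma walk_number:
  assumes "g 0 = init" "g l = fin" "\<And>t. t < l \<Longrightarrow> one_transition G k (g t) (g (Suc t))"
  shows "index.walk (\<lambda>t. number (g t)) l (number init) (number fin)"
proof -
  have "index.step (number (g t)) (number (g (Suc t)))" if "t < l" for t
  proof -
    have c: "configuration G k (g t)" "configuration G k (g (Suc t))"
      using assms(3)[OF that] by (auto simp: one_transition_def)
    show ?thesis
      using step_iff[OF conf_number(1)[OF c(1)] conf_number(1)[OF c(2)]] assms(3)[OF that]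
      unfolding conf_number(2)[OF c(1)] conf_number(2)[OF c(2)] by blast
  qed
  then show ?thesis using assms(1,2) by (simp add: index.walk_def)
qed

lemma can_reach_iff: "can_reach G k init fin \<longleftrightarrow> (\<exists>f l. 1 \<le> l \<and> index.walk f l (number init) (number fin))"
proof
  assume "can_reach G k init fin"
  then obtain l confs where l: "1 \<le> l" "confs ! 0 = init" "confs ! l = fin"
    "\<forall>i < l. one_transition G k (confs ! i) (confs ! Suc i)"
    by (auto simp: can_reach_def l_transition_def)
  then have "index.walk (\<lambda>t. number (confs ! t)) l (number init) (number fin)"
    by (intro walk_number) auto
  with l(1) show "\<exists>f l. 1 \<le> l \<and> index.walk f l (number init) (number fin)" by blast
next
  assume "\<exists>f l. 1 \<le> l \<and> index.walk f l (number init) (number fin)"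
  then obtain f l where l: "1 \<le> l" and w: "index.walk f l (number init) (number fin)" by blast
  let ?confs = "map (\<lambda>t. label (f t)) [0..<Suc l]"
  have nth: "?confs ! t = label (f t)" if "t \<le> l" for t
    using that by (simp add: less_Suc_eq_le nth_append)
  have "l_transition G k l init fin" unfolding l_transition_def
  proof (intro exI[of _ ?confs] conjI)
    show "\<forall>c \<in> set ?confs. configuration G k c" using walk_label(3)[OF w] by auto
    show "\<forall>i < l. one_transition G k (?confs ! i) (?confs ! Suc i)"
      using walk_label(4)[OF w] nth by simp
  qed (use nth walk_label(1,2)[OF w] in \<open>simp_all del: upt_Suc map_map\<close>)
  with l show "can_reach G k init fin" by (auto simp: can_reach_def)
qed

section \<open>Shortest walks and paths in the configuration graph\<close>

abbreviation "path_of p \<equiv> vpath p (with_proj (config_graph G k)) \<and> hd p = init \<and> last p = fin"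

lemma path_walk:
  assumes "path_of p"
  shows "index.walk (\<lambda>t. number (p ! t)) (length p - 1) (number init) (number fin)"
proof (rule walk_number)
  have p: "p \<noteq> []" "\<And>i. Suc i < length p \<Longrightarrow> (p ! i, p ! Suc i) \<in> parcs (config_graph G k)"
    using assms by (auto simp: vpath_def vwalk_def vwalk_arcs_subset_iff)
  show "p ! 0 = init" "p ! (length p - 1) = fin" using assms p(1) by (auto simp: hd_conv_nth last_conv_nth)
  show "one_transition G k (p ! t) (p ! Suc t)" if "t < length p - 1" for t
    using p(2)[of t] that by (auto simp: config_graph_def)
qed

text \<open>A path must not repeat vertices: if \<open>f a = f b\<close>, cutting out the segment
  between them would leave a shorter walk. Conversely, by \<open>path_walk\<close> every path is a
  walk, so minimality among walks gives minimality among paths.\<close>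

lemma minimal_walk_path:
  assumes w: "index.walk f l (number init) (number fin)"
    and min: "\<And>f' l'. index.walk f' l' (number init) (number fin) \<Longrightarrow> l \<le> l'"
  shows "shortest_path G k init fin (map (\<lambda>t. label (f t)) [0..<Suc l])"
proof -
  let ?p = "map (\<lambda>t. label (f t)) [0..<Suc l]"
  have nth: "?p ! t = label (f t)" if "t \<le> l" for t
    using that by (simp add: less_Suc_eq_le nth_append)
  have p: "?p \<noteq> []" "length ?p = Suc l" by simp_all
  have neq: "f a \<noteq> f b" if ab: "a < b" "b \<le> l" for a b
  proof
    assume eq: "f a = f b"
    let ?g = "\<lambda>t. if t \<le> a then f t else f (t + (b - a))"
    have "index.walk ?g (l - (b - a)) (number init) (number fin)"
      unfolding index.walk_def
    proof (intro conjI allI impI)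
      show "?g 0 = number init" using w by (simp add: index.walk_def)
      show "?g (l - (b - a)) = number fin"
        using w ab eq by (cases "b = l") (auto simp: index.walk_def)
      fix t assume t: "t < l - (b - a)"
      consider "t < a" | "t = a" | "a < t" by linarith
      then show "index.step (?g t) (?g (Suc t))"
      proof cases
        case 2
        have "index.step (f b) (f (Suc b))" using w t 2 ab by (simp add: index.walk_def)
        then show ?thesis using 2 eq ab by simp
      qed (use w t ab in \<open>simp_all add: index.walk_def\<close>)
    qed
    from min[OF this] show False using ab by simp
  qed
  have "label (f a) \<noteq> label (f b)" if "a < b" "b \<le> l" for a b
    using neq[OF that] conf_label[OF index.walk_conf[OF w index.conf_init, of a]]
      conf_label[OF index.walk_conf[OF w index.conf_init, of b]] that by (metis less_imp_le le_trans)
  then have "?p ! a \<noteq> ?p ! b" if "a < b" "b < length ?p" for a b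
    using that nth[of a] nth[of b] by simp
  then have "distinct ?p" unfolding distinct_conv_nth by (metis linorder_neqE_nat)
  moreover have "vwalk ?p (with_proj (config_graph G k))"
  proof
    show "set ?p \<subseteq> verts (with_proj (config_graph G k))"
      using walk_label(3)[OF w] by (auto simp: config_graph_def)
    show "set (vwalk_arcs ?p) \<subseteq> arcs_ends (with_proj (config_graph G k))"
      unfolding vwalk_arcs_subset_iff
    proof (intro allI impI)
      fix i assume "Suc i < length ?p"
      then have "i < l" by simp
      then show "(?p ! i, ?p ! Suc i) \<in> arcs_ends (with_proj (config_graph G k))"
        using walk_label(4)[OF w, of i] nth[of i] nth[of "Suc i"] by (simp add: config_graph_def)
    qed
  qed simp
  moreover have "hd ?p = init" "last ?p = fin"
    using nth[of 0] nth[of l] walk_label(1,2)[OF w] p by (simp_all add: hd_conv_nth last_conv_nth del: upt_Suc)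
  ultimately have path: "path_of ?p" by blast
  have "\<not> vwalk_length q < vwalk_length ?p" if "path_of q" for q
    using min[OF path_walk[OF that]] p(2) by (simp del: upt_Suc)
  then show ?thesis using path unfolding shortest_path_def is_arg_min_def by blast
qed

definition base :: nat where
  "base = 10 + n * n + 2 * k + k * k + codes k + k * (n * codes k * k + k + 1)"

lemma encode_nth:
  defines "xs \<equiv> encode_instance vs G k init fin"
  shows "length xs = 2 + n * n + 2 * k" "xs ! 0 = n" "xs ! 1 = k"
    "u < n \<Longrightarrow> v < n \<Longrightarrow> xs ! (2 + u * n + v) = of_bool ((vs ! u, vs ! v) \<in> parcs G)"
    "i < k \<Longrightarrow> xs ! (2 + n * n + i) = number init ! i"
    "i < k \<Longrightarrow> xs ! (2 + n * n + k + i) = number fin ! i"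
proof -
  let ?rows = "map (\<lambda>u. map (\<lambda>v. of_bool ((u, v) \<in> parcs G)) vs) vs :: nat list list"
  let ?cells = "concat ?rows"
  have xs: "xs = [n, k] @ ?cells @ number init @ number fin" by (simp add: xs_def encode_instance_def)
  have uniform: "\<forall>x \<in> set ?rows. length x = n" by auto
  have cells: "length ?cells = n * n" using length_concat_uniform[OF uniform] by simp
  have len: "length init = k" "length fin = k" using instD(2,3) by (auto simp: configuration_def)
  show "length xs = 2 + n * n + 2 * k" "xs ! 0 = n" "xs ! 1 = k" using cells len by (simp_all add: xs)
  show "xs ! (2 + u * n + v) = of_bool ((vs ! u, vs ! v) \<in> parcs G)" if "u < n" "v < n"
  proof -
    have lt: "u * n + v < n * length ?rows" using cell_bound[OF that] by simp
    have "xs ! (2 + u * n + v) = ?cells ! (u * n + v)" using lt cells by (simp add: xs nth_append)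
    also have "\<dots> = ?rows ! ((u * n + v) div n) ! ((u * n + v) mod n)"
      by (rule concat_nth_uniform[OF uniform lt])
    also have "\<dots> = of_bool ((vs ! u, vs ! v) \<in> parcs G)"
    proof -
      have "n \<noteq> 0" using that by linarith
      then have "(u * n + v) div n = u" using that div_mult_self3[of n u v] by simp
      then show ?thesis using that by simp
    qed
    finally show ?thesis .
  qed
  show "xs ! (2 + n * n + i) = number init ! i" if "i < k"
    using that cells len by (simp add: xs nth_append)
  show "xs ! (2 + n * n + k + i) = number fin ! i" if "i < k"
    using that cells len by (simp add: xs nth_append)
qed

lemma exec_snake_prog:
  fixes W :: nat
  assumes W: "base + 8 * ((n * codes k * k + 2) * k + n * codes k * k + k + 2) + 100 \<le> W"
  shows "\<exists>t s. exec W snake_prog (initial_state (encode_instance vs G k init fin)) t s \<and>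
    correct_output vs G k init fin s \<and>
    t \<le> 10000 * (n * codes k * k * (n * (codes k * (k * k * (n * codes k * k)))))"
proof -
  let ?xs = "encode_instance vs G k init fin" let ?QM = "n * codes k * k"
  interpret snake_machine n k "adjacent G k vs" "number init" "number fin" W base ?QM
    using W by unfold_locales (auto simp: base_def)
  note xs = encode_nth
  define M where "M = snd (initial_state ?xs)"
  have init: "initial_state ?xs = (\<lambda>_. 0, M)" by (simp add: M_def initial_state_def)
  have M: "M a = (if a < length ?xs then ?xs ! a else 0)" for a by (simp add: M_def initial_state_def)
  \<comment> \<open>The input lies entirely below \<open>base\<close>, so all work arrays start out
    as zero.\<close>
  have len: "length ?xs < base" using xs(1) by (simp add: base_def)
  have view: "array_view base M 0 a = ?xs ! a" if "a < length ?xs" for a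
    using that len by (simp add: array_view_def M)
  have "input (array_view base M)" unfolding input_def
  proof (intro conjI allI impI)
    show "array_view base M 0 0 = n" "array_view base M 0 1 = k" using view xs(1-3) by simp_all
    show "array_view base M aD 0 = 0" using len by (simp add: array_view_def address_def M)
    fix i assume "i < k"
    then show "array_view base M 0 (2 + n * n + i) = number init ! i"
      "array_view base M 0 (2 + n * n + k + i) = number fin ! i"
      using view xs(1,5,6) by simp_all
  next
    fix u v assume uv: "u < n" "v < n"
    have "u * n + v < n * n" by (rule cell_bound[OF uv])
    then have eq: "array_view base M 0 (2 + u * n + v) = of_bool ((vs ! u, vs ! v) \<in> parcs G)"
      using view[of "2 + u * n + v"] xs(1) xs(4)[OF uv] by simp
    then show "array_view base M 0 (2 + u * n + v) \<le> 1" by simp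
    have "2 div Suc k \<noteq> 0 \<longleftrightarrow> k = 1" using instD(1) by (auto simp: div_eq_0_iff)
    then show "array_view base M 0 (2 + u * n + v) + 2 div Suc k \<noteq> 0 \<longleftrightarrow> adjacent G k vs u v"
      unfolding eq adjacent_def by auto
  qed
  from runs_snake[OF this, of "var_view (\<lambda>_. 0)"] obtain t R' M' where
    t: "t \<le> 10000 * (?QM * (n * (codes k * (k * k * ?QM))))" and
    ex: "exec W snake_prog (\<lambda>_. 0, M) t (R', M')" and res: "correct_result (array_view base M')"
    by (rule runsD)
  have low: "M' a = array_view base M' 0 a" if "a < base" for a using that by (simp add: array_view_def)
  have reach: "reachable \<longleftrightarrow> can_reach G k init fin" by (simp add: reachable_def can_reach_iff)
  have M0: "M' 0 = of_bool (can_reach G k init fin)"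
    using res low[of 0] reach by (simp add: correct_result_def base_def)
  have M1: "M' 1 = array_view base M' 0 1" by (rule low) (simp add: base_def)
  have "correct_output vs G k init fin (R', M')"
  proof (cases "number fin \<noteq> number init \<and> \<not> reachable")
    case True
    then have "M' 1 = 0" using res M1 by (simp add: correct_result_def)
    then have out: "outputs (R', M') (encode_answer vs (can_reach G k init fin) [])"
      using M0 by (simp add: outputs_def encode_answer_def)
    \<comment> \<open>A path between different configurations has at least one arc, so it would
      witness \<open>reachable\<close>.\<close>
    have "\<not> shortest_path G k init fin p" for p
    proof
      assume "shortest_path G k init fin p"
      then have "path_of p" by (simp add: shortest_path_def is_arg_min_def)
      from path_walk[OF this] have w: "index.walk (\<lambda>t. number (p ! t)) (length p - 1) (number init) (number fin)" .
      then have "1 \<le> length p - 1" using True by (cases "length p - 1") (auto simp: index.walk_def)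
      with w True show False unfolding reachable_def by blast
    qed
    then show ?thesis using out by (auto simp: correct_output_def)
  next
    case False
    then obtain f l where w: "index.walk f l (number init) (number fin)" and l: "l \<le> ?QM + k"
      and num: "array_view base M' 0 1 = l + 1"
      and cells: "\<forall>t \<le> l. \<forall>i < k. array_view base M' 0 (2 + k * t + i) = f t ! i"
      and min: "\<forall>f' l'. index.walk f' l' (number init) (number fin) \<longrightarrow> l \<le> l'"
      using res unfolding correct_result_def by (auto split: if_splits)
    let ?p = "map (\<lambda>t. label (f t)) [0..<Suc l]"
    let ?fs = "map f [0..<Suc l]"
    have shortest: "shortest_path G k init fin ?p" using minimal_walk_path[OF w] min by blast
    have conf: "index.conf (f t)" if "t \<le> l" for t by (rule index.walk_conf[OF w index.conf_init that])
    have numbers: "map (index vs) (concat ?p) = concat ?fs"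
    proof -
      have eq: "number (label (f t)) = f t" if "t \<le> l" for t using conf[OF that] conf_label by blast
      have "map number ?p = map (\<lambda>t. number (label (f t))) [0..<Suc l]" by (simp only: map_map comp_def)
      also have "\<dots> = ?fs" by (rule map_cong[OF refl], rule eq) auto
      finally have "map number ?p = ?fs" .
      then show ?thesis by (simp only: map_concat)
    qed
    have uniform: "\<forall>x \<in> set ?fs. length x = k" using conf index.confD(1) by (auto simp: less_Suc_eq_le)
    have length: "length (concat ?fs) = k * Suc l" using length_concat_uniform[OF uniform] by simp
    have fit: "2 + k * Suc l \<le> base"
    proof -
      have "k * Suc l \<le> k * (?QM + k + 1)" using l by (intro mult_le_mono2) simp
      then show ?thesis unfolding base_def by linarith
    qed
    have "M' a = encode_answer vs (can_reach G k init fin) ?p ! a" if a: "a < 2 + k * Suc l" for a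
    proof -
      consider "a = 0" | "a = 1" | b where "a = 2 + b" "b < k * Suc l"
        using a by (metis One_nat_def add_2_eq_Suc add_less_cancel_left less_2_cases_iff nat_le_iff_add not_less)
      then show ?thesis
      proof cases
        case 3
        have "b div k \<le> l" using 3(2) by (metis less_Suc_eq_le less_mult_imp_div_less mult.commute)
        moreover have "b mod k < k" using instD(1) by simp
        ultimately have "array_view base M' 0 (2 + k * (b div k) + b mod k) = f (b div k) ! (b mod k)"
          using cells by blast
        moreover have "2 + k * (b div k) + b mod k = a" using 3(1) by simp
        ultimately have "M' a = f (b div k) ! (b mod k)" using low[of a] a fit by simp
        also have "\<dots> = ?fs ! (b div k) ! (b mod k)"
          using \<open>b div k \<le> l\<close> by (simp add: less_Suc_eq_le nth_append del: upt_Suc)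
        also have "\<dots> = concat ?fs ! b"
          by (rule concat_nth_uniform[OF uniform, symmetric]) (use 3(2) in simp)
        also have "\<dots> = encode_answer vs (can_reach G k init fin) ?p ! a"
          using 3(1) unfolding encode_answer_def numbers by simp
        finally show ?thesis .
      qed (use M0 M1 num in \<open>simp_all add: encode_answer_def\<close>)
    qed
    moreover have "length (encode_answer vs (can_reach G k init fin) ?p) = 2 + k * Suc l"
      using length unfolding encode_answer_def numbers by simp
    ultimately have "outputs (R', M') (encode_answer vs (can_reach G k init fin) ?p)"
      using outputsI[of _ "(R', M')"] by (simp only: snd_conv)
    then show ?thesis using shortest unfolding correct_output_def by auto
  qed
  then show ?thesis using ex t init by auto
qed

end

section \<open>Word size and running time\<close>

text \<open>With \<open>Y = k ^ k * n\<close>, the numbers \<open>n\<close>, \<open>k\<close> and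
  \<open>k ^ k\<close> are at most \<open>Y\<close>. Hence \<open>codes k\<close> is at most
  \<open>Y ^ 2\<close>, the queue bound at most \<open>Y ^ 4\<close> and its size in cells at most
  \<open>Y ^ 5\<close>. Every term is thus a multiple of \<open>Y ^ 5\<close>, up to
  \<open>\<le>\<close>, and the coefficients sum to less than 1000.\<close>

lemma word_size_bound:
  fixes n k c :: nat
  assumes "1 \<le> n" "1 \<le> k" "1000 \<le> c"
  shows "10 + n * n + 2 * k + k * k + codes k + k * (n * codes k * k + k + 1)
    + 8 * ((n * codes k * k + 2) * k + n * codes k * k + k + 2) + 100 \<le> max_word c k n"
proof -
  define Y where "Y = k ^ k * n"
  have kk: "k \<le> k ^ k" "1 \<le> k ^ k"
    using power_increasing[of 1 k k] assms by simp_all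
  have "k ^ k * 1 \<le> Y" unfolding Y_def using assms by (intro mult_le_mono2) simp
  then have k: "k \<le> Y" "k ^ k \<le> Y" using kk by simp_all
  have n: "n \<le> Y" unfolding Y_def using kk by simp
  have Y: "1 \<le> Y" using n assms by simp
  have C: "codes k \<le> Y * Y"
    unfolding codes_def power_mult_distrib using k(2) by (intro mult_le_mono)
  have P: "Y ^ i \<le> Y ^ 5" if "i \<le> 5" for i using Y that by (rule power_increasing[rotated])
  have p: "1 \<le> Y ^ 5" "Y \<le> Y ^ 5" "Y * Y \<le> Y ^ 5" using P[of 0] P[of 1] P[of 2] by (simp_all add: power2_eq_square)
  have QM: "n * codes k * k \<le> Y * (Y * Y) * Y" using n C k by (intro mult_le_mono)
  have pow: "Y * (Y * Y) * Y = Y ^ 4" "Y * (Y * Y) * Y * Y = Y ^ 5"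
    by (simp_all add: eval_nat_numeral)
  have QM4: "n * codes k * k \<le> Y ^ 5" using QM P[of 4] pow by linarith
  have QMk: "n * codes k * k * k \<le> Y ^ 5"
    using mult_le_mono[OF QM k(1)] pow by linarith
  have kk2: "k * k \<le> Y ^ 5" "n * n \<le> Y ^ 5"
    using mult_le_mono[OF k(1) k(1)] mult_le_mono[OF n n] p(3) by linarith+
  have C': "codes k \<le> Y ^ 5" "k \<le> Y ^ 5" using C p k by linarith+
  have "10 + n * n + 2 * k + k * k + codes k + k * (n * codes k * k + k + 1)
      + 8 * ((n * codes k * k + 2) * k + n * codes k * k + k + 2) + 100
    = 126 + n * n + 27 * k + 2 * (k * k) + codes k + 9 * (n * codes k * k * k) + 8 * (n * codes k * k)"
    by (simp add: algebra_simps)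
  also have "\<dots> \<le> 1000 * Y ^ 5" using p QM4 QMk kk2 C' by linarith
  also have "\<dots> \<le> c * Y ^ c"
    using assms(3) Y by (intro mult_le_mono power_increasing) simp_all
  finally show ?thesis by (simp add: max_word_def Y_def)
qed

text \<open>The queue bound enters twice, once for expansions and once for each scan; together with
  the \<open>n\<close> heads and the loop over codes this gives
  \<open>n ^ 3 * codes k ^ 3 * k ^ 4\<close>. As \<open>codes k = k ^ (2 * k)\<close>, the power of
  \<open>k\<close> is \<open>6 * k + 4 \<le> 10 * k\<close>. The logarithmic factor is at least 1
  because \<open>2 \<le> n\<close>.\<close>

lemma running_time_bound:
  fixes n k c t :: nat
  assumes t: "t \<le> 10000 * (n * codes k * k * (n * (codes k * (k * k * (n * codes k * k)))))"
    and "2 \<le> n" "1 \<le> k" "10000 \<le> c"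
  shows "real t \<le> real c * real k ^ (c * k) * real n ^ 3 * (log 2 (real n))\<^sup>2"
proof -
  have C: "codes k = k ^ (2 * k)" by (simp add: codes_def power_mult power2_eq_square)
  have "n * codes k * k * (n * (codes k * (k * k * (n * codes k * k)))) = n ^ 3 * (codes k ^ 3 * k ^ 4)"
    by (simp add: eval_nat_numeral mult_ac)
  also have "codes k ^ 3 * k ^ 4 = k ^ (6 * k + 4)" by (simp add: C power_add flip: power_mult)
  finally have t': "t \<le> 10000 * (n ^ 3 * k ^ (6 * k + 4))" using t by simp
  have "6 * k + 4 \<le> 10 * k" using assms(3) by simp
  also have "\<dots> \<le> c * k" using assms(4) by (intro mult_le_mono1) simp
  finally have "k ^ (6 * k + 4) \<le> k ^ (c * k)" using assms(3) by (intro power_increasing) simp_all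
  then have "10000 * (n ^ 3 * k ^ (6 * k + 4)) \<le> c * (n ^ 3 * k ^ (c * k))"
    using assms(4) by (intro mult_le_mono) simp_all
  with t' have "t \<le> c * (n ^ 3 * k ^ (c * k))" by linarith
  then have "real t \<le> real (c * (n ^ 3 * k ^ (c * k)))" by (rule of_nat_mono)
  also have "\<dots> = (real c * real k ^ (c * k) * real n ^ 3) * 1" by simp
  also have "\<dots> \<le> (real c * real k ^ (c * k) * real n ^ 3) * (log 2 (real n))\<^sup>2"
  proof (rule mult_left_mono)
    have "1 \<le> log 2 (real n)" using assms(2) by simp
    then show "1 \<le> (log 2 (real n))\<^sup>2" by simp
  qed simp
  finally show ?thesis .
qed

text \<open>One constant serves as time factor, as exponent and as word parameter. The value 10000
  is the factor in \<open>runs_snake\<close>; it also exceeds the 10 required in the exponent and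
  the 1000 required by \<open>word_size_bound\<close>.\<close>

theorem theorem3p22:
  shows "\<exists>(P :: prog) (c :: nat).
    \<forall>(G :: nat pair_pre_digraph) (k :: nat) (init :: nat list) (fin :: nat list) (vs :: nat list).
      snake_instance G k init fin \<and> distinct vs \<and> set vs = pverts G \<longrightarrow>
      (\<exists>t s. exec (max_word c k (card (pverts G))) P
                (initial_state (encode_instance vs G k init fin)) t s \<and>
             correct_output vs G k init fin s \<and>
             (card (pverts G) \<ge> 2 \<longrightarrow>
                real t \<le> real c * real k ^ (c * k) * real (card (pverts G)) ^ 3
                          * (log 2 (real (card (pverts G)))) ^ 2))"
proof (rule exI[of _ snake_prog], rule exI[of _ 10000], intro allI impI)
  fix G :: "nat pair_pre_digraph" and k :: nat and init fin vs :: "nat list"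
  assume asm: "snake_instance G k init fin \<and> distinct vs \<and> set vs = pverts G"
  then interpret numbered_instance G k init fin vs by unfold_locales auto
  have card: "card (pverts G) = length vs" using asm distinct_card by metis
  have pos: "1 \<le> length vs" "1 \<le> k"
    using instD index.confD(5)[OF index.conf_init, of 0] by auto
  have "base + 8 * ((length vs * codes k * k + 2) * k + length vs * codes k * k + k + 2) + 100
      \<le> max_word 10000 k (length vs)"
    unfolding base_def using word_size_bound[OF pos] by simp
  from exec_snake_prog[OF this] show "\<exists>t s. exec (max_word 10000 k (card (pverts G))) snake_prog
      (initial_state (encode_instance vs G k init fin)) t s \<and> correct_output vs G k init fin s \<and>
      (card (pverts G) \<ge> 2 \<longrightarrow> real t \<le> real 10000 * real k ^ (10000 * k) * real (card (pverts G)) ^ 3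
                          * (log 2 (real (card (pverts G)))) ^ 2)"
    unfolding card using running_time_bound[OF _ _ pos(2) order_refl] by blast
qed

end
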